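(* The value function $V$ is continuous on $D$ and uniformly continuous on every compact set $\mathfrak D\subset D$.
   Context: Model. Fix $T>0$ and constants $p>0$ (premium rate), $c>0$ (discount factor). On a probability space $(\Omega,\mathscr F,\mathbb P)$, let $N=(N_t)_{t\ge0}$ be a renewal counting process with jump times $\sigma_n$ ($\sigma_0=0$) and i.i.d. waiting times $T_i=\sigma_i-\sigma_{i-1}$ with distribution function $F$ on $[0,\infty)$ and density $f$; put $\bar F=1-F$. Let $(U_i)_{i\ge1}$ (claim sizes) be i.i.d., independent of $N$, with distribution function $G$ on $[0,\infty)$. Standing assumption: $F$ and $G$ are continuous on $[0,\infty)$; there is a continuous bounded function $\lambda:[0,\infty)\to[0,\infty)$ with $\bar F(t)=\exp(-\int_0^t\lambda(u)du)$, $\lambda(t)=f(t)/\bar F(t)>0$ for $t\in[0,T]$; and there is $\Lambda>0$ with $\lambda(w)\le\Lambda$ for $w\in[0,T]$. Put $Q_t=\sum_{i=1}^{N_t}U_i$, $W_t=t-\sigma_{N_t}$, and let $(\mathscr F_t)$ be the $\mathbb P$-augmented filtration generated by $N,Q,W$. For $s\in[0,T]$, $w\in[0,s]$, let $\mathbb P_{sw}=\mathbb P[\,\cdot\,|W_s=w]$ (regular conditional probability) and $N^{s,w}_t=N_t-N_s$ for $t\in[s,T]$; under $\mathbb P_{sw}$ this is a delayed renewal process: the first claim after $s$ occurs at time $s+T_1^{s,w}$, where $\mathbb P_{sw}\{T_1^{s,w}>t\}=\exp(-\int_w^{w+t}\lambda(u)du)$, and later waiting times are independent with law $F$. Put $Q^{s,w}_t=\sum_{i=1}^{N^{s,w}_t}U_i$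 and $W^{s,w}_t=w+W_t-W_s$. Strategies and value function. Given $(s,x,w)$ with $x\ge0$, a dividend strategy $\pi=(L_t)$ gives the cumulative dividends $L_t=L_t^\pi$ paid from time $s$ to time $t$ ($L_s=0$; $L_{t+}$ includes a lump sum paid at time $t$, also for $t=T$). The wealth is $X^\pi_t=x+p(t-s)-Q^{s,w}_t-L_t$ and the ruin time is $\tau^\pi=\inf\{t\ge s:X^\pi_t<0\}$ ($\inf\emptyset=\infty$). $\pi$ is admissible, $\pi\in U_{ad}^{x,w}[s,T]$, if $L$ is $(\mathscr F_t)_{t\ge s}$-predictable, nondecreasing, càglàd, and dividends cannot cause bankruptcy: $L_t\le L_{t+}\le x+p(t-s)-Q^{s,w}_t$ for every $t\in[s,T]$ with $t<\tau^\pi$, and no dividends are paid at or after ruin. With $\mathbb E_{sxw}$ the expectation under $\mathbb P_{sw}$ with $X_s=x$, and $\int_s^{b+}$ denoting the integral over $[s,b]$ (lump sums at $s$ and $b$ included), $$J(s,x,w;\pi)=\mathbb E_{sxw}\Big[\int_s^{(\tau^\pi\wedge T)+}e^{-c(t-s)}dL_t^\pi\Big],\qquad V(s,x,w)=\sup_{\pi\in U_{ad}^{x,w}[s,T]}J(s,x,w;\pi).$$ The domain is $D=\{(s,x,w):0\le s\le T,\ x\ge0,\ 0\le w\le s\}$.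
   Formalization: The filtration is augmented by the null sets of P_sw, not of P; Q^{s,w} sums the claims occurring after s (U_{N_s+i}), not U_1, U_2, ...; P_sw is the version with W_s=w and the delayed renewal law, independent of the past up to s, at every w. *)

theory Defs
  imports "HOL-Probability.Probability"
begin

text \<open>
  Waiting times \<open>\<xi> i\<close> and claim sizes \<open>U i\<close> are indexed by \<open>i \<ge> 1\<close>; index 0 is never used.
\<close>

definition jump_time :: "(nat \<Rightarrow> 'a \<Rightarrow> real) \<Rightarrow> nat \<Rightarrow> 'a \<Rightarrow> real" where
  "jump_time \<xi> n \<omega> = (\<Sum>i=1..n. \<xi> i \<omega>)"

definition claim_count :: "(nat \<Rightarrow> 'a \<Rightarrow> real) \<Rightarrow> real \<Rightarrow> 'a \<Rightarrow> nat" where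
  "claim_count \<xi> t \<omega> = card {n. 1 \<le> n \<and> jump_time \<xi> n \<omega> \<le> t}"

definition total_claims ::
  "(nat \<Rightarrow> 'a \<Rightarrow> real) \<Rightarrow> (nat \<Rightarrow> 'a \<Rightarrow> real) \<Rightarrow> real \<Rightarrow> 'a \<Rightarrow> real" where
  "total_claims \<xi> U t \<omega> = (\<Sum>i=1..claim_count \<xi> t \<omega>. U i \<omega>)"

definition elapsed_time :: "(nat \<Rightarrow> 'a \<Rightarrow> real) \<Rightarrow> real \<Rightarrow> 'a \<Rightarrow> real" where
  "elapsed_time \<xi> t \<omega> = t - jump_time \<xi> (claim_count \<xi> t \<omega>) \<omega>"


definition count_after :: "(nat \<Rightarrow> 'a \<Rightarrow> real) \<Rightarrow> real \<Rightarrow> real \<Rightarrow> 'a \<Rightarrow> nat" where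
  "count_after \<xi> s t \<omega> = claim_count \<xi> t \<omega> - claim_count \<xi> s \<omega>"

definition waiting_after :: "(nat \<Rightarrow> 'a \<Rightarrow> real) \<Rightarrow> real \<Rightarrow> nat \<Rightarrow> 'a \<Rightarrow> real" where
  "waiting_after \<xi> s k \<omega> =
     (if k = 1 then jump_time \<xi> (claim_count \<xi> s \<omega> + 1) \<omega> - s
      else \<xi> (claim_count \<xi> s \<omega> + k) \<omega>)"

definition claim_after ::
  "(nat \<Rightarrow> 'a \<Rightarrow> real) \<Rightarrow> (nat \<Rightarrow> 'a \<Rightarrow> real) \<Rightarrow> real \<Rightarrow> nat \<Rightarrow> 'a \<Rightarrow> real" where
  "claim_after \<xi> U s k \<omega> = U (claim_count \<xi> s \<omega> + k) \<omega>"

text \<open>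
  Claims are relabelled from time \<open>s\<close> on, so this is the increment of \<^const>\<open>total_claims\<close> over \<open>(s,t]\<close>.
  Summing \<open>U 1, U 2, \<dots>\<close> themselves would reuse claims already observed before \<open>s\<close>.
\<close>

definition claims_after ::
  "(nat \<Rightarrow> 'a \<Rightarrow> real) \<Rightarrow> (nat \<Rightarrow> 'a \<Rightarrow> real) \<Rightarrow> real \<Rightarrow> real \<Rightarrow> 'a \<Rightarrow> real" where
  "claims_after \<xi> U s t \<omega> = (\<Sum>i=1..count_after \<xi> s t \<omega>. claim_after \<xi> U s i \<omega>)"


definition observation_events ::
  "'a set \<Rightarrow> (nat \<Rightarrow> 'a \<Rightarrow> real) \<Rightarrow> (nat \<Rightarrow> 'a \<Rightarrow> real) \<Rightarrow> real \<Rightarrow> 'a set set" where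
  "observation_events \<Omega> \<xi> U t =
     {(\<lambda>\<omega>. (real (claim_count \<xi> u \<omega>), total_claims \<xi> U u \<omega>, elapsed_time \<xi> u \<omega>)) -` B \<inter> \<Omega> |
        u B. 0 \<le> u \<and> u \<le> t \<and> B \<in> sets (borel :: (real \<times> real \<times> real) measure)}"

text \<open>
  The measure \<open>P\<close> providing the null sets is a parameter: a problem started from \<open>(s,w)\<close> is
  posed under the conditional law given that the elapsed time at \<open>s\<close> is \<open>w\<close>, and the filtration
  is augmented by the null sets of that law. For \<open>w < s\<close> the conditioning event is null for the
  unconditional law, whose null sets would therefore reveal the whole future at time \<open>s\<close>.
\<close>

definition augmented_filtration ::
  "'a measure \<Rightarrow> (nat \<Rightarrow> 'a \<Rightarrow> real) \<Rightarrow> (nat \<Rightarrow> 'a \<Rightarrow> real) \<Rightarrow> real \<Rightarrow> 'a measure" where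
  "augmented_filtration P \<xi> U t =
     sigma (space P) (observation_events (space P) \<xi> U t \<union> null_sets (completion P))"

definition predictable_algebra ::
  "'a set \<Rightarrow> (real \<Rightarrow> 'a measure) \<Rightarrow> real \<Rightarrow> (real \<times> 'a) measure" where
  "predictable_algebra \<Omega> \<F> s =
     sigma ({s..} \<times> \<Omega>)
       ({{s} \<times> A | A. A \<in> sets (\<F> s)} \<union>
        {{a<..b} \<times> A | a b A. s \<le> a \<and> a \<le> b \<and> A \<in> sets (\<F> a)})"

definition caglad_from :: "real \<Rightarrow> (real \<Rightarrow> real) \<Rightarrow> bool" where
  "caglad_from s g \<longleftrightarrow>
     (\<forall>t>s. (g \<longlongrightarrow> g t) (at_left t)) \<and> (\<forall>t\<ge>s. \<exists>l. (g \<longlongrightarrow> l) (at_right t))"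

definition right_lim :: "(real \<Rightarrow> real) \<Rightarrow> real \<Rightarrow> real" where
  "right_lim g t = Lim (at_right t) g"


text \<open>
  \<open>K s w\<close> is the conditional probability given that the elapsed time at \<open>s\<close> is \<open>w\<close>. A regular
  conditional probability is determined only for almost every \<open>w\<close>; the version meant here is the
  one for which, at \<^emph>\<open>every\<close> \<open>w\<close>, the elapsed time at \<open>s\<close> is \<open>w\<close> and the claim process
  after \<open>s\<close> is the delayed renewal process, independent of what was observed up to \<open>s\<close>.
\<close>

locale sparre_andersen = prob_space M
  for M :: "'a measure" +
  fixes T p c :: real
    and \<xi> U :: "nat \<Rightarrow> 'a \<Rightarrow> real"
    and F f G lam :: "real \<Rightarrow> real"
    and K :: "real \<Rightarrow> real \<Rightarrow> 'a measure"
  assumes T_pos: "0 < T" and p_pos: "0 < p" and c_pos: "0 < c"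
    and indep: "indep_vars (\<lambda>_. borel) (case_sum \<xi> U) (Inl ` {1..} \<union> Inr ` {1..})"
    and waiting_cdf: "\<And>i. 1 \<le> i \<Longrightarrow> cdf (distr M borel (\<xi> i)) = F"
    and waiting_density: "\<And>i. 1 \<le> i \<Longrightarrow> distributed M lborel (\<xi> i) (\<lambda>x. ennreal (f x))"
    and density_nonneg: "\<And>x. 0 \<le> f x"
    and claim_cdf: "\<And>i. 1 \<le> i \<Longrightarrow> cdf (distr M borel (U i)) = G"
    and F_neg: "\<And>x. x < 0 \<Longrightarrow> F x = 0" and G_neg: "\<And>x. x < 0 \<Longrightarrow> G x = 0"
    and F_cont: "continuous_on {0..} F" and G_cont: "continuous_on {0..} G"
    and intensity_cont: "continuous_on {0..} lam" and intensity_bounded: "bounded (lam ` {0..})"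
    and intensity_nonneg: "\<And>t. 0 \<le> t \<Longrightarrow> 0 \<le> lam t"
    and survival: "\<And>t. 0 \<le> t \<Longrightarrow> 1 - F t = exp (- integral {0..t} lam)"
    and intensity_eq: "\<And>t. t \<in> {0..T} \<Longrightarrow> lam t = f t / (1 - F t)"
    and intensity_pos: "\<And>t. t \<in> {0..T} \<Longrightarrow> 0 < lam t"
    and intensity_le: "\<exists>\<Lambda>>0. \<forall>w\<in>{0..T}. lam w \<le> \<Lambda>"
    and kernel: "\<And>s. s \<in> {0..T} \<Longrightarrow> K s \<in> measurable (restrict_space borel {0..s}) (prob_algebra M)"
    and disintegration: "\<And>s A B. s \<in> {0..T} \<Longrightarrow> A \<in> sets M \<Longrightarrow> B \<in> sets borel \<Longrightarrow>
        emeasure M (A \<inter> {\<omega> \<in> space M. elapsed_time \<xi> s \<omega> \<in> B}) =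
        (\<integral>\<^sup>+\<omega>. emeasure (K s (elapsed_time \<xi> s \<omega>)) A * indicator B (elapsed_time \<xi> s \<omega>) \<partial>M)"
    and cond_elapsed: "\<And>s w. s \<in> {0..T} \<Longrightarrow> w \<in> {0..s} \<Longrightarrow>
        AE \<omega> in K s w. elapsed_time \<xi> s \<omega> = w"
    and cond_indep: "\<And>s w. s \<in> {0..T} \<Longrightarrow> w \<in> {0..s} \<Longrightarrow>
        prob_space.indep_vars (K s w) (\<lambda>_. borel)
          (case_sum (waiting_after \<xi> s) (claim_after \<xi> U s)) (Inl ` {1..} \<union> Inr ` {1..})"
    and cond_indep_past: "\<And>s w. s \<in> {0..T} \<Longrightarrow> w \<in> {0..s} \<Longrightarrow>
        prob_space.indep_set (K s w)
          (sigma_sets (space M) (observation_events (space M) \<xi> U s))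
          (sigma_sets (space M)
            {case_sum (waiting_after \<xi> s) (claim_after \<xi> U s) i -` B \<inter> space M | i B.
               i \<in> Inl ` {1..} \<union> Inr ` {1..} \<and> B \<in> sets borel})"
    and cond_first_waiting: "\<And>s w t. s \<in> {0..T} \<Longrightarrow> w \<in> {0..s} \<Longrightarrow> 0 \<le> t \<Longrightarrow>
        measure (K s w) {\<omega> \<in> space M. waiting_after \<xi> s 1 \<omega> > t} = exp (- integral {w..w+t} lam)"
    and cond_later_waiting: "\<And>s w k. s \<in> {0..T} \<Longrightarrow> w \<in> {0..s} \<Longrightarrow> 2 \<le> k \<Longrightarrow>
        cdf (distr (K s w) borel (waiting_after \<xi> s k)) = F"
    and cond_claims: "\<And>s w k. s \<in> {0..T} \<Longrightarrow> w \<in> {0..s} \<Longrightarrow> 1 \<le> k \<Longrightarrow>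
        cdf (distr (K s w) borel (claim_after \<xi> U s k)) = G"


definition wealth ::
  "real \<Rightarrow> (nat \<Rightarrow> 'a \<Rightarrow> real) \<Rightarrow> (nat \<Rightarrow> 'a \<Rightarrow> real) \<Rightarrow> real \<Rightarrow> real \<Rightarrow>
   (real \<Rightarrow> 'a \<Rightarrow> real) \<Rightarrow> real \<Rightarrow> 'a \<Rightarrow> real" where
  "wealth p \<xi> U s x L t \<omega> = x + p * (t - s) - claims_after \<xi> U s t \<omega> - L t \<omega>"

definition ruin_time ::
  "real \<Rightarrow> (nat \<Rightarrow> 'a \<Rightarrow> real) \<Rightarrow> (nat \<Rightarrow> 'a \<Rightarrow> real) \<Rightarrow> real \<Rightarrow> real \<Rightarrow>
   (real \<Rightarrow> 'a \<Rightarrow> real) \<Rightarrow> 'a \<Rightarrow> ereal" where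
  "ruin_time p \<xi> U s x L \<omega> = Inf (ereal ` {t. s \<le> t \<and> wealth p \<xi> U s x L t \<omega> < 0})"

text \<open>
  A strategy is a process \<open>L t\<close> on \<open>t \<ge> s\<close> that is constant on \<open>t > T\<close>; its value there is the
  right limit at \<open>T\<close>, which carries the lump sum paid at \<open>T\<close>. Being constant from the ruin time
  on (the ruin time included) rules out a lump sum at ruin, since \<open>L\<close> is left continuous.
\<close>

definition admissible ::
  "'a measure \<Rightarrow> real \<Rightarrow> real \<Rightarrow> (nat \<Rightarrow> 'a \<Rightarrow> real) \<Rightarrow> (nat \<Rightarrow> 'a \<Rightarrow> real) \<Rightarrow>
   real \<Rightarrow> real \<Rightarrow> (real \<Rightarrow> 'a \<Rightarrow> real) set" where
  "admissible P T p \<xi> U s x =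
     {L. (\<lambda>(t, \<omega>). L t \<omega>) \<in>
           borel_measurable (predictable_algebra (space P) (augmented_filtration P \<xi> U) s) \<and>
         (AE \<omega> in P.
            L s \<omega> = 0 \<and> mono_on {s..} (\<lambda>t. L t \<omega>) \<and> caglad_from s (\<lambda>t. L t \<omega>) \<and>
            (\<forall>t>T. L t \<omega> = right_lim (\<lambda>u. L u \<omega>) T) \<and>
            (\<forall>t\<in>{s..T}. ereal t < ruin_time p \<xi> U s x L \<omega> \<longrightarrow>
               L t \<omega> \<le> right_lim (\<lambda>u. L u \<omega>) t \<and>
               right_lim (\<lambda>u. L u \<omega>) t \<le> x + p * (t - s) - claims_after \<xi> U s t \<omega>) \<and>
            (\<forall>u t. ruin_time p \<xi> U s x L \<omega> \<le> ereal u \<and> u \<le> t \<longrightarrow> L t \<omega> = L u \<omega>))}"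

text \<open>
  \<^const>\<open>interval_measure\<close> takes a right-continuous distribution function, hence the right limits; the jump at \<open>s\<close>
  from 0 to the right limit makes the lump sum at \<open>s\<close> an atom.
\<close>

definition dividend_measure :: "real \<Rightarrow> (real \<Rightarrow> real) \<Rightarrow> real measure" where
  "dividend_measure s g = interval_measure (\<lambda>t. if t < s then 0 else right_lim g t)"

definition expected_dividends ::
  "'a measure \<Rightarrow> real \<Rightarrow> real \<Rightarrow> real \<Rightarrow> (nat \<Rightarrow> 'a \<Rightarrow> real) \<Rightarrow> (nat \<Rightarrow> 'a \<Rightarrow> real) \<Rightarrow>
   real \<Rightarrow> real \<Rightarrow> (real \<Rightarrow> 'a \<Rightarrow> real) \<Rightarrow> real" where
  "expected_dividends P T p c \<xi> U s x L =
     (\<integral>\<omega>. (LINT t : {t. s \<le> t \<and> ereal t \<le> min (ruin_time p \<xi> U s x L \<omega>) (ereal T)}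
            | dividend_measure s (\<lambda>u. L u \<omega>). exp (- c * (t - s))) \<partial>completion P)"

definition value_function ::
  "(real \<Rightarrow> real \<Rightarrow> 'a measure) \<Rightarrow> real \<Rightarrow> real \<Rightarrow> real \<Rightarrow>
   (nat \<Rightarrow> 'a \<Rightarrow> real) \<Rightarrow> (nat \<Rightarrow> 'a \<Rightarrow> real) \<Rightarrow> real \<Rightarrow> real \<Rightarrow> real \<Rightarrow> real" where
  "value_function K T p c \<xi> U s x w =
     (SUP L \<in> admissible (K s w) T p \<xi> U s x. expected_dividends (K s w) T p c \<xi> U s x L)"

definition state_domain :: "real \<Rightarrow> (real \<times> real \<times> real) set" where
  "state_domain T = {(s, x, w). 0 \<le> s \<and> s \<le> T \<and> 0 \<le> x \<and> 0 \<le> w \<and> w \<le> s}"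

end

theory Submission
  imports Defs
begin

text \<open>
  Why the value function is continuous.  Given that the elapsed time at \<open>s\<close> is \<open>w\<close>, the claims after \<open>s\<close>
  form a random path of waiting times and claim sizes whose law does not depend on \<open>s\<close>, and in which
  only the first waiting time depends on \<open>w\<close>.  Strategies are causal functionals of this path, so the
  control problems for different \<open>(s, x, w)\<close> can all be posed over one set of controls.  Such a control, a
  \<^emph>\<open>rule\<close>, proposes at each rational time the dividends accumulated so far, as a function of the claims
  observed up to then.  The proposal is followed as long as it is affordable and payments stop for ever
  afterwards; at the horizon \<open>r = T - s\<close> all remaining wealth is paid out.  The set of rules is the same for
  every initial state, and the value function equals \<open>v (T - s) x w\<close>, the supremum over rules of the
  expected gain under the path law for \<open>w\<close> (\<open>value_eq\<close>, \<open>value_function_eq\<close>).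

  Discounting is an independent exponential clock: \<open>\<integral> exp (- c (t - s)) dL\<^sub>t\<close> is the mean of
  \<open>L (s + \<zeta>)\<close> for an exponential time \<open>\<zeta>\<close> (\<open>discounted_dividends\<close>).  Hence the gain is monotone in the cumulative
  dividends, and the two estimates in \<open>r\<close> and \<open>x\<close> below reduce to inequalities between dividends along
  one and the same path.

  \<^item> Horizon: changing \<open>r\<close> by \<open>\<delta>\<close> changes the value by at most \<open>p \<delta>\<close>, because a shorter problem can pay out at
    its end everything the longer one still had, except for the premiums of the extra time
    (\<open>dividends_shorter_horizon\<close>, \<open>dividends_longer_horizon\<close>).
  \<^item> Capital: a rule for \<open>x + h\<close> with its first \<open>h\<close> of payments withheld is a rule for \<open>x\<close>.  The smaller company
    is ruined earlier only before \<open>h\<close> has been paid, when it has not paid anything; so its surplus without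
    dividends has then entered \<open>[-h, 0)\<close> on first becoming negative
    (\<open>dividends_smaller_capital\<close>).  A given claim does this with small probability as \<open>G\<close> is continuous, and
    the number of claims up to \<open>T\<close> is tight uniformly in \<open>w\<close> (\<open>prob_shallow_ruin\<close>).
  \<^item> Elapsed time: the density of the first waiting time depends continuously on \<open>w\<close>, so its law is continuous in
    total variation, and gains are bounded (\<open>residual_excess_tendsto\<close>, \<open>v_age\<close>).

  For the identification with the value function, a rule becomes an admissible strategy by evaluating it
  on the observed claims (\<open>rule_strategy\<close>).  Conversely, a strategy is left continuous, hence determined by its
  values at rational times after \<open>s\<close>; each of these is almost surely a function of the observations before \<open>s\<close> and of
  the claims since \<open>s\<close>.  What happened before \<open>s\<close> is independent of the future, so by Fubini the
  strategy gains at most the mean of what the rules obtained by freezing the past gain (\<open>strategy_bound\<close>).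
\<close>

section \<open>Following a proposal while it is affordable\<close>

text \<open>
  The proposal \<open>a\<close> is tested against the budget \<open>B\<close> at rational times only, so that the test is measurable.
  Comparing the proposal at \<open>q1\<close> with the budget at every later \<open>q2\<close> makes insolvency irreversible also for
  proposals that decrease in time.
\<close>

definition solvent :: "(real \<Rightarrow> real) \<Rightarrow> (real \<Rightarrow> real) \<Rightarrow> real \<Rightarrow> bool" where
  "solvent B a q \<longleftrightarrow> (\<forall>q1\<in>\<rat>. \<forall>q2\<in>\<rat>. 0 < q1 \<and> q1 \<le> q2 \<and> q2 \<le> q \<longrightarrow> max 0 (a q1) \<le> B q2)"

text \<open>
  Cumulative dividends up to \<open>t\<close>, not including a lump sum at \<open>t\<close>: the strict inequality \<open>q < t\<close> makes this left
  continuous, as strategies are required to be.  A lump sum proposed at \<open>q\<close> is in force immediately after \<open>q\<close>.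
\<close>

definition payout :: "(real \<Rightarrow> real) \<Rightarrow> (real \<Rightarrow> real) \<Rightarrow> real \<Rightarrow> real" where
  "payout B a t = (SUP q\<in>{q\<in>\<rat>. 0 < q}. if q < t \<and> solvent B a q then max 0 (a q) else 0)"

lemma solventD:
  "solvent B a q \<Longrightarrow> q1 \<in> \<rat> \<Longrightarrow> q2 \<in> \<rat> \<Longrightarrow> 0 < q1 \<Longrightarrow> q1 \<le> q2 \<Longrightarrow> q2 \<le> q \<Longrightarrow> a q1 \<le> B q2"
  "solvent B a q \<Longrightarrow> q2 \<in> \<rat> \<Longrightarrow> 0 < q2 \<Longrightarrow> q2 \<le> q \<Longrightarrow> 0 \<le> B q2"
  unfolding solvent_def by (force, force)

lemma solventI:
  assumes "\<And>q1 q2. q1 \<in> \<rat> \<Longrightarrow> q2 \<in> \<rat> \<Longrightarrow> 0 < q1 \<Longrightarrow> q1 \<le> q2 \<Longrightarrow> q2 \<le> q \<Longrightarrow> a q1 \<le> B q2"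
    and "\<And>q2. q2 \<in> \<rat> \<Longrightarrow> 0 < q2 \<Longrightarrow> q2 \<le> q \<Longrightarrow> 0 \<le> B q2"
  shows "solvent B a q"
  using assms unfolding solvent_def by fastforce

lemma solvent_cong:
  assumes "\<And>u. u \<le> q \<Longrightarrow> B u = B' u" "\<And>u. u \<le> q \<Longrightarrow> a u = a' u"
  shows "solvent B a q \<longleftrightarrow> solvent B' a' q"
proof -
  have "max 0 (a q1) \<le> B q2 \<longleftrightarrow> max 0 (a' q1) \<le> B' q2" if "q1 \<le> q2" "q2 \<le> q" for q1 q2
    using assms(1)[of q2] assms(2)[of q1] that by simp
  then show ?thesis
    unfolding solvent_def by blast
qed

lemma rat_pos_nonempty: "{q\<in>\<rat>. 0 < (q::real)} \<noteq> {}"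
  using Rats_1 zero_less_one by blast

lemma rat_between:
  fixes u t :: real
  assumes "u < t"
  obtains q where "q \<in> \<rat>" "u < q" "q < t"
  using Rats_dense_in_real[OF assms] by blast

locale bounded_budget =
  fixes B :: "real \<Rightarrow> real" and \<beta> :: real
  assumes upper: "\<And>q. B q \<le> \<beta>" and upper_nonneg: "0 \<le> \<beta>"
begin

lemma payout_bdd:
  "bdd_above ((\<lambda>q. if q < t \<and> solvent B a q then max 0 (a q) else 0) ` {q\<in>\<rat>. 0 < q})"
proof (rule bdd_aboveI2)
  fix q :: real assume "q \<in> {q\<in>\<rat>. 0 < q}"
  then show "(if q < t \<and> solvent B a q then max 0 (a q) else 0) \<le> \<beta>"
    using solventD(1)[of B a q q q] upper[of q] upper_nonneg by auto
qed

lemma payout_nonneg: "0 \<le> payout B a t"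
proof -
  have "(if 1 < t \<and> solvent B a 1 then max 0 (a 1) else 0) \<le> payout B a t"
    unfolding payout_def by (rule cSUP_upper[OF _ payout_bdd]) auto
  then show ?thesis
    by (smt (verit))
qed

lemma payout_upper:
  assumes "q \<in> \<rat>" "0 < q" "q < t" "solvent B a q"
  shows "a q \<le> payout B a t"
proof -
  have "(if q < t \<and> solvent B a q then max 0 (a q) else 0) \<le> payout B a t"
    unfolding payout_def by (rule cSUP_upper[OF _ payout_bdd]) (use assms in auto)
  then show ?thesis
    using assms by auto
qed

lemma payout_least:
  assumes "\<And>q. q \<in> \<rat> \<Longrightarrow> 0 < q \<Longrightarrow> q < t \<Longrightarrow> solvent B a q \<Longrightarrow> a q \<le> z" and "0 \<le> z"
  shows "payout B a t \<le> z"
  unfolding payout_def by (rule cSUP_least[OF rat_pos_nonempty]) (use assms in auto)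

lemma payout_le: "payout B a t \<le> \<beta>"
  by (rule payout_least) (use solventD(1) upper upper_nonneg in \<open>force intro: order_trans\<close>)+

lemma payout_mono: "t \<le> t' \<Longrightarrow> payout B a t \<le> payout B a t'"
  by (rule payout_least) (auto intro: payout_upper payout_nonneg)

lemma payout_zero: "t \<le> 0 \<Longrightarrow> payout B a t = 0"
  by (rule antisym[OF payout_least payout_nonneg]) auto

lemma payout_less_ex:
  assumes "z < payout B a t" "0 \<le> z"
  obtains q where "q \<in> \<rat>" "0 < q" "q < t" "solvent B a q" "z < a q"
proof -
  have "\<not> (\<forall>q. q \<in> \<rat> \<longrightarrow> 0 < q \<longrightarrow> q < t \<longrightarrow> solvent B a q \<longrightarrow> a q \<le> z)"
    using payout_least[of t a z] assms by (meson not_le)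
  then show ?thesis
    using that by (meson not_le)
qed

lemma payout_at_left: "(payout B a \<longlongrightarrow> payout B a t) (at_left t)"
proof (rule increasing_tendsto)
  show "\<forall>\<^sub>F u in at_left t. payout B a u \<le> payout B a t"
    by (auto simp: eventually_at_left_field intro!: payout_mono exI[of _ "t - 1"])
next
  fix z assume z: "z < payout B a t"
  show "\<forall>\<^sub>F u in at_left t. z < payout B a u"
  proof (cases "z < 0")
    case True
    then show ?thesis
      using payout_nonneg by (auto intro!: always_eventually intro: less_le_trans)
  next
    case False
    then obtain q where q: "q \<in> \<rat>" "0 < q" "q < t" "solvent B a q" "z < a q"
      using z payout_less_ex[of z a t] by (metis not_le)
    have "z < payout B a u" if "q < u" for u
      using payout_upper[OF q(1,2) that q(4)] q(5) by simp
    then show ?thesis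
      using q(3) by (auto simp: eventually_at_left_field)
  qed
qed

lemma payout_measurable: "payout B a \<in> borel_measurable borel"
  by (rule borel_measurable_mono) (auto simp: mono_def payout_mono)

end

lemma payout_comparison:
  assumes "bounded_budget B \<beta>" "bounded_budget B' \<beta>'" "0 \<le> \<delta>"
    and "\<And>q. q \<in> \<rat> \<Longrightarrow> 0 < q \<Longrightarrow> q < t \<Longrightarrow> solvent B a q \<Longrightarrow> a q \<le> payout B' a' t + \<delta>"
  shows "payout B a t \<le> payout B' a' t + \<delta>"
  using bounded_budget.payout_least[OF assms(1) assms(4)]
    bounded_budget.payout_nonneg[OF assms(2), of a' t] assms(3) by simp

text \<open>
  This covers what happens after the horizon, where the budget and the proposal are frozen.
\<close>

lemma payout_tail_constant:
  assumes "bounded_budget B \<beta>"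
    and B: "\<And>q. r \<le> q \<Longrightarrow> B q = B r" and a: "\<And>q. r \<le> q \<Longrightarrow> a q = a r" and "0 \<le> r" "r < t" "r < t'"
  shows "payout B a t = payout B a t'"
proof -
  interpret bounded_budget B \<beta> by fact
  have *: "payout B a t \<le> payout B a t'" if t: "r < t" "r < t'" for t t'
  proof (rule payout_least[OF _ payout_nonneg])
    fix q assume q: "q \<in> \<rat>" "0 < q" "q < t" "solvent B a q"
    show "a q \<le> payout B a t'"
    proof (cases "q < t'")
      case True
      then show ?thesis using q payout_upper by blast
    next
      case False
      obtain q' where q': "q' \<in> \<rat>" "r < q'" "q' < t'"
        using rat_between[OF t(2)] by blast
      have "solvent B a q'"
        using q(4) q' False \<open>0 \<le> r\<close> unfolding solvent_def by auto
      then have "a q' \<le> payout B a t'"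
        using q' \<open>0 \<le> r\<close> by (intro payout_upper) auto
      then show ?thesis
        using a[of q] a[of q'] q' False by simp
    qed
  qed
  show ?thesis
    using *[of t t'] *[of t' t] assms by auto
qed

text \<open>
  A surplus without dividends grows between finitely many claims, so it is right continuous and does not
  decrease immediately after any time.  Both conditions together ensure that the wealth is negative at the ruin time
  itself, and not merely at times arbitrarily soon after it.
\<close>

locale surplus_budget = bounded_budget +
  assumes right_cont: "\<And>t. 0 \<le> t \<Longrightarrow> (B \<longlongrightarrow> B t) (at_right t)"
    and right_incr: "\<And>t. 0 \<le> t \<Longrightarrow> \<exists>d>0. \<forall>u. t \<le> u \<and> u < t + d \<longrightarrow> B t \<le> B u"
begin

lemma right_limit_ge:
  assumes "0 \<le> t" "t < q" "\<And>q'. q' \<in> \<rat> \<Longrightarrow> t < q' \<Longrightarrow> q' < q \<Longrightarrow> z \<le> B q'"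
  shows "z \<le> B t"
proof (rule ccontr)
  assume "\<not> z \<le> B t"
  then have "\<forall>\<^sub>F u in at_right t. B u < z"
    using right_cont[OF assms(1)] by (auto simp: order_tendsto_iff)
  then obtain b where b: "t < b" "\<And>u. t < u \<Longrightarrow> u < b \<Longrightarrow> B u < z"
    unfolding eventually_at_right_field by blast
  obtain q' where "q' \<in> \<rat>" "t < q'" "q' < min b q"
    using rat_between[of t "min b q"] b(1) assms(2) by auto
  then show False
    using b(2)[of q'] assms(3)[of q'] by auto
qed

text \<open>
  Solvency is a condition at rational times; right continuity of the budget carries it over to all earlier times.
\<close>

lemma solvent_budget_ge:
  assumes "solvent B a q" "0 \<le> t" "t < q"
  shows "payout B a t \<le> B t"
proof (rule payout_least)
  show "0 \<le> B t"
    by (rule right_limit_ge[OF assms(2,3)]) (use solventD[OF assms(1)] assms(2,3) in auto)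
next
  fix q1 assume "q1 \<in> \<rat>" "0 < q1" "q1 < t" "solvent B a q1"
  then show "a q1 \<le> B t"
    by (intro right_limit_ge[OF assms(2,3)] solventD[OF assms(1)]) auto
qed

text \<open>
  If some later time is solvent, the budget covers the payout up to that time.  Otherwise the payout
  grows at most by a lump sum at \<open>t\<close>, which the budget at \<open>t\<close> covers, and the budget does not decrease
  right after \<open>t\<close>.
\<close>

lemma wealth_stays_nonneg:
  assumes "0 \<le> t" "payout B a t \<le> B t"
  shows "\<forall>\<^sub>F u in at_right t. payout B a u \<le> B u"
proof (cases "\<exists>q>t. solvent B a q")
  case True
  then obtain q where q: "t < q" "solvent B a q" by blast
  have "payout B a u \<le> B u" if "t < u" "u < q" for u
    using solvent_budget_ge[OF q(2)] that assms by auto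
  then show ?thesis
    using q by (auto simp: eventually_at_right_field)
next
  case False
  obtain d where d: "0 < d" "\<And>u. t \<le> u \<Longrightarrow> u < t + d \<Longrightarrow> B t \<le> B u"
    using right_incr[OF assms(1)] by blast
  have "payout B a u \<le> B t" for u
  proof (rule payout_least)
    show "0 \<le> B t"
      using assms payout_nonneg[of a t] by auto
  next
    fix q assume q: "q \<in> \<rat>" "0 < q" "q < u" "solvent B a q"
    then have "q \<le> t"
      using False by force
    show "a q \<le> B t"
    proof (cases "q = t")
      case True
      then show ?thesis
        using solventD[OF q(4)] q by auto
    next
      case False
      then show ?thesis
        using payout_upper[of q t a] q \<open>q \<le> t\<close> assms by auto
    qed
  qed
  then have "payout B a u \<le> B u" if "t < u" "u < t + d" for u
    using d(2)[of u] that by (meson less_imp_le order_trans)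
  then show ?thesis
    using d(1) unfolding eventually_at_right_field by (metis less_add_same_cancel1)
qed

text \<open>
  A payout exceeding the budget at \<open>t\<close> contradicts solvency at any later time and, if \<open>t\<close> is rational, at \<open>t\<close> itself;
  so nothing is added to the payout from \<open>t\<close> on.
\<close>

lemma payout_stops_at_ruin:
  assumes "0 \<le> t" "B t < payout B a t" "t \<le> u"
  shows "payout B a u = payout B a t"
proof -
  have "\<not> solvent B a q" if "t < q" for q
    using solvent_budget_ge[of a q t] that assms by auto
  moreover have "\<not> (solvent B a t \<and> t \<in> \<rat> \<and> 0 < t)"
  proof
    assume t: "solvent B a t \<and> t \<in> \<rat> \<and> 0 < t"
    then have "payout B a t \<le> B t"
      by (intro payout_least) (use solventD[of B a t] in auto)
    then show False using assms by simp
  qed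
  ultimately have "payout B a u \<le> payout B a t"
    by (intro payout_least payout_nonneg payout_upper)
       (metis linorder_neqE_linordered_idom)+
  then show ?thesis
    using payout_mono[OF assms(3), of a] by simp
qed

end

section \<open>Claim paths and dividends along a path\<close>

type_synonym path = "nat + nat \<Rightarrow> real"
type_synonym observation = "real \<times> real \<times> real"
type_synonym rule = "real \<Rightarrow> (real \<Rightarrow> observation) \<Rightarrow> real"

text \<open>
  The value \<open>e (Inl k)\<close> is the waiting time for claim \<open>k\<close> after the initial time and \<open>e (Inr k)\<close> its size, with
  claims numbered from 0.  This shifts by one the numbering of \<^const>\<open>waiting_after\<close> and \<^const>\<open>claim_after\<close>, whose
  index 0 has no meaning.
\<close>

definition arrival :: "path \<Rightarrow> nat \<Rightarrow> real" where
  "arrival e k = (\<Sum>i\<le>k. e (Inl i))"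

definition arrivals :: "path \<Rightarrow> real \<Rightarrow> nat" where
  "arrivals e t = card {k. arrival e k \<le> t}"

text \<open>
  The absolute value changes nothing on regular paths and makes the aggregate claims nonnegative on all paths; so
  budgets, and with them the suprema below, are bounded without exceptional paths.
\<close>

definition aggregate :: "path \<Rightarrow> real \<Rightarrow> real" where
  "aggregate e t = (\<Sum>k<arrivals e t. \<bar>e (Inr k)\<bar>)"

text \<open>
  The last component is the time of the latest claim.  It carries the same information as the
  elapsed time at \<open>u\<close>, but unlike the latter it is determined by the path after the initial time also before the
  first claim.
\<close>

definition observe :: "path \<Rightarrow> real \<Rightarrow> observation" where
  "observe e u = (real (arrivals e u), aggregate e u,
     if arrivals e u = 0 then 0 else arrival e (arrivals e u - 1))"

text \<open>
  Causality is built in: a function of \<open>history q e\<close> cannot use more than the observations up to \<open>q\<close>.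
\<close>

definition history :: "real \<Rightarrow> path \<Rightarrow> real \<Rightarrow> observation" where
  "history q e = (\<lambda>u\<in>{0..q}. observe e u)"

text \<open>
  Almost all paths are regular (see \<open>AE_regular\<close>): claims arrive one at a time and do not accumulate.
\<close>

definition regular_path :: "path \<Rightarrow> bool" where
  "regular_path e \<longleftrightarrow>
     (\<forall>k. 0 < e (Inl k)) \<and> (\<forall>k. 0 \<le> e (Inr k)) \<and> (\<forall>t. \<exists>k. t < arrival e k)"

lemma arrival_Suc: "arrival e (Suc k) = arrival e k + e (Inl (Suc k))"
  by (simp add: arrival_def)

lemma arrival_0: "arrival e 0 = e (Inl 0)"
  by (simp add: arrival_def)

lemma arrival_strict_mono: "regular_path e \<Longrightarrow> strict_mono (arrival e)"
  by (auto simp: strict_mono_Suc_iff arrival_Suc regular_path_def)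

lemma arrival_pos: "regular_path e \<Longrightarrow> 0 < arrival e k"
  unfolding arrival_def by (rule sum_pos) (auto simp: regular_path_def)

lemma arrivals_eq:
  assumes "regular_path e"
  shows "{k. arrival e k \<le> t} = {..<arrivals e t}"
proof -
  note mono = arrival_strict_mono[OF assms]
  define n where "n = (LEAST k. t < arrival e k)"
  have n: "t < arrival e n"
    unfolding n_def using assms by (auto simp: regular_path_def intro: LeastI_ex)
  have "\<not> t < arrival e k" if "k < n" for k
    using that not_less_Least unfolding n_def by blast
  moreover have "t < arrival e k" if "n \<le> k" for k
    using n strict_mono_less_eq[OF mono, of n k] that by simp
  ultimately have "arrival e k \<le> t \<longleftrightarrow> k < n" for k
    by (meson not_le)
  then have "{k. arrival e k \<le> t} = {..<n}"
    by auto
  then show ?thesis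
    by (simp add: arrivals_def)
qed

lemma less_arrivals_iff:
  "regular_path e \<Longrightarrow> k < arrivals e t \<longleftrightarrow> arrival e k \<le> t"
  using arrivals_eq[of e t] by auto

lemma arrivals_mono: "regular_path e \<Longrightarrow> t \<le> u \<Longrightarrow> arrivals e t \<le> arrivals e u"
  using less_arrivals_iff[of e "arrivals e u" t] less_arrivals_iff[of e "arrivals e u" u]
  by (cases "arrivals e u < arrivals e t") auto

lemma arrivals_0: "regular_path e \<Longrightarrow> t \<le> 0 \<Longrightarrow> arrivals e t = 0"
  using less_arrivals_iff[of e 0 t] arrival_pos[of e 0] by auto

text \<open>
  The witness is the distance to the next claim.
\<close>

lemma arrivals_right_constant:
  assumes "regular_path e"
  shows "\<exists>d>0. \<forall>u. t \<le> u \<and> u < t + d \<longrightarrow> arrivals e u = arrivals e t"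
proof (intro exI conjI allI impI)
  show "0 < arrival e (arrivals e t) - t"
    using less_arrivals_iff[OF assms, of "arrivals e t" t] by auto
next
  fix u assume u: "t \<le> u \<and> u < t + (arrival e (arrivals e t) - t)"
  then have "\<not> arrivals e t < arrivals e u"
    using less_arrivals_iff[OF assms, of "arrivals e t" u] by auto
  then show "arrivals e u = arrivals e t"
    using arrivals_mono[OF assms, of t u] u by auto
qed

lemma aggregate_nonneg: "0 \<le> aggregate e t"
  by (simp add: aggregate_def sum_nonneg)

lemma aggregate_mono: "regular_path e \<Longrightarrow> t \<le> u \<Longrightarrow> aggregate e t \<le> aggregate e u"
  unfolding aggregate_def using arrivals_mono[of e t u] by (intro sum_mono2) auto

text \<open>
  The surplus of a company with initial capital \<open>x\<close> that pays no dividends, frozen at the horizon \<open>r\<close>.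
\<close>

definition budget :: "real \<Rightarrow> real \<Rightarrow> real \<Rightarrow> path \<Rightarrow> real \<Rightarrow> real" where
  "budget p r x e t = x + p * min t r - aggregate e (min t r)"

text \<open>
  From the horizon on the proposal is to pay out everything.  It takes effect right after \<open>r\<close>, in accordance
  with lump sums at the terminal time being paid.
\<close>

definition plan ::
  "real \<Rightarrow> real \<Rightarrow> real \<Rightarrow> rule \<Rightarrow> path \<Rightarrow> real \<Rightarrow> real" where
  "plan p r x b e q = (if q < r then b q (history q e) else budget p r x e r)"

definition dividends ::
  "real \<Rightarrow> real \<Rightarrow> real \<Rightarrow> rule \<Rightarrow> path \<Rightarrow> real \<Rightarrow> real" where
  "dividends p r x b e = payout (budget p r x e) (plan p r x b e)"

lemma budget_bounded:
  assumes "0 \<le> p" "0 \<le> r" "0 \<le> x"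
  shows "bounded_budget (budget p r x e) (x + p * r)"
proof
  fix q
  have "p * min q r \<le> p * r"
    using assms by (intro mult_left_mono) auto
  then show "budget p r x e q \<le> x + p * r"
    unfolding budget_def using aggregate_nonneg[of e "min q r"] by linarith
qed (use assms in auto)

lemma budget_surplus:
  assumes "0 \<le> p" "0 \<le> r" "0 \<le> x" "regular_path e"
  shows "surplus_budget (budget p r x e) (x + p * r)"
proof -
  interpret bounded_budget "budget p r x e" "x + p * r"
    using budget_bounded assms by blast
  have *: "\<exists>d>0. \<forall>u. t \<le> u \<and> u < t + d \<longrightarrow>
      budget p r x e u = budget p r x e t + p * (min u r - min t r)" for t
  proof -
    obtain d where d: "d > 0" "\<And>u. min t r \<le> u \<Longrightarrow> u < min t r + d \<Longrightarrow> arrivals e u = arrivals e (min t r)"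
      using arrivals_right_constant[OF assms(4), of "min t r"] by blast
    have "budget p r x e u = budget p r x e t + p * (min u r - min t r)" if "t \<le> u \<and> u < t + d" for u
    proof -
      have "arrivals e (min u r) = arrivals e (min t r)"
        using that d(1) by (intro d(2)) linarith+
      then show ?thesis
        by (simp add: budget_def aggregate_def right_diff_distrib)
    qed
    then show ?thesis using d(1) by blast
  qed
  show ?thesis
  proof
    fix t :: real
    obtain d where d: "d > 0" "\<And>u. t \<le> u \<Longrightarrow> u < t + d \<Longrightarrow>
      budget p r x e u = budget p r x e t + p * (min u r - min t r)"
      using *[of t] by blast
    have "((\<lambda>u. budget p r x e t + p * (min u r - min t r)) \<longlongrightarrow> budget p r x e t + p * (min t r - min t r)) (at_right t)"
      by (intro tendsto_intros)
    moreover have "\<forall>\<^sub>F u in at_right t. budget p r x e t + p * (min u r - min t r) = budget p r x e u"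
      unfolding eventually_at_right_field using d(1) by (intro exI[of _ "t + d"] conjI allI impI d(2)[symmetric]) simp_all
    ultimately show "(budget p r x e \<longlongrightarrow> budget p r x e t) (at_right t)"
      by (simp add: Lim_transform_eventually)
    have "budget p r x e t \<le> budget p r x e u" if "t \<le> u \<and> u < t + d" for u
    proof -
      have "0 \<le> p * (min u r - min t r)"
        using assms(1) that by (intro mult_nonneg_nonneg) auto
      then show ?thesis
        using d(2)[of u] that by linarith
    qed
    then show "\<exists>d>0. \<forall>u. t \<le> u \<and> u < t + d \<longrightarrow> budget p r x e t \<le> budget p r x e u"
      using d(1) by blast
  qed
qed

lemma dividends_tail_constant:
  assumes "0 \<le> p" "0 \<le> r" "0 \<le> x" "r < t" "r < t'"
  shows "dividends p r x b e t = dividends p r x b e t'"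
  unfolding dividends_def
  by (rule payout_tail_constant[OF budget_bounded[OF assms(1-3)], of r])
     (use assms in \<open>auto simp: budget_def plan_def\<close>)

lemma dividends_bounds:
  assumes "0 \<le> p" "0 \<le> r" "0 \<le> x"
  shows "0 \<le> dividends p r x b e t" "dividends p r x b e t \<le> x + p * r"
  using bounded_budget.payout_nonneg[OF budget_bounded[OF assms]]
    bounded_budget.payout_le[OF budget_bounded[OF assms]] unfolding dividends_def by auto

section \<open>Comparing initial states along one path\<close>

text \<open>
  With more capital the same rule stays affordable at least as long.
\<close>

lemma dividends_mono_capital:
  assumes "0 \<le> p" "0 \<le> r" "0 \<le> x" "x \<le> x'"
  shows "dividends p r x b e t \<le> dividends p r x' b e t"
proof -
  have B: "budget p r x' e u = budget p r x e u + (x' - x)" for u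
    by (simp add: budget_def)
  show ?thesis
    unfolding dividends_def
  proof (rule payout_comparison[OF budget_bounded budget_bounded, where \<delta> = 0, simplified])
    fix q assume q: "q \<in> \<rat>" "0 < q" "q < t" "solvent (budget p r x e) (plan p r x b e) q"
    have "solvent (budget p r x' e) (plan p r x' b e) q"
    proof (rule solventI)
      fix q1 q2 :: real assume *: "q1 \<in> \<rat>" "q2 \<in> \<rat>" "0 < q1" "q1 \<le> q2" "q2 \<le> q"
      show "plan p r x' b e q1 \<le> budget p r x' e q2"
        using solventD(1)[OF q(4) *] assms(4) * by (auto simp: plan_def B)
    next
      fix q2 :: real assume *: "q2 \<in> \<rat>" "0 < q2" "q2 \<le> q"
      show "0 \<le> budget p r x' e q2"
        using solventD(2)[OF q(4) *] assms(4) by (auto simp: B)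
    qed
    then have "plan p r x' b e q \<le> payout (budget p r x' e) (plan p r x' b e) t"
      using assms q by (intro bounded_budget.payout_upper[OF budget_bounded]) auto
    moreover have "plan p r x b e q \<le> plan p r x' b e q"
      using assms by (auto simp: plan_def B)
    ultimately show "plan p r x b e q \<le> payout (budget p r x' e) (plan p r x' b e) t"
      by simp
  qed (use assms in auto)
qed

text \<open>
  Without dividends, the surplus is nonnegative just before claim \<open>k\<close>, when it equals \<open>y\<close>, and lies in
  \<open>[-h, 0)\<close> just after it.
\<close>

definition shallow_ruin :: "real \<Rightarrow> real \<Rightarrow> real \<Rightarrow> real \<Rightarrow> path \<Rightarrow> nat \<Rightarrow> bool" where
  "shallow_ruin p r x h e k \<longleftrightarrow> arrival e k \<le> r \<and>
     (let y = x + p * arrival e k - (\<Sum>i<k. e (Inr i)) in 0 \<le> y \<and> y < e (Inr k) \<and> e (Inr k) \<le> y + h)"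

lemma aggregate_eq: "regular_path e \<Longrightarrow> aggregate e t = (\<Sum>k<arrivals e t. e (Inr k))"
  by (simp add: aggregate_def regular_path_def)

text \<open>
  The witness is the first claim after which the surplus without dividends is negative; it exists as the surplus
  increases between claims.
\<close>

lemma first_shallow_ruin:
  assumes "regular_path e" "0 \<le> p" "0 \<le> r" "0 \<le> x" "0 < q2"
    and neg: "budget p r x e q2 < 0"
    and sol: "\<And>q. q \<in> \<rat> \<Longrightarrow> 0 < q \<Longrightarrow> q \<le> q2 \<Longrightarrow> - h \<le> budget p r x e q"
    and q2: "q2 \<in> \<rat>"
  shows "\<exists>k. shallow_ruin p r x h e k"
proof -
  interpret surplus_budget "budget p r x e" "x + p * r"
    by (rule budget_surplus[OF assms(2-4,1)])
  \<comment> \<open>the surplus without dividends just after claim \<open>k\<close>\<close>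
  define z where "z k = x + p * arrival e k - (\<Sum>i<Suc k. e (Inr i))" for k
  define m where "m = min q2 r"
  have "\<exists>k. arrival e k \<le> m \<and> z k < 0"
  proof -
    define n where "n = arrivals e m"
    have "n \<noteq> 0"
    proof
      assume "n = 0"
      then have "budget p r x e q2 = x + p * m"
        by (simp add: budget_def m_def n_def aggregate_def)
      moreover have "0 \<le> p * m"
        using assms(2,3,5) by (simp add: m_def)
      ultimately show False
        using neg assms(4) by simp
    qed
    then have a: "arrival e (n - 1) \<le> m"
      using less_arrivals_iff[OF assms(1), of "n - 1" m] n_def by auto
    have "z (n - 1) = x + p * arrival e (n - 1) - aggregate e m"
      using \<open>n \<noteq> 0\<close> by (simp add: z_def aggregate_eq[OF assms(1)] n_def)
    also have "\<dots> \<le> x + p * m - aggregate e m"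
      using a assms(2) by (simp add: mult_left_mono)
    also have "\<dots> < 0"
      using neg by (simp add: budget_def m_def)
    finally show ?thesis using a by blast
  qed
  then have ex: "\<exists>k. arrival e k \<le> m \<and> z k < 0" .
  define k where "k = (LEAST k. arrival e k \<le> m \<and> z k < 0)"
  have "arrival e k \<le> m \<and> z k < 0"
    unfolding k_def by (rule LeastI_ex[OF ex])
  then have k: "arrival e k \<le> m" "z k < 0"
    by simp_all
  have k': "\<not> (arrival e i \<le> m \<and> z i < 0)" if "i < k" for i
    using not_less_Least[of i "\<lambda>k. arrival e k \<le> m \<and> z k < 0"] that unfolding k_def by blast
  define y where "y = x + p * arrival e k - (\<Sum>i<k. e (Inr i))"
  have zy: "z k = y - e (Inr k)"
    by (simp add: z_def y_def)
  have "0 \<le> y"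
  proof (cases k)
    case 0
    then show ?thesis
      using assms(2,4) arrival_pos[OF assms(1), of 0] by (simp add: y_def)
  next
    case (Suc i)
    have "arrival e i \<le> arrival e k"
      using arrival_strict_mono[OF assms(1)] Suc by (simp add: strict_mono_less_eq)
    then have "0 \<le> z i" "p * arrival e i \<le> p * arrival e k"
      using k'[of i] k(1) Suc assms(2) by (auto intro: mult_left_mono)
    then show ?thesis
      unfolding z_def y_def Suc by simp
  qed
  moreover have "y < e (Inr k)"
    using k(2) zy by simp
  moreover have "e (Inr k) \<le> y + h"
  proof -
    have "budget p r x e (arrival e k) = z k"
    proof -
      have *: "arrival e k \<le> r" using k(1) by (simp add: m_def)
      have "arrivals e (arrival e k) = Suc k"
        by (simp add: arrivals_def strict_mono_less_eq[OF arrival_strict_mono[OF assms(1)]]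
            flip: atMost_def)
      then show ?thesis
        using * by (simp add: budget_def z_def aggregate_eq[OF assms(1)] min_def)
    qed
    moreover have "- h \<le> budget p r x e (arrival e k)"
    proof (cases "arrival e k = q2")
      case True
      then show ?thesis using sol[of q2] q2 assms(5) by simp
    next
      case False
      then have lt: "arrival e k < q2" using k(1) by (auto simp: m_def)
      have pos: "0 \<le> arrival e k"
        using arrival_pos[OF assms(1), of k] by simp
      show ?thesis
        by (rule right_limit_ge[OF pos lt]) (rule sol, use pos in auto)
    qed
    ultimately show ?thesis
      using zy by simp
  qed
  ultimately show ?thesis
    using k(1) unfolding shallow_ruin_def m_def Let_def by (intro exI[of _ k]) (simp add: y_def)
qed

text \<open>
  Lowering proposals by \<open>h\<close> matches lowering the budget by \<open>h\<close>, as long as the reduced proposals are not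
  truncated at 0.  So solvency with capital \<open>x + h\<close> gives solvency with capital \<open>x\<close>, unless the smaller
  budget becomes negative while it is at least \<open>-h\<close>; by \<open>first_shallow_ruin\<close> there is then a shallow ruin.
\<close>

lemma dividends_smaller_capital:
  assumes "regular_path e" "0 \<le> p" "0 \<le> r" "0 \<le> x" "0 \<le> h"
    and no_shallow: "\<nexists>k. shallow_ruin p r x h e k"
  shows "dividends p r (x + h) b e t \<le> dividends p r x (\<lambda>q g. b q g - h) e t + h"
proof -
  have B: "budget p r (x + h) e u = budget p r x e u + h" for u
    by (simp add: budget_def)
  have a: "plan p r x (\<lambda>q g. b q g - h) e q = plan p r (x + h) b e q - h" for q
    by (simp add: plan_def B)
  show ?thesis
    unfolding dividends_def
  proof (rule payout_comparison[OF budget_bounded budget_bounded])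
    fix q assume q: "q \<in> \<rat>" "0 < q" "q < t" "solvent (budget p r (x + h) e) (plan p r (x + h) b e) q"
    have ge: "- h \<le> budget p r x e q2" if "q2 \<in> \<rat>" "0 < q2" "q2 \<le> q" for q2
      using solventD(2)[OF q(4) that] by (simp add: B)
    have "solvent (budget p r x e) (plan p r x (\<lambda>q g. b q g - h) e) q"
    proof (rule solventI)
      fix q1 q2 :: real assume *: "q1 \<in> \<rat>" "q2 \<in> \<rat>" "0 < q1" "q1 \<le> q2" "q2 \<le> q"
      show "plan p r x (\<lambda>q g. b q g - h) e q1 \<le> budget p r x e q2"
        using solventD(1)[OF q(4) *] by (simp add: a B)
    next
      fix q2 :: real assume *: "q2 \<in> \<rat>" "0 < q2" "q2 \<le> q"
      show "0 \<le> budget p r x e q2"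
      proof (rule ccontr)
        assume "\<not> 0 \<le> budget p r x e q2"
        then have "\<exists>k. shallow_ruin p r x h e k"
          using * by (intro first_shallow_ruin[OF assms(1-4) *(2)] ge) simp_all
        then show False
          using no_shallow by blast
      qed
    qed
    then have "plan p r x (\<lambda>q g. b q g - h) e q
        \<le> payout (budget p r x e) (plan p r x (\<lambda>q g. b q g - h) e) t"
      using assms q by (intro bounded_budget.payout_upper[OF budget_bounded]) auto
    then show "plan p r (x + h) b e q
        \<le> payout (budget p r x e) (plan p r x (\<lambda>q g. b q g - h) e) t + h"
      by (simp add: a)
  qed (use assms in auto)
qed

text \<open>
  Proposals before \<open>r1\<close> are the same for both horizons.  A later payment is at most the wealth at \<open>r1\<close> plus
  the premiums earned in between, and with the short horizon that wealth is paid out at \<open>r1\<close>.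
\<close>

lemma dividends_shorter_horizon:
  assumes "regular_path e" "0 \<le> p" "0 \<le> r1" "r1 \<le> r2" "0 \<le> x"
  shows "dividends p r2 x b e t \<le> dividends p r1 x b e t + p * (r2 - r1)"
proof -
  interpret B2: surplus_budget "budget p r2 x e" "x + p * r2"
    using budget_surplus assms by auto
  interpret B1: surplus_budget "budget p r1 x e" "x + p * r1"
    using budget_surplus assms by auto
  have Beq: "budget p r2 x e u = budget p r1 x e u" if "u \<le> r1" for u
    using that assms by (simp add: budget_def min_def)
  show ?thesis
    unfolding dividends_def
  proof (rule payout_comparison[OF B2.bounded_budget_axioms B1.bounded_budget_axioms])
    show "0 \<le> p * (r2 - r1)" using assms by simp
  next
    fix q assume q: "q \<in> \<rat>" "0 < q" "q < t" "solvent (budget p r2 x e) (plan p r2 x b e) q"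
    show "plan p r2 x b e q \<le> payout (budget p r1 x e) (plan p r1 x b e) t + p * (r2 - r1)"
    proof (cases "q < r1")
      case True
      have "solvent (budget p r1 x e) (plan p r1 x b e) q"
        by (rule solvent_cong[THEN iffD1, OF _ _ q(4)])
           (use True assms(4) Beq in \<open>auto simp: plan_def\<close>)
      then have "plan p r1 x b e q \<le> payout (budget p r1 x e) (plan p r1 x b e) t"
        using q by (intro B1.payout_upper) auto
      moreover have "plan p r2 x b e q = plan p r1 x b e q"
        using True assms by (simp add: plan_def)
      ultimately show ?thesis
        using assms by (simp add: add_increasing2)
    next
      case False
      have "plan p r2 x b e q \<le> budget p r2 x e q"
        using solventD(1)[OF q(4), of q q] q by auto
      also have "\<dots> \<le> x + p * r2 - aggregate e r1"
        unfolding budget_def using False assms aggregate_mono[OF assms(1), of r1 "min q r2"]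
        by (intro diff_mono add_left_mono mult_left_mono) auto
      also have "\<dots> = budget p r1 x e r1 + p * (r2 - r1)"
        by (simp add: budget_def algebra_simps)
      finally have le: "plan p r2 x b e q \<le> budget p r1 x e r1 + p * (r2 - r1)" .
      have at_r1: "z \<le> budget p r1 x e r1"
        if "\<And>q'. q' \<in> \<rat> \<Longrightarrow> r1 \<le> q' \<Longrightarrow> q' \<le> q \<Longrightarrow> z \<le> budget p r2 x e q'" for z
      proof (cases "q = r1")
        case True
        then show ?thesis using that[of q] q Beq[of r1] by auto
      next
        case ne: False
        then have "z \<le> budget p r2 x e r1"
          using assms False by (intro B2.right_limit_ge[of r1 q]) (auto intro!: that)
        then show ?thesis using Beq[of r1] by simp
      qed
      have "solvent (budget p r1 x e) (plan p r1 x b e) q"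
      proof (rule solventI)
        fix q1 q2 :: real assume *: "q1 \<in> \<rat>" "q2 \<in> \<rat>" "0 < q1" "q1 \<le> q2" "q2 \<le> q"
        have late: "budget p r1 x e u = budget p r1 x e r1" if "r1 \<le> u" for u
          using that by (simp add: budget_def)
        have "plan p r1 x b e q1 \<le> budget p r1 x e q2" if "q1 < r1"
        proof -
          have e: "plan p r1 x b e q1 = plan p r2 x b e q1"
            using that assms by (simp add: plan_def)
          show ?thesis
          proof (cases "q2 < r1")
            case True
            then show ?thesis
              using solventD(1)[OF q(4) *] e Beq[of q2] by simp
          next
            case False
            have "plan p r2 x b e q1 \<le> budget p r1 x e r1"
              using that * by (intro at_r1 solventD(1)[OF q(4)]) auto
            then show ?thesis
              using e late[of q2] False by simp
          qed
        qed
        then show "plan p r1 x b e q1 \<le> budget p r1 x e q2"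
          using late[of q2] * by (cases "q1 < r1") (auto simp: plan_def)
      next
        fix q2 :: real assume *: "q2 \<in> \<rat>" "0 < q2" "q2 \<le> q"
        show "0 \<le> budget p r1 x e q2"
        proof (cases "q2 < r1")
          case True
          then show ?thesis
            using solventD(2)[OF q(4) *] Beq[of q2] by simp
        next
          case False
          have "0 \<le> budget p r1 x e r1"
          proof (cases "r1 = 0")
            case True
            then show ?thesis
              using assms by (simp add: budget_def aggregate_def arrivals_0)
          next
            case ne: False
            show ?thesis
              by (rule at_r1) (use solventD(2)[OF q(4)] ne assms in auto)
          qed
          then show ?thesis using False by (simp add: budget_def)
        qed
      qed
      then have "plan p r1 x b e q \<le> payout (budget p r1 x e) (plan p r1 x b e) t"
        using q by (intro B1.payout_upper) auto
      then show ?thesis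
        using le False by (simp add: plan_def)
    qed
  qed
qed

text \<open>
  The rule is altered to propose from \<open>r1\<close> on what the short problem pays out at its end.  As the budget does
  not decrease right after \<open>r1\<close>, this proposal is affordable for a short while, which is enough for it to be
  paid.
\<close>

lemma dividends_longer_horizon:
  fixes b :: rule
  assumes "regular_path e" "0 \<le> p" "0 \<le> r1" "r1 \<le> r2" "0 \<le> x"
  defines "b' \<equiv> \<lambda>q g. if q < r1 then b q g else x + p * r1 - fst (snd (g r1))"
  shows "dividends p r1 x b e t \<le> dividends p r2 x b' e t"
proof (cases "r1 = r2")
  case True
  then have "plan p r1 x b e = plan p r2 x b' e"
    by (auto simp: plan_def b'_def)
  then show ?thesis
    using True by (simp add: dividends_def)
next
  case False
  with assms have lt: "r1 < r2" by simp
  interpret B2: surplus_budget "budget p r2 x e" "x + p * r2"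
    using budget_surplus assms by auto
  interpret B1: surplus_budget "budget p r1 x e" "x + p * r1"
    using budget_surplus assms by auto
  have Beq: "budget p r2 x e u = budget p r1 x e u" if "u \<le> r1" for u
    using that assms by (simp add: budget_def min_def)
  have late: "budget p r1 x e u = budget p r1 x e r1" if "r1 \<le> u" for u
    using that by (simp add: budget_def)
  have plan': "plan p r2 x b' e q = budget p r1 x e r1" if "r1 \<le> q" "q < r2" for q
    using that assms(3) by (simp add: plan_def b'_def history_def observe_def budget_def)
  have plan_eq: "plan p r2 x b' e q = plan p r1 x b e q" if "q < r1" for q
    using that lt by (simp add: plan_def b'_def)
  show ?thesis
    unfolding dividends_def
  proof (rule payout_comparison[OF B1.bounded_budget_axioms B2.bounded_budget_axioms, where \<delta> = 0, simplified])
    fix q assume q: "q \<in> \<rat>" "0 < q" "q < t" "solvent (budget p r1 x e) (plan p r1 x b e) q"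
    show "plan p r1 x b e q \<le> payout (budget p r2 x e) (plan p r2 x b' e) t"
    proof (cases "q < r1")
      case True
      have "solvent (budget p r2 x e) (plan p r2 x b' e) q"
        by (rule solvent_cong[THEN iffD2, OF _ _ q(4)]) (use True Beq plan_eq in auto)
      then show ?thesis
        using q True plan_eq[of q] B2.payout_upper[of q t "plan p r2 x b' e"] by simp
    next
      case False
      obtain d where d: "0 < d" "\<And>u. r1 \<le> u \<Longrightarrow> u < r1 + d \<Longrightarrow> budget p r2 x e r1 \<le> budget p r2 x e u"
        using B2.right_incr[of r1] assms by blast
      \<comment> \<open>late enough for the altered proposal to be in force, early enough for the budget not to have decreased\<close>
      obtain q' where q': "q' \<in> \<rat>" "r1 < q'" "q' < Min {t, r2, r1 + d}"
        using rat_between[of r1 "Min {t, r2, r1 + d}"] False q(3) lt d(1) by auto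
      have near: "budget p r1 x e r1 \<le> budget p r2 x e u" if "r1 \<le> u" "u \<le> q'" for u
        using d(2)[of u] that q' Beq[of r1] by auto
      have "solvent (budget p r2 x e) (plan p r2 x b' e) q'"
      proof (rule solventI)
        fix q1 q2 :: real assume *: "q1 \<in> \<rat>" "q2 \<in> \<rat>" "0 < q1" "q1 \<le> q2" "q2 \<le> q'"
        consider "q2 < r1" | "q1 < r1" "r1 \<le> q2" | "r1 \<le> q1" by linarith
        then show "plan p r2 x b' e q1 \<le> budget p r2 x e q2"
        proof cases
          case 1
          then show ?thesis
            using solventD(1)[OF q(4) *(1-4)] False plan_eq[of q1] Beq[of q2] * by simp
        next
          case 2
          then have "plan p r1 x b e q1 \<le> budget p r1 x e q"
            using False * q by (intro solventD(1)[OF q(4)]) auto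
          then show ?thesis
            using plan_eq[of q1] near[of q2] 2 * late[of q] False by simp
        next
          case 3
          then show ?thesis
            using plan'[of q1] near[of q2] * q' by simp
        qed
      next
        fix q2 :: real assume *: "q2 \<in> \<rat>" "0 < q2" "q2 \<le> q'"
        show "0 \<le> budget p r2 x e q2"
        proof (cases "q2 < r1")
          case True
          then show ?thesis
            using solventD(2)[OF q(4), of q2] * False Beq[of q2] by auto
        next
          case f: False
          have "0 \<le> budget p r1 x e q"
            using q by (intro solventD(2)[OF q(4)]) auto
          then show ?thesis
            using near[of q2] * f late[of q] False by auto
        qed
      qed
      then have "plan p r2 x b' e q' \<le> payout (budget p r2 x e) (plan p r2 x b' e) t"
        using q' assms(3) by (intro B2.payout_upper) auto
      then show ?thesis
        using plan'[of q'] q' False by (simp add: plan_def)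
    qed
  qed
qed

section \<open>Rules and their expected gain\<close>

abbreviation path_space :: "path measure" where
  "path_space \<equiv> PiM UNIV (\<lambda>_. borel)"

abbreviation history_space :: "real \<Rightarrow> (real \<Rightarrow> observation) measure" where
  "history_space q \<equiv> PiM {0..q} (\<lambda>_. borel)"

text \<open>
  Neither the horizon nor the initial capital nor the law of the path enters.  This is what makes different
  initial states comparable.
\<close>

definition rules :: "rule set" where
  "rules = {b. \<forall>q. b q \<in> borel_measurable (history_space q)}"

lemma measurable_coord [measurable]: "(\<lambda>e. e i) \<in> borel_measurable path_space"
  by (rule measurable_component_singleton) simp

lemma measurable_arrival [measurable]: "(\<lambda>e. arrival e k) \<in> borel_measurable path_space"
  unfolding arrival_def by measurable

lemma measurable_arrivals [measurable]:
  "(\<lambda>e. arrivals e t) \<in> measurable path_space (count_space UNIV)"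
  unfolding arrivals_def by measurable

lemma measurable_aggregate [measurable]: "(\<lambda>e. aggregate e t) \<in> borel_measurable path_space"
  unfolding aggregate_def
  by (rule measurable_compose_countable[where f = "\<lambda>n e. \<Sum>k<n. \<bar>e (Inr k)\<bar>" and g = "\<lambda>e. arrivals e t"])
     measurable

lemma measurable_observe [measurable]: "(\<lambda>e. observe e u) \<in> borel_measurable path_space"
proof -
  have "(\<lambda>e. arrival e (arrivals e u - 1)) \<in> borel_measurable path_space"
    by (rule measurable_compose_countable[where f = "\<lambda>n e. arrival e (n - 1)" and g = "\<lambda>e. arrivals e u"])
       measurable
  moreover have "(\<lambda>e. real (arrivals e u)) \<in> borel_measurable path_space"
    by (rule measurable_compose[OF measurable_arrivals]) simp
  moreover have "Measurable.pred path_space (\<lambda>e. arrivals e u = 0)"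
    by measurable
  ultimately show ?thesis
    unfolding observe_def borel_prod[symmetric]
    by (intro measurable_Pair measurable_If measurable_aggregate measurable_const) auto
qed

lemma measurable_history [measurable]: "history q \<in> measurable path_space (history_space q)"
  unfolding history_def by (rule measurable_restrict) measurable

lemma measurable_budget [measurable]: "(\<lambda>e. budget p r x e t) \<in> borel_measurable path_space"
  unfolding budget_def by measurable

text \<open>
  Only countably many proposals and budgets are involved, by the restriction to rational times.  Joint measurability
  in time and parameter is needed for integrating over the exponential clock.
\<close>

lemma measurable_payout:
  fixes B a :: "'n \<Rightarrow> real \<Rightarrow> real"
  assumes [measurable]: "\<And>q. (\<lambda>n. B n q) \<in> borel_measurable N" "\<And>q. (\<lambda>n. a n q) \<in> borel_measurable N"
    and bnd: "\<And>n. bounded_budget (B n) \<beta>"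
  shows "(\<lambda>(n, t). payout (B n) (a n) t) \<in> borel_measurable (N \<Otimes>\<^sub>M borel)"
proof -
  have cnt: "countable {q\<in>\<rat>. 0 < (q::real)}"
    by (rule countable_subset[OF _ countable_rat]) auto
  have "solvent (B n) (a n) q \<longleftrightarrow> (\<forall>i j. 0 < real_of_rat i \<and> real_of_rat i \<le> real_of_rat j \<and>
      real_of_rat j \<le> q \<longrightarrow> max 0 (a n (real_of_rat i)) \<le> B n (real_of_rat j))" for n q
    unfolding solvent_def Rats_def by blast
  then have [measurable]: "Measurable.pred N (\<lambda>n. solvent (B n) (a n) q)" for q
    by simp
  show ?thesis
    unfolding payout_def case_prod_beta
  proof (rule borel_measurable_cSUP[OF cnt])
    fix q :: real
    show "(\<lambda>z. if q < snd z \<and> solvent (B (fst z)) (a (fst z)) q then max 0 (a (fst z) q) else 0)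
        \<in> borel_measurable (N \<Otimes>\<^sub>M borel)"
      by measurable
  next
    fix z
    show "bdd_above ((\<lambda>q. if q < snd z \<and> solvent (B (fst z)) (a (fst z)) q then max 0 (a (fst z) q) else 0)
        ` {q\<in>\<rat>. 0 < q})"
      by (rule bounded_budget.payout_bdd[OF bnd])
  qed
qed

text \<open>
  The parameter will be the observations made before the initial time.
\<close>

lemma measurable_dividends_param:
  fixes g :: "real \<Rightarrow> 'r \<times> (real \<Rightarrow> observation) \<Rightarrow> real"
  assumes g: "\<And>q. g q \<in> borel_measurable (R \<Otimes>\<^sub>M history_space q)" and "0 \<le> p" "0 \<le> r" "0 \<le> x"
  shows "(\<lambda>(n, t). dividends p r x (\<lambda>q h. g q (fst n, h)) (snd n) t)
    \<in> borel_measurable ((R \<Otimes>\<^sub>M path_space) \<Otimes>\<^sub>M borel)"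
  unfolding dividends_def
proof (rule measurable_payout[OF _ _ budget_bounded[OF assms(2-4)]])
  fix q
  note [measurable] = g
  show "(\<lambda>n. budget p r x (snd n) q) \<in> borel_measurable (R \<Otimes>\<^sub>M path_space)"
    by measurable
  show "(\<lambda>n. plan p r x (\<lambda>q h. g q (fst n, h)) (snd n) q) \<in> borel_measurable (R \<Otimes>\<^sub>M path_space)"
    unfolding plan_def by (cases "q < r") simp_all
qed

lemma measurable_dividends:
  assumes "b \<in> rules" "0 \<le> p" "0 \<le> r" "0 \<le> x"
  shows "(\<lambda>(e, t). dividends p r x b e t) \<in> borel_measurable (path_space \<Otimes>\<^sub>M borel)"
proof -
  have [measurable]: "b q \<in> borel_measurable (history_space q)" for q
    using assms by (simp add: rules_def)
  show ?thesis
    unfolding dividends_def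
  proof (rule measurable_payout[OF _ _ budget_bounded[OF assms(2-4)]])
    fix q
    show "(\<lambda>e. plan p r x b e q) \<in> borel_measurable path_space"
      unfolding plan_def by (cases "q < r") simp_all
  qed measurable
qed

lemma measurable_shallow_ruin [measurable]: "Measurable.pred path_space (\<lambda>e. shallow_ruin p r x h e k)"
proof -
  define y where "y e = x + p * arrival e k - (\<Sum>i<k. e (Inr i))" for e
  have y: "y \<in> borel_measurable path_space"
    unfolding y_def
    by (intro borel_measurable_diff borel_measurable_add borel_measurable_times borel_measurable_const
        measurable_arrival borel_measurable_sum measurable_coord)
  have "Measurable.pred path_space (\<lambda>e. arrival e k \<le> r \<and> 0 \<le> y e \<and> y e < e (Inr k) \<and> e (Inr k) \<le> y e + h)"
    unfolding pred_def
    by (intro sets.sets_Collect_conj borel_measurable_less borel_measurable_le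
        borel_measurable_add borel_measurable_const measurable_arrival measurable_coord y)
  then show ?thesis
    unfolding shallow_ruin_def Let_def y_def .
qed

definition exp_time :: "real \<Rightarrow> real measure" where
  "exp_time c = density lborel (exponential_density c)"

lemma prob_space_exp_time: "0 < c \<Longrightarrow> prob_space (exp_time c)"
  unfolding exp_time_def by (rule prob_space_exponential_density)

lemma sets_exp_time [simp, measurable_cong]: "sets (exp_time c) = sets borel"
  by (simp add: exp_time_def)

lemma space_exp_time [simp]: "space (exp_time c) = UNIV"
  by (simp add: exp_time_def)

text \<open>
  By \<open>discounted_dividends\<close> below, this is the discounted value of the dividends paid along the path \<open>e\<close>.
\<close>

definition reward :: "real \<Rightarrow> real \<Rightarrow> real \<Rightarrow> real \<Rightarrow> rule \<Rightarrow> path \<Rightarrow> real" where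
  "reward c p r x b e = (\<integral>t. dividends p r x b e t \<partial>exp_time c)"

lemma dividends_measurable_time:
  assumes "0 \<le> p" "0 \<le> r" "0 \<le> x"
  shows "dividends p r x b e \<in> borel_measurable borel"
  unfolding dividends_def by (rule bounded_budget.payout_measurable[OF budget_bounded[OF assms]])

lemma integrable_dividends:
  assumes "0 < c" "0 \<le> p" "0 \<le> r" "0 \<le> x"
  shows "integrable (exp_time c) (dividends p r x b e)"
proof -
  interpret prob_space "exp_time c" by (rule prob_space_exp_time[OF assms(1)])
  show ?thesis
    using dividends_bounds[OF assms(2-4)] dividends_measurable_time[OF assms(2-4)]
    by (intro integrable_const_bound[where B = "x + p * r"]) (auto intro!: AE_I2 simp: measurable_def)
qed

lemma reward_bounds:
  assumes "0 < c" "0 \<le> p" "0 \<le> r" "0 \<le> x"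
  shows "0 \<le> reward c p r x b e" "reward c p r x b e \<le> x + p * r"
proof -
  interpret prob_space "exp_time c" by (rule prob_space_exp_time[OF assms(1)])
  show "0 \<le> reward c p r x b e"
    unfolding reward_def using dividends_bounds[OF assms(2-4)] by (intro integral_nonneg_AE) auto
  show "reward c p r x b e \<le> x + p * r"
    unfolding reward_def using dividends_bounds[OF assms(2-4)] integrable_dividends[OF assms]
    by (intro integral_le_const) auto
qed

lemma reward_comparison:
  assumes "0 < c" "0 \<le> p" "0 \<le> r" "0 \<le> x" "0 \<le> r'" "0 \<le> x'"
    and "\<And>t. dividends p r x b e t \<le> dividends p r' x' b' e t + \<delta>"
  shows "reward c p r x b e \<le> reward c p r' x' b' e + \<delta>"
proof -
  interpret prob_space "exp_time c" by (rule prob_space_exp_time[OF assms(1)])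
  have "reward c p r x b e \<le> (\<integral>t. dividends p r' x' b' e t + \<delta> \<partial>exp_time c)"
    unfolding reward_def using assms integrable_dividends[OF assms(1,2)]
    by (intro integral_mono Bochner_Integration.integrable_add) auto
  also have "\<dots> = reward c p r' x' b' e + \<delta>"
    unfolding reward_def using assms integrable_dividends[OF assms(1,2)] prob_space
    by (subst Bochner_Integration.integral_add) auto
  finally show ?thesis .
qed

lemma measurable_reward_param:
  fixes g :: "real \<Rightarrow> 'r \<times> (real \<Rightarrow> observation) \<Rightarrow> real"
  assumes "\<And>q. g q \<in> borel_measurable (R \<Otimes>\<^sub>M history_space q)" "0 < c" "0 \<le> p" "0 \<le> r" "0 \<le> x"
  shows "(\<lambda>n. reward c p r x (\<lambda>q h. g q (fst n, h)) (snd n)) \<in> borel_measurable (R \<Otimes>\<^sub>M path_space)"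
proof -
  interpret prob_space "exp_time c" by (rule prob_space_exp_time[OF assms(2)])
  have "(\<lambda>(n, t). dividends p r x (\<lambda>q h. g q (fst n, h)) (snd n) t)
    \<in> borel_measurable ((R \<Otimes>\<^sub>M path_space) \<Otimes>\<^sub>M exp_time c)"
    using measurable_dividends_param[OF assms(1,3-5)] by (simp cong: measurable_cong_sets)
  then show ?thesis
    unfolding reward_def by (rule borel_measurable_lebesgue_integral)
qed

lemma measurable_reward:
  assumes "b \<in> rules" "0 < c" "0 \<le> p" "0 \<le> r" "0 \<le> x"
  shows "reward c p r x b \<in> borel_measurable path_space"
proof -
  interpret prob_space "exp_time c" by (rule prob_space_exp_time[OF assms(2)])
  have "(\<lambda>(e, t). dividends p r x b e t) \<in> borel_measurable (path_space \<Otimes>\<^sub>M exp_time c)"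
    using measurable_dividends[OF assms(1,3-5)] by (simp cong: measurable_cong_sets)
  then show ?thesis
    unfolding reward_def by (rule borel_measurable_lebesgue_integral)
qed

definition canonical_value :: "real \<Rightarrow> real \<Rightarrow> real \<Rightarrow> real \<Rightarrow> path measure \<Rightarrow> real" where
  "canonical_value c p r x P = (SUP b\<in>rules. \<integral>e. reward c p r x b e \<partial>P)"

lemma rules_nonempty: "(\<lambda>q h. 0) \<in> rules"
  by (simp add: rules_def)

locale path_prob = prob_space P for P :: "path measure" +
  fixes c p :: real
  assumes sets_P [measurable_cong]: "sets P = sets path_space"
    and c_pos: "0 < c" and p_nonneg: "0 \<le> p"
    and regular: "AE e in P. regular_path e"
begin

lemma integrable_reward:
  assumes "b \<in> rules" "0 \<le> r" "0 \<le> x"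
  shows "integrable P (reward c p r x b)"
proof (rule integrable_const_bound[where B = "x + p * r"])
  show "reward c p r x b \<in> borel_measurable P"
    using measurable_reward[OF assms(1) c_pos p_nonneg assms(2,3)] sets_P by (simp cong: measurable_cong_sets)
qed (use reward_bounds[OF c_pos p_nonneg assms(2,3)] in auto)

lemma expected_reward_bounds:
  assumes "0 \<le> r" "0 \<le> x" "b \<in> rules"
  shows "0 \<le> (\<integral>e. reward c p r x b e \<partial>P)" "(\<integral>e. reward c p r x b e \<partial>P) \<le> x + p * r"
  using reward_bounds[OF c_pos p_nonneg assms(1,2)] integrable_reward[OF assms(3,1,2)]
  by (auto intro!: integral_nonneg_AE integral_le_const)

lemma value_upper:
  assumes "b \<in> rules" "0 \<le> r" "0 \<le> x"
  shows "(\<integral>e. reward c p r x b e \<partial>P) \<le> canonical_value c p r x P"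
  unfolding canonical_value_def
  by (rule cSUP_upper[OF assms(1)]) (auto intro!: bdd_aboveI2 expected_reward_bounds assms)

lemma value_least:
  assumes "\<And>b. b \<in> rules \<Longrightarrow> (\<integral>e. reward c p r x b e \<partial>P) \<le> z"
  shows "canonical_value c p r x P \<le> z"
  unfolding canonical_value_def using rules_nonempty assms by (intro cSUP_least) auto

lemma value_comparison:
  assumes "0 \<le> r" "0 \<le> x" "0 \<le> r'" "0 \<le> x'"
    and "\<And>b. b \<in> rules \<Longrightarrow> \<exists>b'\<in>rules. AE e in P. reward c p r x b e \<le> reward c p r' x' b' e + \<delta>"
  shows "canonical_value c p r x P \<le> canonical_value c p r' x' P + \<delta>"
proof (rule value_least)
  fix b assume b: "b \<in> rules"
  then obtain b' where b': "b' \<in> rules" "AE e in P. reward c p r x b e \<le> reward c p r' x' b' e + \<delta>"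
    using assms(5) by blast
  have "(\<integral>e. reward c p r x b e \<partial>P) \<le> (\<integral>e. reward c p r' x' b' e + \<delta> \<partial>P)"
    using integrable_reward b b' assms by (intro integral_mono_AE Bochner_Integration.integrable_add) auto
  also have "\<dots> = (\<integral>e. reward c p r' x' b' e \<partial>P) + \<delta>"
    using integrable_reward b' assms prob_space by (subst Bochner_Integration.integral_add) auto
  finally show "(\<integral>e. reward c p r x b e \<partial>P) \<le> canonical_value c p r' x' P + \<delta>"
    using value_upper[OF b'(1) assms(3,4)] by simp
qed

lemma value_horizon:
  assumes "0 \<le> r1" "r1 \<le> r2" "0 \<le> x"
  shows "\<bar>canonical_value c p r1 x P - canonical_value c p r2 x P\<bar> \<le> p * (r2 - r1)"
proof -
  have "canonical_value c p r2 x P \<le> canonical_value c p r1 x P + p * (r2 - r1)"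
  proof (rule value_comparison)
    fix b assume "b \<in> rules"
    have "AE e in P. reward c p r2 x b e \<le> reward c p r1 x b e + p * (r2 - r1)"
      using regular
    proof eventually_elim
      case (elim e)
      then show ?case
        using assms c_pos p_nonneg by (intro reward_comparison dividends_shorter_horizon) auto
    qed
    with \<open>b \<in> rules\<close> show "\<exists>b'\<in>rules. AE e in P. reward c p r2 x b e \<le> reward c p r1 x b' e + p * (r2 - r1)"
      by blast
  qed (use assms in auto)
  moreover have "canonical_value c p r1 x P \<le> canonical_value c p r2 x P + 0"
  proof (rule value_comparison)
    fix b assume b: "b \<in> rules"
    define b' where "b' = (\<lambda>q g. if q < r1 then b q g else x + p * r1 - fst (snd (g r1)))"
    have "b' q \<in> borel_measurable (history_space q)" for q
    proof (cases "q < r1")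
      case True
      then show ?thesis using b by (simp add: b'_def rules_def)
    next
      case False
      then have "(\<lambda>g. g r1) \<in> measurable (history_space q) borel"
        using assms by (intro measurable_component_singleton) auto
      then have "(\<lambda>g. fst (snd (g r1))) \<in> borel_measurable (history_space q)"
        unfolding borel_prod[symmetric] by measurable
      then show ?thesis
        using False by (simp add: b'_def)
    qed
    then have "b' \<in> rules"
      by (simp add: rules_def)
    moreover have "AE e in P. reward c p r1 x b e \<le> reward c p r2 x b' e + 0"
      using regular
    proof eventually_elim
      case (elim e)
      show ?case
        using assms c_pos p_nonneg dividends_longer_horizon[OF elim p_nonneg assms, of b]
        unfolding b'_def by (intro reward_comparison) auto
    qed
    ultimately show "\<exists>b'\<in>rules. AE e in P. reward c p r1 x b e \<le> reward c p r2 x b' e + 0"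
      by blast
  qed (use assms in auto)
  ultimately show ?thesis
    by linarith
qed

lemma value_mono_capital:
  assumes "0 \<le> r" "0 \<le> x" "x \<le> x'"
  shows "canonical_value c p r x P \<le> canonical_value c p r x' P"
proof -
  have "canonical_value c p r x P \<le> canonical_value c p r x' P + 0"
  proof (rule value_comparison)
    fix b assume "b \<in> rules"
    moreover have "reward c p r x b e \<le> reward c p r x' b e + 0" for e
      using assms c_pos p_nonneg dividends_mono_capital[OF p_nonneg assms]
      by (intro reward_comparison) auto
    ultimately show "\<exists>b'\<in>rules. AE e in P. reward c p r x b e \<le> reward c p r x' b' e + 0"
      by blast
  qed (use assms in auto)
  then show ?thesis by simp
qed

text \<open>
  On a shallow ruin the whole gain is given up; it is at most \<open>x + h + p * r\<close>.
\<close>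

lemma value_capital:
  assumes "0 \<le> r" "0 \<le> x" "0 \<le> h"
  shows "canonical_value c p r (x + h) P \<le> canonical_value c p r x P + h +
    (x + h + p * r) * prob {e\<in>space P. \<exists>k. shallow_ruin p r x h e k}"
proof (rule value_least)
  fix b assume b: "b \<in> rules"
  define b' where "b' = (\<lambda>q g. b q g - h)"
  have b': "b' \<in> rules"
    using b by (auto simp: b'_def rules_def intro!: borel_measurable_diff)
  define A where "A = {e\<in>space P. \<exists>k. shallow_ruin p r x h e k}"
  have A: "A \<in> sets P"
    unfolding A_def by measurable
  have bound: "0 \<le> x + h + p * r"
    using assms p_nonneg by simp
  have le: "AE e in P. reward c p r (x + h) b e \<le> reward c p r x b' e + h + (x + h + p * r) * indicator A e"
    using regular AE_space
  proof eventually_elim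
    case (elim e)
    show ?case
    proof (cases "e \<in> A")
      case True
      then show ?thesis
        using reward_bounds(2)[OF c_pos p_nonneg assms(1), of "x + h" b e]
          reward_bounds(1)[OF c_pos p_nonneg assms(1,2), of b' e] assms by auto
    next
      case False
      then have "\<nexists>k. shallow_ruin p r x h e k"
        using elim by (auto simp: A_def)
      then have "reward c p r (x + h) b e \<le> reward c p r x b' e + h"
        using assms c_pos p_nonneg elim dividends_smaller_capital[OF elim(1) p_nonneg assms]
        unfolding b'_def by (intro reward_comparison) auto
      then show ?thesis using False by simp
    qed
  qed
  have int: "integrable P (\<lambda>e. (x + h + p * r) * indicator A e :: real)"
    using A by (intro integrable_mult_right integrable_real_indicator) (simp_all add: less_top[symmetric])
  have "(\<integral>e. reward c p r (x + h) b e \<partial>P)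
      \<le> (\<integral>e. reward c p r x b' e + h + (x + h + p * r) * indicator A e \<partial>P)"
    using integrable_reward b b' assms int le
    by (intro integral_mono_AE Bochner_Integration.integrable_add) auto
  also have "\<dots> = (\<integral>e. reward c p r x b' e \<partial>P) + h + (x + h + p * r) * prob A"
    using integrable_reward b' assms prob_space int A by simp
  finally show "(\<integral>e. reward c p r (x + h) b e \<partial>P) \<le> canonical_value c p r x P + h +
      (x + h + p * r) * prob {e\<in>space P. \<exists>k. shallow_ruin p r x h e k}"
    using value_upper[OF b' assms(1,2)] unfolding A_def by simp
qed

end

text \<open>
  The hypothesis on \<open>\<Psi>\<close> bounds the total variation distance of the two path laws from one side.
\<close>

lemma value_total_variation:
  assumes "path_prob P c p" "path_prob P' c p" "0 \<le> r" "0 \<le> x"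
    and tv: "\<And>\<Psi>. \<Psi> \<in> borel_measurable path_space \<Longrightarrow> (\<And>e. 0 \<le> \<Psi> e) \<Longrightarrow> (\<And>e. \<Psi> e \<le> x + p * r) \<Longrightarrow>
        (\<integral>e. \<Psi> e \<partial>P) \<le> (\<integral>e. \<Psi> e \<partial>P') + \<delta>"
  shows "canonical_value c p r x P \<le> canonical_value c p r x P' + \<delta>"
proof -
  interpret P: path_prob P c p by fact
  interpret P': path_prob P' c p by fact
  show ?thesis
  proof (rule P.value_least)
    fix b assume b: "b \<in> rules"
    have "(\<integral>e. reward c p r x b e \<partial>P) \<le> (\<integral>e. reward c p r x b e \<partial>P') + \<delta>"
      using assms(3,4) b P.c_pos P.p_nonneg
      by (intro tv measurable_reward reward_bounds) auto
    then show "(\<integral>e. reward c p r x b e \<partial>P) \<le> canonical_value c p r x P' + \<delta>"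
      using P'.value_upper[OF b assms(3,4)] by simp
  qed
qed

section \<open>Laws of claim paths\<close>

definition path_marginal :: "real measure \<Rightarrow> real measure \<Rightarrow> real measure \<Rightarrow> nat + nat \<Rightarrow> real measure" where
  "path_marginal R D C = case_sum (\<lambda>k. if k = 0 then R else D) (\<lambda>_. C)"

text \<open>
  \<open>R\<close>, \<open>D\<close> and \<open>C\<close> are the laws of the first waiting time, of the later waiting times and of the claim sizes.
\<close>

definition path_law :: "real measure \<Rightarrow> real measure \<Rightarrow> real measure \<Rightarrow> path measure" where
  "path_law R D C = PiM UNIV (path_marginal R D C)"

locale renewal_laws = R: real_distribution R + D: real_distribution D + C: real_distribution C
  for R D C :: "real measure" +
  assumes R_pos: "AE y in R. 0 < y" and D_pos: "AE y in D. 0 < y" and C_nonneg: "AE y in C. 0 \<le> y"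
begin

abbreviation "Q \<equiv> path_law R D C"

lemma marginal_prob: "prob_space (path_marginal R D C i)"
  using R.prob_space_axioms D.prob_space_axioms C.prob_space_axioms
  by (auto simp: path_marginal_def split: sum.split)

lemma marginal_sets [measurable_cong]: "sets (path_marginal R D C i) = sets borel"
  by (auto simp: path_marginal_def split: sum.split)

lemma marginal_space [simp]: "space (path_marginal R D C i) = UNIV"
  using sets_eq_imp_space_eq[OF marginal_sets] by simp

lemma sets_path_law [measurable_cong]: "sets Q = sets path_space"
  unfolding path_law_def by (rule sets_PiM_cong) (auto simp: marginal_sets)

lemma space_path_law [simp]: "space Q = UNIV"
  using sets_eq_imp_space_eq[OF sets_path_law] by (simp add: space_PiM)

sublocale Q: prob_space Q
  unfolding path_law_def by (intro prob_space_PiM marginal_prob)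

lemma measurable_fun_upd_path [measurable]:
  "(\<lambda>(y, e). e(j := y)) \<in> measurable (borel \<Otimes>\<^sub>M path_space) path_space"
proof (rule measurable_PiM_single')
  fix i
  show "(\<lambda>z. (case z of (y, e) \<Rightarrow> e(j := y)) i) \<in> borel_measurable (borel \<Otimes>\<^sub>M path_space)"
    using measurable_compose[OF measurable_snd measurable_coord[of i], of borel]
    by (cases "i = j") (simp_all add: case_prod_beta)
qed (auto simp: space_PiM)

text \<open>
  Replacing one coordinate by an independent copy does not change the law.  All facts about independent coordinates
  are obtained from this by integrating over the copy first.
\<close>

lemma resample:
  "distr (path_marginal R D C j \<Otimes>\<^sub>M Q) path_space (\<lambda>(y, e). e(j := y)) = Q"
  using distr_pair_PiM_eq_PiM[of UNIV "path_marginal R D C" j] marginal_prob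
  unfolding path_law_def
  by (simp add: sets_path_law[unfolded path_law_def] cong: distr_cong)

lemma nn_integral_resample:
  assumes [measurable]: "\<Psi> \<in> borel_measurable path_space"
  shows "(\<integral>\<^sup>+ e. \<Psi> e \<partial>Q) = (\<integral>\<^sup>+ e. (\<integral>\<^sup>+ y. \<Psi> (e(j := y)) \<partial>path_marginal R D C j) \<partial>Q)"
proof -
  interpret J: prob_space "path_marginal R D C j" by (rule marginal_prob)
  interpret pair_sigma_finite "path_marginal R D C j" Q ..
  have m [measurable]: "(\<lambda>(y, e). e(j := y)) \<in> measurable (path_marginal R D C j \<Otimes>\<^sub>M Q) path_space"
    using measurable_fun_upd_path by (simp cong: measurable_cong_sets)
  have "(\<integral>\<^sup>+ e. \<Psi> e \<partial>Q) = (\<integral>\<^sup>+ e. \<Psi> e \<partial>distr (path_marginal R D C j \<Otimes>\<^sub>M Q) path_space (\<lambda>(y, e). e(j := y)))"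
    by (simp add: resample)
  also have "\<dots> = (\<integral>\<^sup>+ z. \<Psi> (case z of (y, e) \<Rightarrow> e(j := y)) \<partial>(path_marginal R D C j \<Otimes>\<^sub>M Q))"
    by (intro nn_integral_distr m) simp
  also have "\<dots> = (\<integral>\<^sup>+ e. (\<integral>\<^sup>+ y. \<Psi> (e(j := y)) \<partial>path_marginal R D C j) \<partial>Q)"
    using nn_integral_snd[of "\<lambda>z. \<Psi> (case z of (y, e) \<Rightarrow> e(j := y))"] measurable_compose[OF m assms]
    by simp
  finally show ?thesis .
qed

lemma AE_coord:
  assumes "AE y in path_marginal R D C j. A y"
  shows "AE e in Q. A (e j)"
  unfolding path_law_def using marginal_prob assms by (intro AE_PiM_component) auto

definition laplace :: real where
  "laplace = (\<integral>y. exp (- y) \<partial>D)"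

lemma integrable_exp: "integrable D (\<lambda>y. exp (- y))"
proof (rule D.integrable_const_bound[where B = 1])
  show "AE y in D. norm (exp (- y)) \<le> 1"
    using D_pos by eventually_elim simp
qed simp

lemma laplace_bounds: "0 \<le> laplace" "laplace < 1"
proof -
  show "0 \<le> laplace"
    unfolding laplace_def by simp
  have "(\<integral>y. exp (- y) \<partial>D) < (\<integral>y. 1 \<partial>D)"
    using D_pos integrable_exp D.emeasure_space_1
    by (intro D.integral_less_AE_space) auto
  then show "laplace < 1"
    unfolding laplace_def using D.prob_space by simp
qed

lemma laplace_sum:
  "(\<integral>\<^sup>+ e. ennreal (exp (- (\<Sum>i<n. e (Inl (Suc i))))) \<partial>Q) = ennreal (laplace ^ n)"
proof (induction n)
  case 0
  then show ?case using Q.emeasure_space_1 by simp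
next
  case (Suc n)
  have [measurable]: "(\<lambda>e. \<Sum>i<n. e (Inl (Suc i))) \<in> borel_measurable path_space" for n
    by (intro borel_measurable_sum measurable_coord)
  have marg: "path_marginal R D C (Inl (Suc n)) = D"
    by (simp add: path_marginal_def)
  have "(\<integral>\<^sup>+ e. ennreal (exp (- (\<Sum>i<Suc n. e (Inl (Suc i))))) \<partial>Q)
    = (\<integral>\<^sup>+ e. (\<integral>\<^sup>+ y. ennreal (exp (- (\<Sum>i<n. e (Inl (Suc i))))) * ennreal (exp (- y)) \<partial>D) \<partial>Q)"
  proof (subst nn_integral_resample[where j = "Inl (Suc n)"])
    have "ennreal (exp (- (\<Sum>i<Suc n. (e(Inl (Suc n) := y)) (Inl (Suc i)))))
        = ennreal (exp (- (\<Sum>i<n. e (Inl (Suc i))))) * ennreal (exp (- y))" for e :: path and y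
      by (subst ennreal_mult'[symmetric], simp) (simp add: exp_add[symmetric])
    then show "(\<integral>\<^sup>+ e. (\<integral>\<^sup>+ y. ennreal (exp (- (\<Sum>i<Suc n. (e(Inl (Suc n) := y)) (Inl (Suc i)))))
          \<partial>path_marginal R D C (Inl (Suc n))) \<partial>Q)
      = (\<integral>\<^sup>+ e. (\<integral>\<^sup>+ y. ennreal (exp (- (\<Sum>i<n. e (Inl (Suc i))))) * ennreal (exp (- y)) \<partial>D) \<partial>Q)"
      by (simp only: marg)
  qed measurable
  also have "\<dots> = (\<integral>\<^sup>+ e. ennreal (exp (- (\<Sum>i<n. e (Inl (Suc i))))) * ennreal laplace \<partial>Q)"
    unfolding laplace_def using integrable_exp
    by (simp add: nn_integral_cmult nn_integral_eq_integral)
  also have "\<dots> = ennreal (laplace ^ n) * ennreal laplace"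
    using Suc by (subst nn_integral_multc) auto
  also have "\<dots> = ennreal (laplace ^ Suc n)"
    using laplace_bounds by (simp add: ennreal_mult'[symmetric] mult.commute)
  finally show ?case .
qed

lemma AE_positive: "AE e in Q. (\<forall>k. 0 < e (Inl k)) \<and> (\<forall>k. 0 \<le> e (Inr k))"
proof -
  have "AE y in path_marginal R D C (Inl k). 0 < y" for k
  proof -
    have "path_marginal R D C (Inl k) = R \<or> path_marginal R D C (Inl k) = D"
      by (simp add: path_marginal_def)
    then show ?thesis
      by (elim disjE) (simp_all only: R_pos D_pos)
  qed
  then have "AE e in Q. \<forall>k. 0 < e (Inl k)"
    unfolding AE_all_countable by (intro allI AE_coord)
  moreover have "AE y in path_marginal R D C (Inr k). 0 \<le> y" for k
  proof -
    have "path_marginal R D C (Inr k) = C"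
      by (simp add: path_marginal_def)
    then show ?thesis
      by (simp only: C_nonneg)
  qed
  then have "AE e in Q. \<forall>k. 0 \<le> e (Inr k)"
    unfolding AE_all_countable by (intro allI AE_coord)
  ultimately show ?thesis by simp
qed

text \<open>
  Chernoff bound.  The first waiting time is dropped, so the bound is uniform over its law, which is the only
  part of the path law that depends on the elapsed time.
\<close>

lemma arrival_tail: "Q.prob {e. arrival e n \<le> t} \<le> exp t * laplace ^ n"
proof -
  have [measurable]: "(\<lambda>e. \<Sum>i<n. e (Inl (Suc i))) \<in> borel_measurable path_space" for n
    by (intro borel_measurable_sum measurable_coord)
  have [measurable]: "{e. arrival e n \<le> t} \<in> sets Q"
    using borel_measurable_le[OF measurable_arrival[of n] borel_measurable_const[of t]]
    by (simp add: sets_path_law space_PiM)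
  have "emeasure Q {e. arrival e n \<le> t} = (\<integral>\<^sup>+ e. indicator {e. arrival e n \<le> t} e \<partial>Q)"
    by simp
  also have "\<dots> \<le> (\<integral>\<^sup>+ e. ennreal (exp t) * ennreal (exp (- (\<Sum>i<n. e (Inl (Suc i))))) \<partial>Q)"
  proof (rule nn_integral_mono_AE)
    show "AE e in Q. indicator {e. arrival e n \<le> t} e
      \<le> ennreal (exp t) * ennreal (exp (- (\<Sum>i<n. e (Inl (Suc i)))))"
      using AE_positive
    proof eventually_elim
      case (elim e)
      have "1 \<le> exp (t - (\<Sum>i<n. e (Inl (Suc i))))" if "arrival e n \<le> t"
      proof -
        have "arrival e n = e (Inl 0) + (\<Sum>i<n. e (Inl (Suc i)))"
          unfolding arrival_def by (simp add: sum.atMost_shift)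
        then have "0 \<le> t - (\<Sum>i<n. e (Inl (Suc i)))"
          using that elim by (smt (verit))
        then show ?thesis by simp
      qed
      then show ?case
        by (auto simp: indicator_def ennreal_mult'[symmetric] exp_add[symmetric] simp flip: ennreal_1)
    qed
  qed
  also have "\<dots> = ennreal (exp t * laplace ^ n)"
    by (subst nn_integral_cmult) (auto simp: laplace_sum ennreal_mult'[symmetric])
  finally show ?thesis
    using laplace_bounds by (simp add: Q.emeasure_eq_measure)
qed

lemma laplace_power_tendsto: "(\<lambda>n. exp t * laplace ^ n) \<longlonglongrightarrow> 0"
  using laplace_bounds by (intro tendsto_mult_right_zero LIMSEQ_power_zero) simp

lemma AE_regular: "AE e in Q. regular_path e"
proof -
  have "AE e in Q. \<exists>k. real N < arrival e k" for N
  proof -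
    have meas: "{e. arrival e n \<le> real N} \<in> sets Q" for n
      using borel_measurable_le[OF measurable_arrival[of n] borel_measurable_const[of "real N"]]
      by (simp add: sets_path_law space_PiM)
    define Z where "Z = (\<Inter>n. {e. arrival e n \<le> real N})"
    have Z: "Z \<in> sets Q"
      unfolding Z_def using meas by auto
    have "Q.prob Z \<le> 0"
    proof (rule LIMSEQ_le_const[OF laplace_power_tendsto[of "real N"]])
      have "Q.prob Z \<le> exp (real N) * laplace ^ n" for n
        using Q.finite_measure_mono[OF _ meas[of n], of Z] arrival_tail[of n "real N"]
        by (auto simp: Z_def intro: order_trans)
      then show "\<exists>m. \<forall>n\<ge>m. Q.prob Z \<le> exp (real N) * laplace ^ n"
        by blast
    qed
    then have "Z \<in> null_sets Q"
      using Z by (simp add: null_sets_def Q.emeasure_eq_measure measure_nonneg order_antisym)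
    then have "AE e in Q. e \<notin> Z"
      by (rule AE_not_in)
    then show ?thesis
      by eventually_elim (auto simp: Z_def not_le)
  qed
  then have "AE e in Q. \<forall>N. \<exists>k. real N < arrival e k"
    by (simp add: AE_all_countable)
  with AE_positive show ?thesis
  proof eventually_elim
    case (elim e)
    have "\<exists>k. t < arrival e k" for t
      using elim(2) real_arch_simple[of t] by (meson le_less_trans)
    with elim(1) show ?case
      by (simp add: regular_path_def)
  qed
qed

lemma path_prob: "0 < c \<Longrightarrow> 0 \<le> p \<Longrightarrow> path_prob Q c p"
  by unfold_locales (auto simp: sets_path_law AE_regular)

text \<open>
  The surplus \<open>y\<close> before claim \<open>k\<close> is a function of the other coordinates, so claim \<open>k\<close> can be resampled; it must then
  fall into an interval of length \<open>h\<close>.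
\<close>

lemma prob_shallow_ruin_at:
  assumes "\<And>y. 0 \<le> y \<Longrightarrow> measure C {y<..y + h} \<le> \<omega>" "0 \<le> \<omega>"
  shows "Q.prob {e. shallow_ruin p r x h e k} \<le> \<omega>"
proof -
  have meas: "{e. shallow_ruin p r x h e k} \<in> sets path_space"
    using measurable_shallow_ruin[of p r x h k] by (simp add: pred_def space_PiM)
  have [measurable]: "indicator {e. shallow_ruin p r x h e k} \<in> borel_measurable path_space"
    using meas by simp
  have marg: "path_marginal R D C (Inr k) = C"
    by (simp add: path_marginal_def)
  have "emeasure Q {e. shallow_ruin p r x h e k} = (\<integral>\<^sup>+ e. indicator {e. shallow_ruin p r x h e k} e \<partial>Q)"
    using meas by (simp add: sets_path_law)
  also have "\<dots> = (\<integral>\<^sup>+ e. (\<integral>\<^sup>+ y. indicator {e. shallow_ruin p r x h e k} (e(Inr k := y)) \<partial>C) \<partial>Q)"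
    using nn_integral_resample[of "indicator {e. shallow_ruin p r x h e k}" "Inr k"] by (simp add: marg)
  also have "\<dots> \<le> (\<integral>\<^sup>+ e. ennreal \<omega> \<partial>Q)"
  proof (rule nn_integral_mono)
    fix e
    define z where "z = x + p * arrival e k - (\<Sum>i<k. e (Inr i))"
    have "shallow_ruin p r x h (e(Inr k := y)) k \<Longrightarrow> 0 \<le> z \<and> y \<in> {z<..z + h}" for y
      by (auto simp: shallow_ruin_def Let_def z_def arrival_def)
    then have "(\<integral>\<^sup>+ y. indicator {e. shallow_ruin p r x h e k} (e(Inr k := y)) \<partial>C)
      \<le> (\<integral>\<^sup>+ y. indicator (if 0 \<le> z then {z<..z + h} else {}) y \<partial>C)"
      by (intro nn_integral_mono) (auto simp: indicator_def)
    also have "\<dots> \<le> ennreal \<omega>"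
      using assms by (auto simp: C.emeasure_eq_measure)
    finally show "(\<integral>\<^sup>+ y. indicator {e. shallow_ruin p r x h e k} (e(Inr k := y)) \<partial>C) \<le> ennreal \<omega>" .
  qed
  also have "\<dots> = ennreal \<omega>"
    using Q.emeasure_space_1 by simp
  finally show ?thesis
    using assms(2) by (simp add: Q.emeasure_eq_measure)
qed

text \<open>
  A shallow ruin occurs at one of the first \<open>n\<close> claims, or else more than \<open>n\<close> claims arrive before \<open>r\<close>.
\<close>

lemma prob_shallow_ruin:
  assumes "\<And>y. 0 \<le> y \<Longrightarrow> measure C {y<..y + h} \<le> \<omega>" "0 \<le> \<omega>"
  shows "Q.prob {e. \<exists>k. shallow_ruin p r x h e k} \<le> real n * \<omega> + exp r * laplace ^ n"
proof -
  let ?S = "\<lambda>k. {e. shallow_ruin p r x h e k}"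
  have meas: "?S k \<in> sets Q" for k
    using measurable_shallow_ruin[of p r x h k] by (simp add: pred_def space_PiM sets_path_law)
  have tail: "{e. arrival e n \<le> r} \<in> sets Q"
    using borel_measurable_le[OF measurable_arrival[of n] borel_measurable_const[of r]]
    by (simp add: sets_path_law space_PiM)
  have "Q.prob {e. \<exists>k. shallow_ruin p r x h e k} \<le> Q.prob ((\<Union>k<n. ?S k) \<union> {e. arrival e n \<le> r})"
  proof (rule Q.finite_measure_mono_AE)
    show "AE e in Q. e \<in> {e. \<exists>k. shallow_ruin p r x h e k} \<longrightarrow> e \<in> (\<Union>k<n. ?S k) \<union> {e. arrival e n \<le> r}"
      using AE_regular
    proof eventually_elim
      case (elim e)
      have "k < n \<or> arrival e n \<le> r" if "shallow_ruin p r x h e k" for k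
        using that strict_mono_less_eq[OF arrival_strict_mono[OF elim], of n k]
        by (auto simp: shallow_ruin_def not_less)
      then show ?case by auto
    qed
  qed (use meas tail in auto)
  also have "\<dots> \<le> Q.prob (\<Union>k<n. ?S k) + Q.prob {e. arrival e n \<le> r}"
    using meas tail by (intro measure_subadditive) auto
  also have "Q.prob (\<Union>k<n. ?S k) \<le> (\<Sum>k<n. Q.prob (?S k))"
    using meas by (intro measure_subadditive_finite) auto
  also have "\<dots> \<le> (\<Sum>k<n. \<omega>)"
    by (intro sum_mono prob_shallow_ruin_at assms)
  finally show ?thesis
    using arrival_tail[of n r] by simp
qed

end

text \<open>
  Integrating out all coordinates but the first waiting time turns \<open>\<Psi>\<close> into a function of that time with the same
  bounds.
\<close>

lemma path_law_total_variation:
  fixes \<Psi> :: "path \<Rightarrow> real" and \<beta> \<delta> :: real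
  assumes "renewal_laws R D C" "renewal_laws R' D C"
    and \<Psi>: "\<Psi> \<in> borel_measurable path_space" "\<And>e. 0 \<le> \<Psi> e" "\<And>e. \<Psi> e \<le> \<beta>"
    and tv: "\<And>H. H \<in> borel_measurable borel \<Longrightarrow> (\<And>y. 0 \<le> H y) \<Longrightarrow> (\<And>y. H y \<le> \<beta>) \<Longrightarrow>
        (\<integral>y. H y \<partial>R) \<le> (\<integral>y. H y \<partial>R') + \<delta>"
  shows "(\<integral>e. \<Psi> e \<partial>path_law R D C) \<le> (\<integral>e. \<Psi> e \<partial>path_law R' D C) + \<delta>"
proof -
  define N where "N = PiM (UNIV - {Inl 0}) (path_marginal R D C)"
  define H where "H y = (\<integral>e. \<Psi> (e(Inl 0 := y)) \<partial>N)" for y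
  have *: "(\<integral>e. \<Psi> e \<partial>path_law S D C) = (\<integral>y. H y \<partial>S) \<and> H \<in> borel_measurable borel
      \<and> (\<forall>y. 0 \<le> H y \<and> H y \<le> \<beta>)"
    if "renewal_laws S D C" for S
  proof -
    interpret renewal_laws S D C by fact
    have N_eq: "N = PiM (UNIV - {Inl 0}) (path_marginal S D C)"
      unfolding N_def by (intro PiM_cong) (auto simp: path_marginal_def split: sum.split)
    interpret N: prob_space N
      unfolding N_eq by (intro prob_space_PiM marginal_prob)
    interpret SN: pair_prob_space S N ..
    have setsN [measurable_cong]: "sets N = sets (PiM (UNIV - {Inl 0}) (\<lambda>_. borel))"
      unfolding N_eq by (rule sets_PiM_cong) (auto simp: marginal_sets)
    have upd [measurable]: "(\<lambda>(y, e). e(Inl 0 := y)) \<in> measurable (S \<Otimes>\<^sub>M N) path_space"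
    proof (rule measurable_PiM_single')
      fix i :: "nat + nat"
      show "(\<lambda>z. (case z of (y, e) \<Rightarrow> e(Inl 0 := y)) i) \<in> borel_measurable (S \<Otimes>\<^sub>M N)"
      proof (cases "i = Inl 0")
        case False
        then have "(\<lambda>e. e i) \<in> borel_measurable N"
          using measurable_component_singleton[of i "UNIV - {Inl 0}" "\<lambda>_. borel"]
          by (simp cong: measurable_cong_sets add: setsN)
        then have "(\<lambda>z. snd z i) \<in> borel_measurable (S \<Otimes>\<^sub>M N)"
          by (rule measurable_compose[OF measurable_snd])
        then show ?thesis using False by (simp add: case_prod_beta)
      qed (simp add: case_prod_beta)
    qed (auto simp: space_PiM)
    have \<Psi>m: "(\<lambda>z. \<Psi> (case z of (y, e) \<Rightarrow> e(Inl 0 := y))) \<in> borel_measurable (S \<Otimes>\<^sub>M N)"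
      by (rule measurable_compose[OF upd \<Psi>(1)])
    have bound: "norm (\<Psi> e) \<le> \<beta>" for e
      using \<Psi>(2,3)[of e] by simp
    have law: "path_law S D C = distr (S \<Otimes>\<^sub>M N) path_space (\<lambda>(y, e). e(Inl 0 := y))"
    proof -
      have "insert (Inl 0) (UNIV - {Inl 0}) = (UNIV :: (nat + nat) set)"
        by auto
      moreover have "path_marginal S D C (Inl 0) = S"
        by (simp add: path_marginal_def)
      ultimately have "distr (S \<Otimes>\<^sub>M N) (path_law S D C) (\<lambda>(y, e). e(Inl 0 := y)) = path_law S D C"
        using distr_pair_PiM_eq_PiM[of "UNIV - {Inl 0}" "path_marginal S D C" "Inl 0"]
          marginal_prob[of "Inl 0"] marginal_prob
        unfolding path_law_def N_eq by simp
      moreover have "distr (S \<Otimes>\<^sub>M N) (path_law S D C) (\<lambda>(y, e). e(Inl 0 := y))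
          = distr (S \<Otimes>\<^sub>M N) path_space (\<lambda>(y, e). e(Inl 0 := y))"
        by (rule distr_cong) (simp_all add: sets_path_law)
      ultimately show ?thesis by simp
    qed
    have "(\<integral>e. \<Psi> e \<partial>path_law S D C) = (\<integral>z. \<Psi> (case z of (y, e) \<Rightarrow> e(Inl 0 := y)) \<partial>(S \<Otimes>\<^sub>M N))"
      unfolding law by (intro integral_distr upd \<Psi>)
    also have "\<dots> = (\<integral>y. H y \<partial>S)"
    proof -
      have "integrable (S \<Otimes>\<^sub>M N) (\<lambda>z. \<Psi> (case z of (y, e) \<Rightarrow> e(Inl 0 := y)))"
        by (rule SN.P.integrable_const_bound[where B = \<beta>, OF _ \<Psi>m]) (intro AE_I2 bound)
      from SN.integral_fst'[OF this] show ?thesis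
        by (simp add: H_def)
    qed
    finally have 1: "(\<integral>e. \<Psi> e \<partial>path_law S D C) = (\<integral>y. H y \<partial>S)" .
    have "H \<in> borel_measurable S"
      unfolding H_def using N.borel_measurable_lebesgue_integral[of "\<lambda>y e. \<Psi> (e(Inl 0 := y))" S] \<Psi>m
      by (simp add: case_prod_beta)
    then have 2: "H \<in> borel_measurable borel"
      by (simp cong: measurable_cong_sets)
    have 3: "0 \<le> H y \<and> H y \<le> \<beta>" for y
    proof -
      have "(\<lambda>e. (y, e)) \<in> measurable N (S \<Otimes>\<^sub>M N)"
        by (intro measurable_Pair1') simp
      from measurable_compose[OF this \<Psi>m] have "integrable N (\<lambda>e. \<Psi> (e(Inl 0 := y)))"
        by (intro N.integrable_const_bound[where B = \<beta>] AE_I2 bound) simp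
      then show ?thesis
        unfolding H_def using \<Psi> by (auto intro!: integral_nonneg_AE N.integral_le_const)
    qed
    show ?thesis using 1 2 3 by blast
  qed
  show ?thesis
    using *[OF assms(1)] *[OF assms(2)] tv[of H] by auto
qed

section \<open>The residual waiting time\<close>

locale hazard_rate =
  fixes lam :: "real \<Rightarrow> real"
  assumes lam_cont: "continuous_on {0..} lam" and lam_nonneg: "\<And>t. 0 \<le> t \<Longrightarrow> 0 \<le> lam t"
    and lam_exhaust: "((\<lambda>t. exp (- integral {0..t} lam)) \<longlongrightarrow> 0) at_top"
begin

text \<open>
  On \<open>[0, \<infinity>)\<close> this is the integral of \<open>lam\<close> from 0.  The integrand is extended to the left of 0, and integration starts
  at \<open>-1\<close>, so that the derivative is two-sided at 0 as well.
\<close>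

definition cumulative :: "real \<Rightarrow> real" where
  "cumulative t = integral {-1..t} (\<lambda>u. lam (max 0 u)) - integral {-1..0} (\<lambda>u. lam (max 0 u))"

lemma lam_ext_cont: "continuous_on UNIV (\<lambda>u. lam (max 0 u))"
  by (rule continuous_on_compose2[OF lam_cont]) (auto intro!: continuous_intros)

lemma cumulative_deriv: "0 \<le> t \<Longrightarrow> (cumulative has_real_derivative lam t) (at t)"
proof -
  assume t: "0 \<le> t"
  have "((\<lambda>t. integral {-1..t} (\<lambda>u. lam (max 0 u))) has_real_derivative lam (max 0 t)) (at t within {-1..t+1})"
    using t by (intro integral_has_real_derivative continuous_on_subset[OF lam_ext_cont]) auto
  then have "((\<lambda>t. integral {-1..t} (\<lambda>u. lam (max 0 u))) has_real_derivative lam t) (at t)"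
    using t by (simp add: at_within_Icc_at)
  then show ?thesis
    unfolding cumulative_def by (auto intro!: derivative_eq_intros)
qed

lemma integral_lam:
  assumes "0 \<le> a" "a \<le> b"
  shows "integral {a..b} lam = cumulative b - cumulative a"
proof -
  have "integral {a..b} lam = integral {a..b} (\<lambda>u. lam (max 0 u))"
    using assms by (intro integral_cong) auto
  moreover have "integral {-1..a} (\<lambda>u. lam (max 0 u)) + integral {a..b} (\<lambda>u. lam (max 0 u))
      = integral {-1..b} (\<lambda>u. lam (max 0 u))"
    using assms by (intro Henstock_Kurzweil_Integration.integral_combine integrable_continuous_interval
        continuous_on_subset[OF lam_ext_cont]) auto
  ultimately show ?thesis
    by (simp add: cumulative_def)
qed

lemma cumulative_0: "cumulative 0 = 0"
  by (simp add: cumulative_def)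

lemma cumulative_cont: "continuous_on {0..} cumulative"
  using cumulative_deriv by (auto intro!: continuous_at_imp_continuous_on DERIV_isCont)

definition residual_density :: "real \<Rightarrow> real \<Rightarrow> real" where
  "residual_density w y = (if y < 0 then 0 else lam (w + y) * exp (cumulative w - cumulative (w + y)))"

definition residual :: "real \<Rightarrow> real measure" where
  "residual w = density lborel (\<lambda>y. ennreal (residual_density w y))"

lemma residual_density_nonneg: "0 \<le> w \<Longrightarrow> 0 \<le> residual_density w y"
  by (simp add: residual_density_def lam_nonneg)

lemma residual_density_measurable_aux:
  assumes "0 \<le> w"
  shows "(\<lambda>y. lam (w + max 0 y) * exp (cumulative w - cumulative (w + max 0 y))) \<in> borel_measurable borel"
  using assms
  by (intro borel_measurable_continuous_onI continuous_intros
      continuous_on_compose2[OF lam_cont] continuous_on_compose2[OF cumulative_cont]) auto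

lemma residual_density_measurable [measurable]:
  assumes "0 \<le> w"
  shows "residual_density w \<in> borel_measurable borel"
proof -
  have "residual_density w = (\<lambda>y. if y < 0 then 0 else lam (w + max 0 y) * exp (cumulative w - cumulative (w + max 0 y)))"
    by (auto simp: residual_density_def)
  then show ?thesis
    using residual_density_measurable_aux[OF assms] by simp
qed

lemma residual_integral:
  assumes "0 \<le> w" "0 \<le> a"
  shows "(\<integral>\<^sup>+ y. ennreal (residual_density w y) * indicator {a..} y \<partial>lborel)
    = ennreal (exp (- integral {w..w + a} lam))"
proof -
  define F where "F y = - exp (cumulative w - cumulative (w + y))" for y
  have eq: "ennreal (residual_density w y) * indicator {a..} y
      = ennreal (lam (w + max 0 y) * exp (cumulative w - cumulative (w + max 0 y))) * indicator {a..} y" for y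
    using assms by (auto simp: residual_density_def indicator_def)
  have "(\<integral>\<^sup>+ y. ennreal (residual_density w y) * indicator {a..} y \<partial>lborel) = ennreal (0 - F a)"
    unfolding eq
  proof (rule nn_integral_FTC_atLeast[OF residual_density_measurable_aux[OF assms(1)]])
    fix y assume y: "a \<le> y"
    have "((\<lambda>y. cumulative (w + y)) has_real_derivative lam (w + y) * 1) (at y)"
      using assms y by (intro DERIV_chain2[OF cumulative_deriv] derivative_eq_intros) auto
    then show "(F has_real_derivative lam (w + max 0 y) * exp (cumulative w - cumulative (w + max 0 y))) (at y)"
      using assms y unfolding F_def by (auto intro!: derivative_eq_intros)
    show "0 \<le> lam (w + max 0 y) * exp (cumulative w - cumulative (w + max 0 y))"
      using assms by (simp add: lam_nonneg)
  next
    have "((\<lambda>y. exp (- integral {0..w + y} lam)) \<longlongrightarrow> 0) at_top"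
      by (rule filterlim_compose[OF lam_exhaust filterlim_tendsto_add_at_top[OF tendsto_const filterlim_ident]])
    then have "((\<lambda>y. - exp (cumulative w) * exp (- integral {0..w + y} lam)) \<longlongrightarrow> - exp (cumulative w) * 0) at_top"
      by (intro tendsto_mult tendsto_const)
    moreover have "\<forall>\<^sub>F y in at_top. - exp (cumulative w) * exp (- integral {0..w + y} lam) = F y"
      using eventually_ge_at_top[of 0]
    proof eventually_elim
      case (elim y)
      then show ?case
        using assms by (simp add: integral_lam F_def cumulative_0 exp_diff exp_minus field_simps)
    qed
    ultimately show "(F \<longlongrightarrow> 0) at_top"
      by (auto intro: Lim_transform_eventually)
  qed
  then show ?thesis
    using assms by (simp add: F_def integral_lam)
qed

lemma sets_residual [simp, measurable_cong]: "sets (residual w) = sets borel"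
  by (simp add: residual_def)

lemma space_residual [simp]: "space (residual w) = UNIV"
  by (simp add: residual_def)

lemma emeasure_residual:
  assumes "0 \<le> w" "A \<in> sets borel"
  shows "emeasure (residual w) A = (\<integral>\<^sup>+ y. ennreal (residual_density w y) * indicator A y \<partial>lborel)"
  unfolding residual_def using assms by (intro emeasure_density) auto

lemma residual_tail:
  assumes "0 \<le> w" "0 \<le> a"
  shows "emeasure (residual w) {a<..} = ennreal (exp (- integral {w..w + a} lam))"
proof -
  have "emeasure (residual w) {a<..} = (\<integral>\<^sup>+ y. ennreal (residual_density w y) * indicator {a<..} y \<partial>lborel)"
    using assms by (intro emeasure_residual) auto
  also have "\<dots> = (\<integral>\<^sup>+ y. ennreal (residual_density w y) * indicator {a..} y \<partial>lborel)"
  proof (rule nn_integral_cong_AE)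
    show "AE y in lborel. ennreal (residual_density w y) * indicator {a<..} y
        = ennreal (residual_density w y) * indicator {a..} y"
      using AE_lborel_singleton[of a] by eventually_elim (auto simp: indicator_def)
  qed
  finally show ?thesis
    using residual_integral[OF assms] by simp
qed

lemma residual_total: "0 \<le> w \<Longrightarrow> (\<integral>\<^sup>+ y. ennreal (residual_density w y) \<partial>lborel) = 1"
proof -
  assume w: "0 \<le> w"
  have "ennreal (residual_density w y) = ennreal (residual_density w y) * indicator {0..} y" for y
    by (auto simp: residual_density_def indicator_def)
  then show ?thesis
    using residual_integral[OF w, of 0] by simp
qed

lemma real_distribution_residual: "0 \<le> w \<Longrightarrow> real_distribution (residual w)"
proof -
  assume w: "0 \<le> w"
  have "prob_space (residual w)"
    by (rule prob_spaceI) (use emeasure_residual[OF w, of UNIV] residual_total[OF w] in simp)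
  then show ?thesis
    by (intro real_distribution.intro) (auto simp: real_distribution_axioms_def)
qed

lemma residual_pos: "0 \<le> w \<Longrightarrow> AE y in residual w. 0 < y"
proof -
  assume w: "0 \<le> w"
  interpret real_distribution "residual w" by (rule real_distribution_residual[OF w])
  have "emeasure (residual w) {0<..} = 1"
    using residual_tail[OF w, of 0] by simp
  then have "prob {0<..} = 1"
    by (simp add: emeasure_eq_measure)
  then show ?thesis
    using AE_in_set_eq_1[of "{0<..}"] by simp
qed

lemma integrable_residual_density: "0 \<le> w \<Longrightarrow> integrable lborel (residual_density w)"
  using residual_total[of w] residual_density_nonneg[of w]
  by (intro integrableI_nonneg) auto

text \<open>
  For probability densities this is the total variation distance.
\<close>

definition residual_excess :: "real \<Rightarrow> real \<Rightarrow> real" where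
  "residual_excess w w' = (\<integral>y. max 0 (residual_density w y - residual_density w' y) \<partial>lborel)"

lemma integral_residual:
  assumes "0 \<le> w" "H \<in> borel_measurable borel"
  shows "(\<integral>y. H y \<partial>residual w) = (\<integral>y. residual_density w y * H y \<partial>lborel)"
  unfolding residual_def using assms residual_density_nonneg[OF assms(1)]
  by (subst integral_density) auto

text \<open>
  The second inequality is the first one for \<open>\<beta> - H\<close> in place of \<open>H\<close>.
\<close>

lemma residual_total_variation:
  assumes "0 \<le> w" "0 \<le> w'" and H: "H \<in> borel_measurable borel" "\<And>y. 0 \<le> H y" "\<And>y. H y \<le> \<beta>"
  shows "(\<integral>y. H y \<partial>residual w) \<le> (\<integral>y. H y \<partial>residual w') + \<beta> * residual_excess w w'"
    and "(\<integral>y. H y \<partial>residual w') \<le> (\<integral>y. H y \<partial>residual w) + \<beta> * residual_excess w w'"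
proof -
  have *: "(\<integral>y. H y \<partial>residual w) \<le> (\<integral>y. H y \<partial>residual w') + \<beta> * residual_excess w w'"
    if H: "H \<in> borel_measurable borel" "\<And>y. 0 \<le> H y" "\<And>y. H y \<le> \<beta>" for H :: "real \<Rightarrow> real"
  proof -
    have int: "integrable lborel (\<lambda>y. residual_density v y * H y)" if "0 \<le> v" for v
    proof (rule Bochner_Integration.integrable_bound[OF integrable_mult_right[OF integrable_residual_density[OF that], of \<beta>]])
      show "AE y in lborel. norm (residual_density v y * H y) \<le> norm (\<beta> * residual_density v y)"
      proof (rule AE_I2)
        fix y
        have "\<bar>H y\<bar> \<le> \<bar>\<beta>\<bar>"
          using H(2)[of y] H(3)[of y] by simp
        then show "norm (residual_density v y * H y) \<le> norm (\<beta> * residual_density v y)"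
          by (simp add: abs_mult mult.commute[of "\<bar>residual_density v y\<bar>"] mult_right_mono)
      qed
    next
      have "(\<lambda>y. residual_density v y * H y) \<in> borel_measurable borel"
        by (intro borel_measurable_times residual_density_measurable that H)
      then show "(\<lambda>y. residual_density v y * H y) \<in> borel_measurable lborel"
        by simp
    qed
    have exc: "integrable lborel (\<lambda>y. \<beta> * max 0 (residual_density w y - residual_density w' y))"
      using assms by (intro integrable_mult_right integrable_max Bochner_Integration.integrable_diff
          integrable_residual_density) auto
    have "(\<integral>y. residual_density w y * H y \<partial>lborel)
      \<le> (\<integral>y. residual_density w' y * H y + \<beta> * max 0 (residual_density w y - residual_density w' y) \<partial>lborel)"
    proof (rule integral_mono[OF int Bochner_Integration.integrable_add[OF int exc]])
      fix y
      have "(residual_density w y - residual_density w' y) * H y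
          \<le> max 0 (residual_density w y - residual_density w' y) * H y"
        using H by (intro mult_right_mono) auto
      also have "\<dots> \<le> max 0 (residual_density w y - residual_density w' y) * \<beta>"
        using H by (intro mult_left_mono) auto
      finally show "residual_density w y * H y
          \<le> residual_density w' y * H y + \<beta> * max 0 (residual_density w y - residual_density w' y)"
        by (simp add: algebra_simps)
    qed (use assms in auto)
    also have "\<dots> = (\<integral>y. residual_density w' y * H y \<partial>lborel) + \<beta> * residual_excess w w'"
      unfolding residual_excess_def using int[OF assms(2)] exc
      by (subst Bochner_Integration.integral_add) auto
    finally show ?thesis
      using assms H by (simp add: integral_residual)
  qed
  show "(\<integral>y. H y \<partial>residual w) \<le> (\<integral>y. H y \<partial>residual w') + \<beta> * residual_excess w w'"
    by (rule *[OF H])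
  interpret W: real_distribution "residual w" by (rule real_distribution_residual[OF assms(1)])
  interpret W': real_distribution "residual w'" by (rule real_distribution_residual[OF assms(2)])
  have bd: "norm (H y) \<le> \<beta>" for y
    using H(2)[of y] H(3)[of y] by simp
  have iW: "integrable (residual w) H" and iW': "integrable (residual w') H"
    using H(1) bd by (auto intro!: W.integrable_const_bound[where B = \<beta>] W'.integrable_const_bound[where B = \<beta>]
        simp: measurable_def)
  have "(\<integral>y. \<beta> - H y \<partial>residual w) \<le> (\<integral>y. \<beta> - H y \<partial>residual w') + \<beta> * residual_excess w w'"
    using H by (intro *) (auto simp: le_diff_eq)
  then show "(\<integral>y. H y \<partial>residual w') \<le> (\<integral>y. H y \<partial>residual w) + \<beta> * residual_excess w w'"
    using iW iW' W.prob_space W'.prob_space by simp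
qed

text \<open>
  Scheffe's argument: the positive part of the difference of the densities is dominated by the limiting density,
  so pointwise convergence of the densities suffices.
\<close>

lemma residual_excess_tendsto:
  assumes w: "w \<longlonglongrightarrow> w0" "\<And>n. 0 \<le> w n" "0 \<le> w0"
  shows "(\<lambda>n. residual_excess w0 (w n)) \<longlonglongrightarrow> 0"
proof -
  have "(\<lambda>n. \<integral>y. max 0 (residual_density w0 y - residual_density (w n) y) \<partial>lborel)
    \<longlonglongrightarrow> (\<integral>y. 0 \<partial>(lborel :: real measure))"
  proof (rule integral_dominated_convergence[where w = "residual_density w0"])
    show "AE y in lborel. (\<lambda>n. max 0 (residual_density w0 y - residual_density (w n) y)) \<longlonglongrightarrow> 0"
    proof (rule AE_I2)
      fix y
      have lim: "(\<lambda>n. g (w n + y)) \<longlonglongrightarrow> g (w0 + y)" if "continuous_on {0..} g" "0 \<le> y" for g :: "real \<Rightarrow> real"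
        using w that by (intro continuous_on_tendsto_compose[OF that(1)] tendsto_intros) auto
      have "(\<lambda>n. residual_density (w n) y) \<longlonglongrightarrow> residual_density w0 y"
      proof (cases "y < 0")
        case False
        then show ?thesis
          unfolding residual_density_def
          using lim[OF lam_cont] lim[OF cumulative_cont]
            continuous_on_tendsto_compose[OF cumulative_cont w(1)] w
          by (auto intro!: tendsto_intros)
      qed (simp add: residual_density_def)
      then have "(\<lambda>n. max 0 (residual_density w0 y - residual_density (w n) y))
          \<longlonglongrightarrow> max 0 (residual_density w0 y - residual_density w0 y)"
        by (intro tendsto_intros)
      then show "(\<lambda>n. max 0 (residual_density w0 y - residual_density (w n) y)) \<longlonglongrightarrow> 0"
        by simp
    qed
    show "AE y in lborel. norm (max 0 (residual_density w0 y - residual_density (w n) y)) \<le> residual_density w0 y" for n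
      using residual_density_nonneg[OF w(2)[of n]] residual_density_nonneg[OF w(3)]
      by (intro AE_I2) (auto simp: max_def)
  qed (use w integrable_residual_density in auto)
  then show ?thesis
    by (simp add: residual_excess_def)
qed

end

section \<open>Continuity of the value on path space\<close>

text \<open>
  Uniform continuity on a compact interval, and little mass beyond it.  The half-open interval excludes its left
  end point, so an atom at 0 does no harm.
\<close>

lemma cdf_uniform_modulus:
  assumes "real_distribution C" "continuous_on {0..} (cdf C)" "0 < \<epsilon>"
  shows "\<exists>h0>0. \<forall>h y. 0 \<le> y \<and> h \<le> h0 \<longrightarrow> measure C {y<..y + h} \<le> \<epsilon>"
proof -
  interpret real_distribution C by fact
  have incr: "measure C {y<..y + h} = cdf C (y + h) - cdf C y" if "0 \<le> h" for y h
    using cdf_diff_eq[of y "y + h"] that by (cases "h = 0") auto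
  have "\<forall>\<^sub>F a in at_top. 1 - \<epsilon> < cdf C a"
    using cdf_lim_at_top_prob assms(3) by (auto simp: order_tendsto_iff)
  then obtain A0 where "\<And>a. A0 \<le> a \<Longrightarrow> 1 - \<epsilon> < cdf C a"
    unfolding eventually_at_top_linorder by blast
  then obtain A where A: "0 \<le> A" "1 - \<epsilon> < cdf C A"
    using that[of "max 0 A0"] by force
  have "uniformly_continuous_on {0..A + 1} (cdf C)"
    using assms(2) by (intro compact_uniformly_continuous) (auto elim: continuous_on_subset)
  then obtain d where d: "0 < d" "\<And>u v. u \<in> {0..A + 1} \<Longrightarrow> v \<in> {0..A + 1} \<Longrightarrow> dist v u < d \<Longrightarrow> dist (cdf C v) (cdf C u) < \<epsilon>"
    using assms(3) unfolding uniformly_continuous_on_def by metis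
  show ?thesis
  proof (intro exI conjI allI impI)
    show "0 < min 1 (d / 2)" using d by simp
    fix h y :: real assume hy: "0 \<le> y \<and> h \<le> min 1 (d / 2)"
    show "measure C {y<..y + h} \<le> \<epsilon>"
    proof (cases "0 \<le> h")
      case False
      then show ?thesis using assms(3) by simp
    next
      case h: True
      show ?thesis
      proof (cases "y \<le> A")
        case True
        then have "dist (cdf C (y + h)) (cdf C y) < \<epsilon>"
          using hy h d(1) by (intro d(2)) (auto simp: dist_real_def)
        then show ?thesis
          using incr[OF h, of y] by (simp add: dist_real_def)
      next
        case False
        then have "1 - \<epsilon> < cdf C y"
          using A cdf_nondecreasing[of A y] by simp
        then show ?thesis
          using incr[OF h, of y] cdf_bounded_prob[of "y + h"] by simp
      qed
    qed
  qed
qed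

locale dividend_model = hazard_rate lam + D: real_distribution D + C: real_distribution C
  for lam :: "real \<Rightarrow> real" and D C :: "real measure" +
  fixes c p :: real
  assumes D_pos: "AE y in D. 0 < y" and C_nonneg: "AE y in C. 0 \<le> y"
    and C_cont: "continuous_on {0..} (cdf C)" and c_pos: "0 < c" and p_nonneg: "0 \<le> p"
begin

abbreviation law :: "real \<Rightarrow> path measure" where
  "law w \<equiv> path_law (residual w) D C"

lemma renewal_laws: "0 \<le> w \<Longrightarrow> renewal_laws (residual w) D C"
  by (intro renewal_laws.intro renewal_laws_axioms.intro real_distribution_residual residual_pos
      D.real_distribution_axioms C.real_distribution_axioms D_pos C_nonneg)

lemma path_prob_law: "0 \<le> w \<Longrightarrow> path_prob (law w) c p"
  by (rule renewal_laws.path_prob[OF renewal_laws c_pos p_nonneg])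

definition v :: "real \<Rightarrow> real \<Rightarrow> real \<Rightarrow> real" where
  "v r x w = canonical_value c p r x (law w)"

lemma v_age:
  assumes "0 \<le> w" "0 \<le> w0" "0 \<le> r" "0 \<le> x"
  shows "\<bar>v r x w - v r x w0\<bar> \<le> (x + p * r) * residual_excess w0 w"
proof -
  note R = renewal_laws[OF assms(1)] and R0 = renewal_laws[OF assms(2)]
  note P = path_prob_law[OF assms(1)] and P0 = path_prob_law[OF assms(2)]
  note tv = residual_total_variation[OF assms(2,1)]
  have "canonical_value c p r x (law w) \<le> canonical_value c p r x (law w0) + (x + p * r) * residual_excess w0 w"
    by (rule value_total_variation[OF P P0 assms(3,4)], rule path_law_total_variation[OF R R0 _ _ _ tv(2)])
  moreover have "canonical_value c p r x (law w0) \<le> canonical_value c p r x (law w) + (x + p * r) * residual_excess w0 w"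
    by (rule value_total_variation[OF P0 P assms(3,4)], rule path_law_total_variation[OF R0 R _ _ _ tv(1)])
  ultimately show ?thesis
    unfolding v_def by linarith
qed

lemma v_horizon:
  assumes "0 \<le> w" "0 \<le> r" "0 \<le> r'" "0 \<le> x"
  shows "\<bar>v r x w - v r' x w\<bar> \<le> p * \<bar>r - r'\<bar>"
  using path_prob.value_horizon[OF path_prob_law[OF assms(1)] assms(2) _ assms(4), of r']
    path_prob.value_horizon[OF path_prob_law[OF assms(1)] assms(3) _ assms(4), of r]
  unfolding v_def by (cases "r \<le> r'") (auto simp: abs_minus_commute)

lemma v_capital:
  assumes "0 \<le> w" "0 \<le> r" "0 \<le> x" "0 \<le> h"
    and "\<And>y. 0 \<le> y \<Longrightarrow> measure C {y<..y + h} \<le> \<omega>" "0 \<le> \<omega>"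
  shows "\<bar>v r (x + h) w - v r x w\<bar>
    \<le> h + (x + h + p * r) * (real n * \<omega> + exp r * renewal_laws.laplace D ^ n)"
proof -
  interpret renewal_laws "residual w" D C by (rule renewal_laws[OF assms(1)])
  interpret path_prob "law w" c p by (rule path_prob_law[OF assms(1)])
  have "v r (x + h) w \<le> v r x w + h + (x + h + p * r) * Q.prob {e. \<exists>k. shallow_ruin p r x h e k}"
    using value_capital[OF assms(2-4)] unfolding v_def by simp
  also have "\<dots> \<le> v r x w + h + (x + h + p * r) * (real n * \<omega> + exp r * laplace ^ n)"
    using prob_shallow_ruin[OF assms(5,6)] assms p_nonneg
    by (intro add_left_mono mult_left_mono) auto
  finally show ?thesis
    using value_mono_capital[OF assms(2,3), of "x + h"] assms(4) unfolding v_def by simp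
qed

text \<open>
  The arguments are moved to their limits one at a time: first the horizon and then the capital, where the
  estimates are uniform in the elapsed time, and finally the elapsed time.
\<close>

lemma v_continuous:
  assumes r: "r \<longlonglongrightarrow> r0" "\<And>n. 0 \<le> r n" "0 \<le> r0" and x: "x \<longlonglongrightarrow> x0" "\<And>n. 0 \<le> x n" "0 \<le> x0"
    and w: "w \<longlonglongrightarrow> w0" "\<And>n. 0 \<le> w n" "0 \<le> w0"
  shows "(\<lambda>n. v (r n) (x n) (w n)) \<longlonglongrightarrow> v r0 x0 w0"
proof -
  interpret W0: renewal_laws "residual w0" D C by (rule renewal_laws[OF w(3)])
  have X: "(\<lambda>n. v r0 (x n) (w n) - v r0 x0 (w n)) \<longlonglongrightarrow> 0"
  proof (rule LIMSEQ_I)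
    fix \<eta> :: real assume \<eta>: "0 < \<eta>"
    define \<beta> where "\<beta> = x0 + 1 + p * r0"
    have \<beta>: "0 < \<beta>"
      using x(3) r(3) p_nonneg unfolding \<beta>_def by (simp add: add_nonneg_pos add_pos_nonneg)
    have "(\<lambda>n. \<beta> * (exp r0 * W0.laplace ^ n)) \<longlonglongrightarrow> 0"
      by (intro tendsto_mult_right_zero W0.laplace_power_tendsto)
    then have "\<forall>\<^sub>F n in sequentially. \<beta> * (exp r0 * W0.laplace ^ n) < \<eta> / 4"
      using \<eta> by (intro order_tendstoD(2)) auto
    then obtain m where m: "\<beta> * (exp r0 * W0.laplace ^ m) < \<eta> / 4"
      unfolding eventually_sequentially by blast
    \<comment> \<open>\<open>m\<close> makes the contribution of paths with many claims small; \<open>\<omega>\<close> leaves an equal share to each of the first \<open>m\<close> claims\<close>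
    define \<omega> where "\<omega> = \<eta> / (4 * \<beta> * (real m + 1))"
    have "\<beta> * (real m * \<omega>) = \<eta> / 4 * (real m / (real m + 1))"
      using \<beta> by (simp add: \<omega>_def)
    also have "\<dots> \<le> \<eta> / 4 * 1"
      using \<eta> by (intro mult_left_mono) auto
    finally have \<omega>: "0 < \<omega>" "\<beta> * (real m * \<omega>) \<le> \<eta> / 4"
      using \<eta> \<beta> by (simp_all add: \<omega>_def)
    obtain h0 where h0: "0 < h0" "\<And>h y. 0 \<le> y \<Longrightarrow> h \<le> h0 \<Longrightarrow> measure C {y<..y + h} \<le> \<omega>"
      using cdf_uniform_modulus[OF C.real_distribution_axioms C_cont \<omega>(1)] by blast
    define \<rho> where "\<rho> = Min {h0, \<eta> / 4, 1}"
    have \<rho>: "0 < \<rho>" "\<rho> \<le> h0" "\<rho> \<le> \<eta> / 4" "\<rho> \<le> 1"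
      using h0 \<eta> by (auto simp: \<rho>_def)
    obtain N where N: "\<And>n. N \<le> n \<Longrightarrow> \<bar>x n - x0\<bar> < \<rho>"
      using LIMSEQ_D[OF x(1) \<rho>(1)] by auto
    show "\<exists>N. \<forall>n\<ge>N. norm (v r0 (x n) (w n) - v r0 x0 (w n) - 0) < \<eta>"
    proof (intro exI allI impI)
      fix n assume "N \<le> n"
      \<comment> \<open>the capital estimate is applied from the smaller of the two capitals\<close>
      define lo h where "lo = min (x n) x0" and "h = \<bar>x n - x0\<bar>"
      have h: "0 \<le> h" "h < \<rho>" and lo: "0 \<le> lo" "lo + h = max (x n) x0"
        using N[OF \<open>N \<le> n\<close>] x by (auto simp: h_def lo_def)
      have "\<bar>v r0 (x n) (w n) - v r0 x0 (w n)\<bar> = \<bar>v r0 (lo + h) (w n) - v r0 lo (w n)\<bar>"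
        by (cases "x n \<le> x0") (auto simp: lo_def h_def abs_minus_commute)
      also have "\<dots> \<le> h + (lo + h + p * r0) * (real m * \<omega> + exp r0 * W0.laplace ^ m)"
        using h lo r w \<omega> \<rho> h0 by (intro v_capital) auto
      also have "\<dots> \<le> \<rho> + \<beta> * (real m * \<omega> + exp r0 * W0.laplace ^ m)"
      proof (intro add_mono mult_right_mono)
        have "max (x n) x0 \<le> x0 + 1"
          using h(2) \<rho>(4) by (auto simp: h_def)
        then show "lo + h + p * r0 \<le> \<beta>"
          by (simp add: lo(2) \<beta>_def)
        show "0 \<le> real m * \<omega> + exp r0 * W0.laplace ^ m"
          using \<omega> W0.laplace_bounds by simp
      qed (use h in auto)
      also have "\<dots> < \<eta>"
        using \<omega>(2) m \<rho>(3) \<eta> by (simp add: distrib_left)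
      finally show "norm (v r0 (x n) (w n) - v r0 x0 (w n) - 0) < \<eta>"
        by simp
    qed
  qed
  have "(\<lambda>n. p * \<bar>r n - r0\<bar> + \<bar>v r0 (x n) (w n) - v r0 x0 (w n)\<bar> + (x0 + p * r0) * residual_excess w0 (w n))
      \<longlonglongrightarrow> p * \<bar>r0 - r0\<bar> + \<bar>0\<bar> + (x0 + p * r0) * 0"
    by (intro tendsto_intros r X residual_excess_tendsto w)
  then have lim: "(\<lambda>n. p * \<bar>r n - r0\<bar> + \<bar>v r0 (x n) (w n) - v r0 x0 (w n)\<bar> + (x0 + p * r0) * residual_excess w0 (w n))
      \<longlonglongrightarrow> 0"
    by simp
  have "norm (v (r n) (x n) (w n) - v r0 x0 w0)
      \<le> p * \<bar>r n - r0\<bar> + \<bar>v r0 (x n) (w n) - v r0 x0 (w n)\<bar> + (x0 + p * r0) * residual_excess w0 (w n)" (is "_ \<le> ?g n") for n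
    using v_horizon[OF w(2) r(2,3) x(2), of n n n] v_age[OF w(2,3) r(3) x(3), of n] by simp
  then have "\<forall>\<^sub>F n in sequentially. norm (v (r n) (x n) (w n) - v r0 x0 w0) \<le> ?g n"
    by (simp add: always_eventually)
  from Lim_null_comparison[OF this lim] show ?thesis
    by (rule LIM_zero_cancel)
qed

end

section \<open>Discounted dividends as a mean at an exponential time\<close>

lemma exp_time_tail:
  assumes "0 < c" "0 \<le> a"
  shows "emeasure (exp_time c) {a<..} = ennreal (exp (- c * a))"
proof -
  interpret prob_space "exp_time c" by (rule prob_space_exp_time[OF assms(1)])
  have "distr (exp_time c) lborel (\<lambda>x. x) = density lborel (exponential_density c)"
    by (subst distr_cong[of _ "exp_time c" _ "exp_time c" _ "\<lambda>x. x"])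
       (simp_all add: exp_time_def distr_id2)
  then have "distributed (exp_time c) lborel (\<lambda>x. x) (exponential_density c)"
    by (auto simp: distributed_def intro!: measurable_ident_sets)
  from exponential_distributedD_gt[OF this assms(2,1)] show ?thesis
    by (simp add: emeasure_eq_measure greaterThan_def mult.commute)
qed

lemma AE_exp_time_pos: "0 < c \<Longrightarrow> AE \<zeta> in exp_time c. 0 < \<zeta>"
proof -
  assume c: "0 < c"
  interpret prob_space "exp_time c" by (rule prob_space_exp_time[OF c])
  have "prob {0<..} = 1"
    using exp_time_tail[OF c, of 0] by (simp add: emeasure_eq_measure)
  then show ?thesis
    using AE_in_set_eq_1[of "{0<..}"] by simp
qed

text \<open>
  \<open>g\<close> is one path of a strategy and \<open>b\<close> the earlier of ruin and terminal time.
\<close>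

locale dividend_path =
  fixes s b :: real and g :: "real \<Rightarrow> real"
  assumes s_le: "s \<le> b" and start: "g s = 0" and mono: "mono_on {s..} g" and caglad: "caglad_from s g"
    and stops: "\<And>t. b < t \<Longrightarrow> g t = right_lim g b"
begin

lemma right_lim: "s \<le> t \<Longrightarrow> (g \<longlongrightarrow> right_lim g t) (at_right t)"
proof -
  assume "s \<le> t"
  then obtain l where "(g \<longlongrightarrow> l) (at_right t)"
    using caglad unfolding caglad_from_def by blast
  then show ?thesis
    unfolding right_lim_def by (metis tendsto_Lim trivial_limit_at_right_real)
qed

lemma le_right_lim: "s \<le> t \<Longrightarrow> g t \<le> right_lim g t"
proof -
  assume t: "s \<le> t"
  have "\<forall>\<^sub>F u in at_right t. g t \<le> g u"
    unfolding eventually_at_right_field using t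
    by (intro exI[of _ "t + 1"]) (auto intro!: mono_onD[OF mono])
  then show ?thesis
    using tendsto_lowerbound[OF right_lim[OF t]] by simp
qed

lemma right_lim_le: "s \<le> t \<Longrightarrow> t < u \<Longrightarrow> right_lim g t \<le> g u"
proof -
  assume t: "s \<le> t" "t < u"
  have "\<forall>\<^sub>F v in at_right t. g v \<le> g u"
    unfolding eventually_at_right_field using t
    by (intro exI[of _ u]) (auto intro!: mono_onD[OF mono])
  then show ?thesis
    using tendsto_upperbound[OF right_lim[OF t(1)]] by simp
qed

lemma nonneg: "s \<le> t \<Longrightarrow> 0 \<le> g t"
  using mono_onD[OF mono, of s t] start by simp

definition cumul :: "real \<Rightarrow> real" where
  "cumul t = (if t < s then 0 else right_lim g t)"

lemma cumul_mono: "t \<le> u \<Longrightarrow> cumul t \<le> cumul u"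
proof -
  assume tu: "t \<le> u"
  consider "t < s" "u < s" | "t < s" "s \<le> u" | "s \<le> t" "t = u" | "s \<le> t" "t < u"
    using tu by linarith
  then show ?thesis
  proof cases
    case 2
    then show ?thesis
      using le_right_lim[of u] nonneg[of u] by (simp add: cumul_def)
  next
    case 4
    then show ?thesis
      using right_lim_le[of t u] le_right_lim[of u] by (simp add: cumul_def)
  qed (auto simp: cumul_def)
qed

lemma cumul_right_cont: "continuous (at_right t) cumul"
  unfolding continuous_within
proof (cases "t < s")
  case True
  have "\<forall>\<^sub>F u in at_right t. cumul t = cumul u"
    unfolding eventually_at_right_field using True by (intro exI[of _ s]) (auto simp: cumul_def)
  then show "(cumul \<longlongrightarrow> cumul t) (at_right t)"
    by (rule Lim_transform_eventually[OF tendsto_const])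
next
  case False
  then have t: "s \<le> t" by simp
  show "(cumul \<longlongrightarrow> cumul t) (at_right t)"
  proof (rule decreasing_tendsto)
    show "\<forall>\<^sub>F u in at_right t. cumul t \<le> cumul u"
      unfolding eventually_at_right_field by (intro exI[of _ "t + 1"]) (auto intro: cumul_mono)
    fix z assume "cumul t < z"
    then have "\<forall>\<^sub>F v in at_right t. g v < z"
      using right_lim[OF t] t by (intro order_tendstoD(2)) (auto simp: cumul_def)
    then obtain v where v: "t < v" "\<And>u. t < u \<Longrightarrow> u < v \<Longrightarrow> g u < z"
      unfolding eventually_at_right_field by blast
    have "cumul u < z" if u: "t < u" "u < v" for u
    proof -
      obtain u' where "u < u'" "u' < v" using dense[OF u(2)] by blast
      then show ?thesis
        using right_lim_le[of u u'] v(2)[of u'] u t by (simp add: cumul_def)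
    qed
    then show "\<forall>\<^sub>F u in at_right t. cumul u < z"
      unfolding eventually_at_right_field using v(1) by blast
  qed
qed

abbreviation "\<mu> \<equiv> dividend_measure s g"

lemma dividend_measure_eq: "\<mu> = interval_measure cumul"
  unfolding dividend_measure_def cumul_def ..

lemma sets_dividend [simp, measurable_cong]: "sets \<mu> = sets borel"
  by (simp add: dividend_measure_eq)

lemma emeasure_dividend_Ioc: "t \<le> u \<Longrightarrow> emeasure \<mu> {t<..u} = ennreal (cumul u - cumul t)"
  unfolding dividend_measure_eq
  by (rule emeasure_interval_measure_Ioc[OF _ cumul_mono cumul_right_cont])

lemma sigma_finite_dividend: "sigma_finite_measure \<mu>"
  unfolding dividend_measure_eq by (rule sigma_finite_interval_measure[OF cumul_mono cumul_right_cont])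

lemma null_before_start: "{s - 1<..<s} \<in> null_sets \<mu>"
proof -
  have "(\<Union>n. {s - 1<..s - 1 / real (Suc n)}) = {s - 1<..<s}"
  proof (intro equalityI subsetI)
    fix t assume t: "t \<in> {s - 1<..<s}"
    then obtain n where "1 / real (Suc n) < s - t"
      using nat_approx_posE[of "s - t"] by auto
    with t show "t \<in> (\<Union>n. {s - 1<..s - 1 / real (Suc n)})"
      by (intro UN_I[of n]) auto
  next
    fix t assume "t \<in> (\<Union>n. {s - 1<..s - 1 / real (Suc n)})"
    then obtain n where "s - 1 < t" "t \<le> s - 1 / real (Suc n)" by auto
    moreover have "0 < 1 / real (Suc n)" by simp
    ultimately have "t < s"
      by linarith
    with \<open>s - 1 < t\<close> show "t \<in> {s - 1<..<s}"
      by simp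
  qed
  moreover have "{s - 1<..s - 1 / real (Suc n)} \<in> null_sets \<mu>" for n
    using emeasure_dividend_Ioc[of "s - 1" "s - 1 / real (Suc n)"] by (auto simp: null_sets_def cumul_def)
  ultimately show ?thesis
    using null_sets_UN[of "\<lambda>n. {s - 1<..s - 1 / real (Suc n)}" \<mu>] by simp
qed

lemma emeasure_dividend_from_start:
  assumes "A \<in> sets borel" "A \<subseteq> {s..}"
  shows "emeasure \<mu> ({s - 1<..<s} \<union> A) = emeasure \<mu> A"
  using assms null_before_start by (subst emeasure_Un_null_set[symmetric, of A]) (auto simp: Un_commute)

lemma emeasure_dividend_upto: "s \<le> u \<Longrightarrow> emeasure \<mu> {s..u} = ennreal (right_lim g u)"
proof -
  assume u: "s \<le> u"
  have "{s - 1<..<s} \<union> {s..u} = {s - 1<..u}"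
    using u by auto
  then show ?thesis
    using emeasure_dividend_from_start[of "{s..u}"] emeasure_dividend_Ioc[of "s - 1" u] u
    by (simp add: cumul_def)
qed

text \<open>
  The lump sum at \<open>u\<close> itself is excluded, so right limits disappear: on an increasing sequence of times, values
  and right limits of \<open>g\<close> have the common limit \<open>g u\<close>.
\<close>

lemma emeasure_dividend_before: "s < u \<Longrightarrow> emeasure \<mu> {s..<u} = ennreal (g u)"
proof -
  assume u: "s < u"
  \<comment> \<open>starts at \<open>s\<close> and increases to \<open>u\<close> without reaching it\<close>
  define a where "a n = u - (u - s) / real (Suc n)" for n
  have a: "s \<le> a n" "a n < u" for n
  proof -
    have "(u - s) / real (Suc n) \<le> (u - s) / 1"
      using u by (intro divide_left_mono) auto
    then show "s \<le> a n" by (simp add: a_def)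
    show "a n < u" using u by (simp add: a_def)
  qed
  have a_lim: "a \<longlonglongrightarrow> u"
  proof -
    have "(\<lambda>n. u - (u - s) * inverse (real (Suc n))) \<longlonglongrightarrow> u - (u - s) * 0"
      by (intro tendsto_intros LIMSEQ_inverse_real_of_nat)
    then show ?thesis by (simp add: a_def[abs_def] divide_inverse)
  qed
  have a_mono: "incseq a"
    unfolding incseq_Suc_iff a_def using u by (auto intro!: divide_left_mono)
  have "incseq (\<lambda>n. {s..a n})"
    using a_mono by (auto simp: incseq_def intro: order_trans)
  then have "(\<lambda>n. emeasure \<mu> {s..a n}) \<longlonglongrightarrow> emeasure \<mu> (\<Union>n. {s..a n})"
    by (intro Lim_emeasure_incseq) auto
  moreover have "(\<Union>n. {s..a n}) = {s..<u}"
  proof (intro equalityI subsetI)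
    fix t assume t: "t \<in> {s..<u}"
    then have "\<forall>\<^sub>F n in sequentially. t < a n"
      using a_lim by (intro order_tendstoD(1)) auto
    then obtain n where "t < a n" unfolding eventually_sequentially by blast
    then show "t \<in> (\<Union>n. {s..a n})" using t by (intro UN_I[of n]) auto
  qed (use a in \<open>force intro: le_less_trans\<close>)
  moreover have "(\<lambda>n. emeasure \<mu> {s..a n}) \<longlonglongrightarrow> ennreal (g u)"
  proof -
    have left: "(\<lambda>n. g (a n)) \<longlonglongrightarrow> g u"
    proof (rule filterlim_compose[of g _ "at_left u"])
      show "(g \<longlongrightarrow> g u) (at_left u)"
        using caglad u unfolding caglad_from_def by blast
      show "filterlim a (at_left u) sequentially"
        unfolding filterlim_at using a_lim a(2) by (auto intro!: always_eventually simp: less_imp_neq)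
    qed
    have "(\<lambda>n. right_lim g (a n)) \<longlonglongrightarrow> g u"
      by (rule tendsto_sandwich[OF _ _ left tendsto_const])
         (use le_right_lim[OF a(1)] right_lim_le[OF a] in \<open>auto intro!: always_eventually\<close>)
    then show ?thesis
      using emeasure_dividend_upto[OF a(1)] by (simp add: tendsto_ennrealI)
  qed
  ultimately show ?thesis
    using LIMSEQ_unique by metis
qed

lemma measurable_after_start: "(\<lambda>\<zeta>. g (s + max 0 \<zeta>)) \<in> borel_measurable borel"
  by (rule borel_measurable_mono) (auto simp: mono_def intro!: mono_onD[OF mono])

text \<open>
  The discount factor \<open>exp (- c * (t - s))\<close> is the probability that an exponential time exceeds \<open>t - s\<close>.  By Fubini
  the integral is the mean of the dividends paid before \<open>s + \<zeta>\<close>, which is \<open>g (s + \<zeta>)\<close> by left continuity.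
\<close>

lemma discounted_dividends:
  assumes c: "0 < c"
  shows "(LINT t : {s..b} | \<mu>. exp (- c * (t - s))) = (\<integral>\<zeta>. g (s + max 0 \<zeta>) \<partial>exp_time c)"
proof -
  interpret E: prob_space "exp_time c" by (rule prob_space_exp_time[OF c])
  interpret M: sigma_finite_measure \<mu> by (rule sigma_finite_dividend)
  interpret P: pair_sigma_finite \<mu> "exp_time c" ..
  have set: "(\<lambda>z. indicator {s..b} (fst z) * indicator {z. fst z - s < snd z} z :: ennreal)
      \<in> borel_measurable (\<mu> \<Otimes>\<^sub>M exp_time c)"
  proof -
    have "{z. fst z - s < snd z} \<in> sets (borel \<Otimes>\<^sub>M borel)"
      using borel_measurable_less[of "\<lambda>z. fst z - s" "borel \<Otimes>\<^sub>M borel" snd] by (simp add: space_pair_measure)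
    then have "{z. fst z - s < snd z} \<in> sets (\<mu> \<Otimes>\<^sub>M exp_time c)"
      by (simp cong: sets_pair_measure_cong)
    then show ?thesis
      by measurable
  qed
  have "(\<integral>\<^sup>+ t. ennreal (indicator {s..b} t * exp (- c * (t - s))) \<partial>\<mu>)
    = (\<integral>\<^sup>+ t. (\<integral>\<^sup>+ \<zeta>. indicator {s..b} t * indicator {z. fst z - s < snd z} (t, \<zeta>) \<partial>exp_time c) \<partial>\<mu>)"
  proof (rule nn_integral_cong)
    fix t
    have "(\<integral>\<^sup>+ \<zeta>. indicator {s..b} t * indicator {z. fst z - s < snd z} (t, \<zeta>) \<partial>exp_time c)
      = indicator {s..b} t * (\<integral>\<^sup>+ \<zeta>. indicator {t - s<..} \<zeta> \<partial>exp_time c)"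
      by (subst nn_integral_cmult[symmetric]) (auto intro!: nn_integral_cong borel_measurable_indicator simp: indicator_def)
    also have "\<dots> = ennreal (indicator {s..b} t * exp (- c * (t - s)))"
      using exp_time_tail[OF c, of "t - s"] by (cases "t \<in> {s..b}") auto
    finally show "ennreal (indicator {s..b} t * exp (- c * (t - s)))
      = (\<integral>\<^sup>+ \<zeta>. indicator {s..b} t * indicator {z. fst z - s < snd z} (t, \<zeta>) \<partial>exp_time c)" ..
  qed
  also have "\<dots> = (\<integral>\<^sup>+ \<zeta>. (\<integral>\<^sup>+ t. indicator {s..b} t * indicator {z. fst z - s < snd z} (t, \<zeta>) \<partial>\<mu>) \<partial>exp_time c)"
    using P.Fubini[OF set] by simp
  also have "\<dots> = (\<integral>\<^sup>+ \<zeta>. ennreal (g (s + max 0 \<zeta>)) \<partial>exp_time c)"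
  proof (rule nn_integral_cong_AE)
    show "AE \<zeta> in exp_time c. (\<integral>\<^sup>+ t. indicator {s..b} t * indicator {z. fst z - s < snd z} (t, \<zeta>) \<partial>\<mu>)
        = ennreal (g (s + max 0 \<zeta>))"
      using AE_exp_time_pos[OF c]
    proof eventually_elim
      case (elim \<zeta>)
      have "(\<integral>\<^sup>+ t. indicator {s..b} t * indicator {z. fst z - s < snd z} (t, \<zeta>) \<partial>\<mu>)
        = (\<integral>\<^sup>+ t. indicator ({s..b} \<inter> {..<s + \<zeta>}) t \<partial>\<mu>)"
        by (intro nn_integral_cong) (auto simp: indicator_def)
      also have "\<dots> = emeasure \<mu> ({s..b} \<inter> {..<s + \<zeta>})"
        by simp
      also have "\<dots> = ennreal (g (s + \<zeta>))"
      proof (cases "s + \<zeta> \<le> b")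
        case True
        then have "{s..b} \<inter> {..<s + \<zeta>} = {s..<s + \<zeta>}" by auto
        then show ?thesis
          using emeasure_dividend_before[of "s + \<zeta>"] elim by simp
      next
        case False
        then have "{s..b} \<inter> {..<s + \<zeta>} = {s..b}" by auto
        then show ?thesis
          using emeasure_dividend_upto[OF s_le] stops[of "s + \<zeta>"] False by simp
      qed
      finally show ?case using elim by simp
    qed
  qed
  finally have eq: "(\<integral>\<^sup>+ t. ennreal (indicator {s..b} t * exp (- c * (t - s))) \<partial>\<mu>)
    = (\<integral>\<^sup>+ \<zeta>. ennreal (g (s + max 0 \<zeta>)) \<partial>exp_time c)" .
  have "(\<lambda>t. indicator {s..b} t * exp (- c * (t - s))) \<in> borel_measurable borel"
    by measurable
  then have "(\<lambda>t. indicator {s..b} t * exp (- c * (t - s))) \<in> borel_measurable \<mu>"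
    by (simp cong: measurable_cong_sets)
  then have "(LINT t : {s..b} | \<mu>. exp (- c * (t - s)))
    = enn2real (\<integral>\<^sup>+ t. ennreal (indicator {s..b} t * exp (- c * (t - s))) \<partial>\<mu>)"
    unfolding set_lebesgue_integral_def by (subst integral_eq_nn_integral) auto
  also have "\<dots> = (\<integral>\<zeta>. g (s + max 0 \<zeta>) \<partial>exp_time c)"
    unfolding eq using measurable_after_start
    by (subst integral_eq_nn_integral) (auto intro!: AE_I2 nonneg simp: measurable_def)
  finally show ?thesis .
qed

end

section \<open>Claims after the initial time\<close>

definition future :: "(nat \<Rightarrow> 'a \<Rightarrow> real) \<Rightarrow> (nat \<Rightarrow> 'a \<Rightarrow> real) \<Rightarrow> real \<Rightarrow> 'a \<Rightarrow> path" where
  "future \<xi> U s \<omega> = case_sum (\<lambda>k. waiting_after \<xi> s (Suc k) \<omega>) (\<lambda>k. claim_after \<xi> U s (Suc k) \<omega>)"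

context
  fixes \<xi> U :: "nat \<Rightarrow> 'a \<Rightarrow> real" and s :: real and \<omega> :: 'a
  assumes reg: "regular_path (future \<xi> U s \<omega>)"
begin

lemma jump_time_future:
  "jump_time \<xi> (claim_count \<xi> s \<omega> + Suc k) \<omega> = s + arrival (future \<xi> U s \<omega>) k"
proof (induction k)
  case 0
  then show ?case
    by (simp add: arrival_0 future_def waiting_after_def)
next
  case (Suc k)
  have "jump_time \<xi> (claim_count \<xi> s \<omega> + Suc (Suc k)) \<omega>
    = jump_time \<xi> (claim_count \<xi> s \<omega> + Suc k) \<omega> + \<xi> (claim_count \<xi> s \<omega> + Suc (Suc k)) \<omega>"
    by (simp add: jump_time_def)
  then show ?case
    using Suc by (simp add: arrival_Suc future_def waiting_after_def)
qed

text \<open>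
  For an exceptional elapsed time \<open>w\<close>, waiting times before \<open>s\<close> need not be positive under the conditional law, which
  is prescribed for every \<open>w\<close> only through what happens after \<open>s\<close>.  But the jump times with index above \<open>claim_count \<xi> s \<omega>\<close> exceed \<open>s\<close>, and then the
  definition of \<^const>\<open>claim_count\<close> as a cardinality leaves no choice for the others.
\<close>

lemma claims_before:
  "{n. 1 \<le> n \<and> jump_time \<xi> n \<omega> \<le> s} = {1..claim_count \<xi> s \<omega>}"
proof (rule card_subset_eq)
  have "n \<le> claim_count \<xi> s \<omega>" if "jump_time \<xi> n \<omega> \<le> s" for n
  proof (rule ccontr)
    assume "\<not> n \<le> claim_count \<xi> s \<omega>"
    then obtain k where "n = claim_count \<xi> s \<omega> + Suc k"
      using less_iff_Suc_add[of "claim_count \<xi> s \<omega>" n] by auto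
    then show False
      using that jump_time_future[of k] arrival_pos[OF reg, of k] by simp
  qed
  then show "{n. 1 \<le> n \<and> jump_time \<xi> n \<omega> \<le> s} \<subseteq> {1..claim_count \<xi> s \<omega>}"
    by auto
qed (simp_all add: claim_count_def)

lemma claim_count_future:
  assumes "s \<le> t"
  shows "claim_count \<xi> t \<omega> = claim_count \<xi> s \<omega> + arrivals (future \<xi> U s \<omega>) (t - s)"
proof -
  let ?N = "claim_count \<xi> s \<omega>" and ?n = "arrivals (future \<xi> U s \<omega>) (t - s)"
  have "1 \<le> n \<and> jump_time \<xi> n \<omega> \<le> t \<longleftrightarrow> 1 \<le> n \<and> n \<le> ?N + ?n" for n
  proof (cases "n \<le> ?N")
    case True
    then have "1 \<le> n \<Longrightarrow> n \<in> {n. 1 \<le> n \<and> jump_time \<xi> n \<omega> \<le> s}"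
      unfolding claims_before by simp
    then show ?thesis
      using True assms by auto
  next
    case False
    then obtain k where k: "n = ?N + Suc k"
      using less_iff_Suc_add[of ?N n] by auto
    then have "jump_time \<xi> n \<omega> \<le> t \<longleftrightarrow> k < ?n"
      using less_arrivals_iff[OF reg, of k "t - s"] jump_time_future[of k] by auto
    then show ?thesis
      using k by auto
  qed
  then have "{n. 1 \<le> n \<and> jump_time \<xi> n \<omega> \<le> t} = {1..?N + ?n}"
    by (simp only: atLeastAtMost_def atLeast_def atMost_def Collect_conj_eq)
  then show ?thesis
    unfolding claim_count_def[of \<xi> t] by simp
qed

lemma total_claims_future:
  assumes "s \<le> t"
  shows "total_claims \<xi> U t \<omega> = total_claims \<xi> U s \<omega> + aggregate (future \<xi> U s \<omega>) (t - s)"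
proof -
  let ?N = "claim_count \<xi> s \<omega>"
  have "(\<Sum>i=1..?N + m. U i \<omega>) = (\<Sum>i=1..?N. U i \<omega>) + (\<Sum>k<m. future \<xi> U s \<omega> (Inr k))" for m
    by (induction m) (simp_all add: future_def claim_after_def)
  then show ?thesis
    using claim_count_future[OF assms] by (simp add: total_claims_def aggregate_eq[OF reg])
qed

lemma claims_after_future:
  assumes "s \<le> t"
  shows "claims_after \<xi> U s t \<omega> = aggregate (future \<xi> U s \<omega>) (t - s)"
proof -
  have "(\<Sum>i=1..m. claim_after \<xi> U s i \<omega>) = (\<Sum>k<m. future \<xi> U s \<omega> (Inr k))" for m
    by (induction m) (simp_all add: future_def)
  then show ?thesis
    using claim_count_future[OF assms]
    by (simp add: claims_after_def count_after_def aggregate_eq[OF reg])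
qed

lemma elapsed_time_future:
  assumes "s \<le> t"
  shows "elapsed_time \<xi> t \<omega> =
    (if arrivals (future \<xi> U s \<omega>) (t - s) = 0 then elapsed_time \<xi> s \<omega> + (t - s)
     else t - s - arrival (future \<xi> U s \<omega>) (arrivals (future \<xi> U s \<omega>) (t - s) - 1))"
proof (cases "arrivals (future \<xi> U s \<omega>) (t - s)")
  case 0
  then show ?thesis
    using claim_count_future[OF assms] by (simp add: elapsed_time_def)
next
  case (Suc k)
  then show ?thesis
    using claim_count_future[OF assms] jump_time_future[of k] by (simp add: elapsed_time_def)
qed

end

section \<open>Rules are admissible strategies\<close>

lemma subset_null_completion:
  assumes "N \<in> null_sets P" "A \<subseteq> N"
  shows "A \<in> null_sets (completion P)"
  using assms by (metis null_sets_completion_subset null_sets_completionI)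

text \<open>
  Used for the augmented filtration and for the completed measure, which both contain all subsets of null sets.
\<close>

lemma measurable_modify_null:
  assumes g: "g \<in> measurable \<F> N" and sp: "space \<F> = space P"
    and null: "null_sets (completion P) \<subseteq> sets \<F>"
    and h: "\<And>\<omega>. \<omega> \<in> space P \<Longrightarrow> h \<omega> \<in> space N" and ae: "AE \<omega> in P. h \<omega> = g \<omega>"
  shows "h \<in> measurable \<F> N"
proof (rule measurableI)
  show "h \<omega> \<in> space N" if "\<omega> \<in> space \<F>" for \<omega>
    using h that sp by simp
next
  fix B assume B: "B \<in> sets N"
  obtain Z where Z: "Z \<in> null_sets P" "\<And>\<omega>. \<omega> \<in> space P - Z \<Longrightarrow> h \<omega> = g \<omega>"
    using AE_E3[OF ae] by blast
  have "h -` B \<inter> space \<F> = (g -` B \<inter> space \<F> - Z) \<union> (h -` B \<inter> space \<F> \<inter> Z)"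
    using Z(2) sp by auto
  moreover have "Z \<in> sets \<F>" "h -` B \<inter> space \<F> \<inter> Z \<in> sets \<F>"
    by (rule subsetD[OF null], rule subset_null_completion[OF Z(1)], simp)+
  ultimately show "h -` B \<inter> space \<F> \<in> sets \<F>"
    using measurable_sets[OF g B] by (metis sets.Diff sets.Un)
qed

lemma observation_events_Pow: "observation_events \<Omega> \<xi> U t \<subseteq> Pow \<Omega>"
  by (auto simp: observation_events_def)

lemma filtration_generators:
  "observation_events (space P) \<xi> U t \<union> null_sets (completion P) \<subseteq> Pow (space P)"
  using observation_events_Pow[of "space P" \<xi> U t] sets.sets_into_space[of _ "completion P"]
  by (auto simp: null_sets_def)

lemma space_filtration [simp]: "space (augmented_filtration P \<xi> U t) = space P"
  unfolding augmented_filtration_def by (rule space_measure_of[OF filtration_generators])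

lemma sets_filtration:
  "sets (augmented_filtration P \<xi> U t) =
     sigma_sets (space P) (observation_events (space P) \<xi> U t \<union> null_sets (completion P))"
  unfolding augmented_filtration_def by (rule sets_measure_of[OF filtration_generators])

lemma null_sets_filtration: "null_sets (completion P) \<subseteq> sets (augmented_filtration P \<xi> U t)"
  unfolding sets_filtration by (auto intro: sigma_sets.Basic)

definition state :: "(nat \<Rightarrow> 'a \<Rightarrow> real) \<Rightarrow> (nat \<Rightarrow> 'a \<Rightarrow> real) \<Rightarrow> real \<Rightarrow> 'a \<Rightarrow> observation" where
  "state \<xi> U u \<omega> = (real (claim_count \<xi> u \<omega>), total_claims \<xi> U u \<omega>, elapsed_time \<xi> u \<omega>)"

lemma measurable_state_filtration:
  assumes "0 \<le> u" "u \<le> t"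
  shows "state \<xi> U u \<in> borel_measurable (augmented_filtration P \<xi> U t)"
proof (rule measurableI)
  fix B :: "(observation) set" assume "B \<in> sets borel"
  then have "state \<xi> U u -` B \<inter> space P \<in> observation_events (space P) \<xi> U t"
    using assms unfolding observation_events_def state_def[abs_def] by blast
  then show "state \<xi> U u -` B \<inter> space (augmented_filtration P \<xi> U t) \<in> sets (augmented_filtration P \<xi> U t)"
    unfolding sets_filtration by (auto intro: sigma_sets.Basic)
qed simp

text \<open>
  Recovers an observation of the path after \<open>s\<close> from the states at \<open>s\<close> and \<open>s + u\<close>.
\<close>

definition observe_states :: "real \<Rightarrow> observation \<Rightarrow> observation \<Rightarrow> observation" where
  "observe_states u z z' = (fst z' - fst z, fst (snd z') - fst (snd z), if fst z' = fst z then 0 else u - snd (snd z'))"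

lemma measurable_observe_states:
  "(\<lambda>(z, z'). observe_states u z z') \<in> borel_measurable (borel \<Otimes>\<^sub>M borel)"
  unfolding observe_states_def borel_prod[symmetric] by measurable

lemma observe_future:
  assumes "regular_path (future \<xi> U s \<omega>)" "0 \<le> u"
  shows "observe (future \<xi> U s \<omega>) u = observe_states u (state \<xi> U s \<omega>) (state \<xi> U (s + u) \<omega>)"
  using claim_count_future[OF assms(1), of "s + u"] total_claims_future[OF assms(1), of "s + u"]
    elapsed_time_future[OF assms(1), of "s + u"] assms(2)
  by (simp add: observe_def observe_states_def state_def)

text \<open>
  The states determine the observation on regular paths only; augmentation takes care of the others.
\<close>

lemma measurable_observe_filtration:
  assumes reg: "AE \<omega> in P. regular_path (future \<xi> U s \<omega>)" and "0 \<le> s" "0 \<le> u" "s + u \<le> t"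
  shows "(\<lambda>\<omega>. observe (future \<xi> U s \<omega>) u) \<in> borel_measurable (augmented_filtration P \<xi> U t)"
proof (rule measurable_modify_null[OF _ space_filtration null_sets_filtration])
  have "(\<lambda>\<omega>. (state \<xi> U s \<omega>, state \<xi> U (s + u) \<omega>))
      \<in> measurable (augmented_filtration P \<xi> U t) (borel \<Otimes>\<^sub>M borel)"
    using assms by (intro measurable_Pair measurable_state_filtration) auto
  from measurable_compose[OF this measurable_observe_states]
  show "(\<lambda>\<omega>. observe_states u (state \<xi> U s \<omega>) (state \<xi> U (s + u) \<omega>))
      \<in> borel_measurable (augmented_filtration P \<xi> U t)"
    by simp
  show "AE \<omega> in P. observe (future \<xi> U s \<omega>) u = observe_states u (state \<xi> U s \<omega>) (state \<xi> U (s + u) \<omega>)"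
    using reg by eventually_elim (rule observe_future[OF _ assms(3)])
qed simp

lemma measurable_budget_filtration:
  assumes "AE \<omega> in P. regular_path (future \<xi> U s \<omega>)" "0 \<le> s" "0 \<le> r" "0 \<le> u" "s + min u r \<le> t"
  shows "(\<lambda>\<omega>. budget p r x (future \<xi> U s \<omega>) u) \<in> borel_measurable (augmented_filtration P \<xi> U t)"
proof -
  have "(\<lambda>\<omega>. observe (future \<xi> U s \<omega>) (min u r)) \<in> measurable (augmented_filtration P \<xi> U t) (borel \<Otimes>\<^sub>M borel \<Otimes>\<^sub>M borel)"
    using measurable_observe_filtration[OF assms(1,2), of "min u r" t] assms by (simp add: borel_prod)
  then have "(\<lambda>\<omega>. fst (snd (observe (future \<xi> U s \<omega>) (min u r)))) \<in> borel_measurable (augmented_filtration P \<xi> U t)"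
    by simp
  then have "(\<lambda>\<omega>. aggregate (future \<xi> U s \<omega>) (min u r)) \<in> borel_measurable (augmented_filtration P \<xi> U t)"
    by (simp add: observe_def)
  then show ?thesis
    unfolding budget_def by measurable
qed

lemma measurable_history_filtration:
  assumes "AE \<omega> in P. regular_path (future \<xi> U s \<omega>)" "0 \<le> s" "s + q \<le> t"
  shows "(\<lambda>\<omega>. history q (future \<xi> U s \<omega>)) \<in> measurable (augmented_filtration P \<xi> U t) (history_space q)"
  unfolding history_def
  using assms by (intro measurable_restrict measurable_observe_filtration) auto

lemma measurable_plan_filtration:
  assumes "AE \<omega> in P. regular_path (future \<xi> U s \<omega>)" "0 \<le> s" "0 \<le> r" "s + q \<le> t" "b \<in> rules"
  shows "(\<lambda>\<omega>. plan p r x b (future \<xi> U s \<omega>) q) \<in> borel_measurable (augmented_filtration P \<xi> U t)"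
proof (cases "q < r")
  case True
  have "b q \<in> borel_measurable (history_space q)"
    using assms(5) by (simp add: rules_def)
  from measurable_compose[OF measurable_history_filtration[OF assms(1,2,4)] this] show ?thesis
    using True by (simp add: plan_def)
next
  case False
  then show ?thesis
    using measurable_budget_filtration[OF assms(1-3), of r t p x] assms by (simp add: plan_def)
qed

lemma measurable_solvent_filtration:
  assumes reg: "AE \<omega> in P. regular_path (future \<xi> U s \<omega>)" and "0 \<le> s" "0 \<le> r" "s + q \<le> t" "b \<in> rules"
  shows "Measurable.pred (augmented_filtration P \<xi> U t)
    (\<lambda>\<omega>. solvent (budget p r x (future \<xi> U s \<omega>)) (plan p r x b (future \<xi> U s \<omega>)) q)"
proof -
  let ?F = "augmented_filtration P \<xi> U t"
  let ?B = "\<lambda>\<omega>. budget p r x (future \<xi> U s \<omega>)" and ?a = "\<lambda>\<omega>. plan p r x b (future \<xi> U s \<omega>)"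
  have eq: "solvent (?B \<omega>) (?a \<omega>) q \<longleftrightarrow> (\<forall>i j. 0 < real_of_rat i \<and> real_of_rat i \<le> real_of_rat j \<and>
      real_of_rat j \<le> q \<longrightarrow> max 0 (?a \<omega> (real_of_rat i)) \<le> ?B \<omega> (real_of_rat j))" for \<omega>
    unfolding solvent_def Rats_def by blast
  have "Measurable.pred ?F (\<lambda>\<omega>. 0 < real_of_rat i \<and> real_of_rat i \<le> real_of_rat j \<and>
      real_of_rat j \<le> q \<longrightarrow> max 0 (?a \<omega> (real_of_rat i)) \<le> ?B \<omega> (real_of_rat j))" for i j
  proof (cases "0 < real_of_rat i \<and> real_of_rat i \<le> real_of_rat j \<and> real_of_rat j \<le> q")
    case True
    then have j: "0 < real_of_rat j"
      by linarith
    have "(\<lambda>\<omega>. ?a \<omega> (real_of_rat i)) \<in> borel_measurable ?F"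
      using True assms by (intro measurable_plan_filtration) auto
    moreover have "(\<lambda>\<omega>. ?B \<omega> (real_of_rat j)) \<in> borel_measurable ?F"
      using True assms by (intro measurable_budget_filtration less_imp_le[OF j]) auto
    ultimately have "Measurable.pred ?F (\<lambda>\<omega>. max 0 (?a \<omega> (real_of_rat i)) \<le> ?B \<omega> (real_of_rat j))"
      unfolding pred_def by (intro borel_measurable_le borel_measurable_max borel_measurable_const)
    then show ?thesis
      using True by simp
  next
    case False
    then show ?thesis
      by (simp only: simp_thms) simp
  qed
  then show ?thesis
    unfolding eq by (intro pred_intros_countable)
qed

lemma predictable_generators:
  fixes \<F> :: "real \<Rightarrow> 'a measure"
  assumes "\<And>t. space (\<F> t) = \<Omega>"
  shows "{{s} \<times> A | A. A \<in> sets (\<F> s)} \<union>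
        {{a<..b} \<times> A | a b A. s \<le> a \<and> a \<le> b \<and> A \<in> sets (\<F> a)} \<subseteq> Pow ({s..} \<times> \<Omega>)"
  using sets.sets_into_space[of _ "\<F> _"] assms by fastforce

lemma space_predictable:
  assumes "\<And>t. space (\<F> t) = \<Omega>"
  shows "space (predictable_algebra \<Omega> \<F> s) = {s..} \<times> \<Omega>"
  unfolding predictable_algebra_def by (rule space_measure_of[OF predictable_generators[OF assms]])

lemma sets_predictable:
  assumes "\<And>t. space (\<F> t) = \<Omega>"
  shows "sets (predictable_algebra \<Omega> \<F> s) = sigma_sets ({s..} \<times> \<Omega>)
       ({{s} \<times> A | A. A \<in> sets (\<F> s)} \<union>
        {{a<..b} \<times> A | a b A. s \<le> a \<and> a \<le> b \<and> A \<in> sets (\<F> a)})"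
  unfolding predictable_algebra_def by (rule sets_measure_of[OF predictable_generators[OF assms]])

lemma predictable_rays:
  assumes sp: "\<And>t. space (\<F> t) = \<Omega>" and "s \<le> a" "A \<in> sets (\<F> a)"
  shows "{a<..} \<times> A \<in> sets (predictable_algebra \<Omega> \<F> s)"
proof -
  have "{a<..a + real n} \<times> A \<in> sets (predictable_algebra \<Omega> \<F> s)" for n
    unfolding sets_predictable[OF sp]
    by (rule sigma_sets.Basic, rule UnI2, rule CollectI, rule exI[of _ a], rule exI[of _ "a + real n"],
        rule exI[of _ A]) (use assms in simp)
  then have "(\<Union>n. {a<..a + real n} \<times> A) \<in> sets (predictable_algebra \<Omega> \<F> s)"
    by blast
  moreover have "(\<Union>n. {a<..a + real n} \<times> A) = {a<..} \<times> A"
  proof (intro equalityI subsetI)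
    fix z assume z: "z \<in> {a<..} \<times> A"
    obtain n where "fst z - a \<le> real n"
      using real_arch_simple by blast
    with z show "z \<in> (\<Union>n. {a<..a + real n} \<times> A)"
      by (intro UN_I[of n]) auto
  qed auto
  ultimately show ?thesis by simp
qed

text \<open>
  Predictability requires \<open>Z\<close> to be known at \<open>a\<close> when it takes effect strictly after \<open>a\<close>.
\<close>

lemma predictable_delayed:
  assumes sp: "\<And>t. space (\<F> t) = \<Omega>" and "s \<le> a" and Z: "Z \<in> borel_measurable (\<F> a)"
  shows "(\<lambda>(t, \<omega>). if a < t then Z \<omega> else (0::real)) \<in> borel_measurable (predictable_algebra \<Omega> \<F> s)"
    (is "?f \<in> borel_measurable ?R")
proof (rule measurableI)
  fix B :: "real set" assume B: "B \<in> sets borel"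
  have 1: "{a<..} \<times> (Z -` B \<inter> \<Omega>) \<in> sets ?R"
    using predictable_rays[where \<F> = \<F> and s = s and A = "Z -` B \<inter> \<Omega>", OF sp assms(2)]
      measurable_sets[OF Z B] sp by simp
  have 2: "space ?R - {a<..} \<times> \<Omega> \<in> sets ?R"
    using predictable_rays[where \<F> = \<F> and s = s and A = \<Omega>, OF sp assms(2)]
      sets.top[of "\<F> a"] sp by auto
  have "?f -` B \<inter> space ?R
      = {a<..} \<times> (Z -` B \<inter> \<Omega>) \<union> (if 0 \<in> B then space ?R - {a<..} \<times> \<Omega> else {})"
    using assms(2) unfolding space_predictable[OF sp] by (auto split: if_splits)
  then show "?f -` B \<inter> space ?R \<in> sets ?R"
    using 1 2 by auto
qed simp

text \<open>
  The payout is a countable supremum of proposals, each in force strictly after the time of its observation.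
\<close>

lemma dividends_predictable:
  assumes reg: "AE \<omega> in P. regular_path (future \<xi> U s \<omega>)" and "0 \<le> s" "0 \<le> r" "0 \<le> p" "0 \<le> x" "b \<in> rules"
  shows "(\<lambda>(t, \<omega>). dividends p r x b (future \<xi> U s \<omega>) (t - s))
    \<in> borel_measurable (predictable_algebra (space P) (augmented_filtration P \<xi> U) s)"
proof -
  let ?B = "\<lambda>\<omega>. budget p r x (future \<xi> U s \<omega>)" and ?a = "\<lambda>\<omega>. plan p r x b (future \<xi> U s \<omega>)"
  have cnt: "countable {q\<in>\<rat>. 0 < (q::real)}"
    by (rule countable_subset[OF _ countable_rat]) auto
  have "(\<lambda>z. SUP q\<in>{q\<in>\<rat>. 0 < q}. if q < fst z - s \<and> solvent (?B (snd z)) (?a (snd z)) q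
        then max 0 (?a (snd z) q) else 0)
    \<in> borel_measurable (predictable_algebra (space P) (augmented_filtration P \<xi> U) s)"
  proof (rule borel_measurable_cSUP[OF cnt])
    fix q :: real assume "q \<in> {q\<in>\<rat>. 0 < q}"
    then have q: "0 < q" by simp
    have "(\<lambda>\<omega>. if solvent (?B \<omega>) (?a \<omega>) q then max 0 (?a \<omega> q) else 0)
        \<in> borel_measurable (augmented_filtration P \<xi> U (s + q))"
      using measurable_plan_filtration[OF reg assms(2,3) _ assms(6), of q "s + q" p x]
        measurable_solvent_filtration[OF reg assms(2,3) _ assms(6), of q "s + q" p x]
      by (intro measurable_If borel_measurable_max) (auto simp: pred_def)
    then have "(\<lambda>(t, \<omega>). if s + q < t then (if solvent (?B \<omega>) (?a \<omega>) q then max 0 (?a \<omega> q) else 0) else 0)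
        \<in> borel_measurable (predictable_algebra (space P) (augmented_filtration P \<xi> U) s)"
      using q by (intro predictable_delayed) auto
    moreover have "(\<lambda>(t, \<omega>). if s + q < t then (if solvent (?B \<omega>) (?a \<omega>) q then max 0 (?a \<omega> q) else 0) else 0)
      = (\<lambda>z. if q < fst z - s \<and> solvent (?B (snd z)) (?a (snd z)) q then max 0 (?a (snd z) q) else 0)"
      by (auto simp: fun_eq_iff)
    ultimately show "(\<lambda>z. if q < fst z - s \<and> solvent (?B (snd z)) (?a (snd z)) q then max 0 (?a (snd z) q) else 0)
        \<in> borel_measurable (predictable_algebra (space P) (augmented_filtration P \<xi> U) s)"
      by simp
  next
    fix z :: "real \<times> 'a"
    show "bdd_above ((\<lambda>q. if q < fst z - s \<and> solvent (?B (snd z)) (?a (snd z)) q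
        then max 0 (?a (snd z) q) else 0) ` {q\<in>\<rat>. 0 < q})"
      using bounded_budget.payout_bdd[OF budget_bounded[OF assms(4,3,5)]] .
  qed
  then show ?thesis
    unfolding dividends_def payout_def case_prod_beta .
qed

text \<open>
  The pathwise part of \<^const>\<open>admissible\<close>.
\<close>

definition admissible_path ::
  "real \<Rightarrow> real \<Rightarrow> (nat \<Rightarrow> 'a \<Rightarrow> real) \<Rightarrow> (nat \<Rightarrow> 'a \<Rightarrow> real) \<Rightarrow> real \<Rightarrow> real \<Rightarrow> (real \<Rightarrow> 'a \<Rightarrow> real) \<Rightarrow> 'a \<Rightarrow> bool" where
  "admissible_path T p \<xi> U s x L \<omega> \<longleftrightarrow>
     L s \<omega> = 0 \<and> mono_on {s..} (\<lambda>t. L t \<omega>) \<and> caglad_from s (\<lambda>t. L t \<omega>) \<and>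
     (\<forall>t>T. L t \<omega> = right_lim (\<lambda>u. L u \<omega>) T) \<and>
     (\<forall>t\<in>{s..T}. ereal t < ruin_time p \<xi> U s x L \<omega> \<longrightarrow>
        L t \<omega> \<le> right_lim (\<lambda>u. L u \<omega>) t \<and>
        right_lim (\<lambda>u. L u \<omega>) t \<le> x + p * (t - s) - claims_after \<xi> U s t \<omega>) \<and>
     (\<forall>u t. ruin_time p \<xi> U s x L \<omega> \<le> ereal u \<and> u \<le> t \<longrightarrow> L t \<omega> = L u \<omega>)"

lemma admissible_iff:
  "L \<in> admissible P T p \<xi> U s x \<longleftrightarrow>
    (\<lambda>(t, \<omega>). L t \<omega>) \<in> borel_measurable (predictable_algebra (space P) (augmented_filtration P \<xi> U) s) \<and>
    (AE \<omega> in P. admissible_path T p \<xi> U s x L \<omega>)"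
  unfolding admissible_def admissible_path_def by simp

lemma ruin_time_ge: "ereal s \<le> ruin_time p \<xi> U s x L \<omega>"
  unfolding ruin_time_def by (rule Inf_greatest) auto

lemma right_lim_eq: "(g \<longlongrightarrow> l) (at_right t) \<Longrightarrow> right_lim g t = l"
  unfolding right_lim_def by (rule tendsto_Lim[OF trivial_limit_at_right_real])

lemma right_lim_const:
  assumes "\<And>u. t < u \<Longrightarrow> g u = l"
  shows "right_lim g t = l"
proof (rule right_lim_eq)
  have "\<forall>\<^sub>F u in at_right t. l = g u"
    unfolding eventually_at_right_field using assms by (intro exI[of _ "t + 1"]) auto
  then show "(g \<longlongrightarrow> l) (at_right t)"
    by (rule Lim_transform_eventually[OF tendsto_const])
qed

text \<open>
  \<open>discounted_dividends\<close> is applied with \<open>b\<close> the minimum of ruin and terminal time; dividends are constant after \<open>b\<close> by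
  admissibility in both cases.
\<close>

lemma admissible_path_reward:
  assumes adm: "admissible_path T p \<xi> U s x L \<omega>" and "s \<le> T" "0 < c"
  shows "(LINT t : {t. s \<le> t \<and> ereal t \<le> min (ruin_time p \<xi> U s x L \<omega>) (ereal T)}
            | dividend_measure s (\<lambda>u. L u \<omega>). exp (- c * (t - s)))
    = (\<integral>\<zeta>. L (s + max 0 \<zeta>) \<omega> \<partial>exp_time c)"
proof -
  let ?\<tau> = "ruin_time p \<xi> U s x L \<omega>"
  obtain b where b: "s \<le> b" "min ?\<tau> (ereal T) = ereal b"
    "\<And>t. b < t \<Longrightarrow> L t \<omega> = right_lim (\<lambda>u. L u \<omega>) b"
  proof (cases "ereal T \<le> ?\<tau>")
    case True
    then show ?thesis
      using that[of T] adm assms(2) by (auto simp: admissible_path_def min_def)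
  next
    case False
    then obtain b where \<tau>: "?\<tau> = ereal b"
      using ruin_time_ge[of s p \<xi> U x L \<omega>] by (cases "?\<tau>") auto
    have const: "L t \<omega> = L b \<omega>" if "b \<le> t" for t
      using adm \<tau> that by (auto simp: admissible_path_def)
    have rl: "right_lim (\<lambda>u. L u \<omega>) b = L b \<omega>"
      by (rule right_lim_const, rule const) simp
    show ?thesis
    proof (rule that[of b])
      show "s \<le> b"
        using ruin_time_ge[of s p \<xi> U x L \<omega>] \<tau> by simp
      show "min ?\<tau> (ereal T) = ereal b"
        using False \<tau> by (simp add: min_def)
      show "L t \<omega> = right_lim (\<lambda>u. L u \<omega>) b" if "b < t" for t
        unfolding rl using that by (intro const) simp
    qed
  qed
  have set: "{t. s \<le> t \<and> ereal t \<le> min ?\<tau> (ereal T)} = {s..b}"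
    unfolding b(2) by auto
  interpret dividend_path s b "\<lambda>t. L t \<omega>"
    using adm b by unfold_locales (auto simp: admissible_path_def)
  show ?thesis
    unfolding set using discounted_dividends[OF assms(3)] by simp
qed

lemma wealth_eq:
  assumes "regular_path (future \<xi> U s \<omega>)" "s \<le> t"
  shows "wealth p \<xi> U s x L t \<omega> = x + p * (t - s) - aggregate (future \<xi> U s \<omega>) (t - s) - L t \<omega>"
  using claims_after_future[OF assms] by (simp add: wealth_def)

text \<open>
  Up to the terminal time the wealth is the budget minus the payout, so the properties of payouts apply.  The ruin
  time of \<^const>\<open>ruin_time\<close> ranges over all later times as well, where premiums and claims go on while the budget is
  frozen; right after the terminal time this can only increase the wealth until the next claim.
\<close>

lemma rule_admissible_path:
  fixes \<xi> U :: "nat \<Rightarrow> 'a \<Rightarrow> real" and b :: rule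
  assumes reg: "regular_path (future \<xi> U s \<omega>)" and "s \<le> T" "0 \<le> p" "0 \<le> x"
  defines "L \<equiv> \<lambda>t \<omega>. dividends p (T - s) x b (future \<xi> U s \<omega>) (t - s)"
  shows "admissible_path T p \<xi> U s x L \<omega>"
proof -
  define e where "e = future \<xi> U s \<omega>"
  define r where "r = T - s"
  define B where "B = budget p r x e"
  define a where "a = plan p r x b e"
  have r: "0 \<le> r" using assms by (simp add: r_def)
  interpret surplus_budget B "x + p * r"
    unfolding B_def using budget_surplus[OF assms(3) r assms(4)] reg by (simp add: e_def)
  have L: "L t \<omega> = payout B a (t - s)" for t
    unfolding L_def dividends_def B_def a_def r_def e_def ..
  have mono_L: "L t \<omega> \<le> L u \<omega>" if "t \<le> u" for t u
    using that by (simp add: L payout_mono)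
  have filter_shift: "at_right (t - s) = filtermap (\<lambda>u. u - s) (at_right t)"
    "at_left (t - s) = filtermap (\<lambda>u. u - s) (at_left t)" for t :: real
    using filtermap_at_right_shift[of "s" t] filtermap_at_left_shift[of s t]
    by (simp_all add: filtermap_filtermap)
  have left: "((\<lambda>u. L u \<omega>) \<longlongrightarrow> L t \<omega>) (at_left t)" for t
    using payout_at_left[of a "t - s"] unfolding L filter_shift filterlim_filtermap .
  have right: "((\<lambda>u. L u \<omega>) \<longlongrightarrow> right_lim (\<lambda>u. L u \<omega>) t) (at_right t)" for t
  proof -
    have "((\<lambda>u. L u \<omega>) \<longlongrightarrow> Inf ((\<lambda>u. L u \<omega>) ` {t<..})) (at_right t)"
    proof (rule decreasing_tendsto)
      have bdd: "bdd_below ((\<lambda>u. L u \<omega>) ` {t<..})"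
        by (rule bdd_belowI2[of _ 0]) (simp add: L payout_nonneg)
      show "\<forall>\<^sub>F u in at_right t. Inf ((\<lambda>u. L u \<omega>) ` {t<..}) \<le> L u \<omega>"
        unfolding eventually_at_right_field by (intro exI[of _ "t + 1"]) (auto intro!: cINF_lower[OF bdd])
      fix z assume "Inf ((\<lambda>u. L u \<omega>) ` {t<..}) < z"
      then obtain u where "t < u" "L u \<omega> < z"
        using cInf_less_iff[OF _ bdd] by (auto simp: not_le)
      then show "\<forall>\<^sub>F u in at_right t. L u \<omega> < z"
        unfolding eventually_at_right_field by (intro exI[of _ u]) (meson mono_L less_imp_le le_less_trans)
    qed
    then show ?thesis
      using right_lim_eq by metis
  qed
  have tail: "L t \<omega> = L u \<omega>" if "T < t" "T < u" for t u
    unfolding L_def using that assms dividends_tail_constant[OF assms(3) r assms(4), of "t - s" "u - s"]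
    by (simp add: r_def)
  \<comment> \<open>also at the terminal time, after which \<open>B\<close> is frozen and the wealth is not\<close>
  have near: "\<forall>\<^sub>F t in at_right u. B (t - s) - L t \<omega> \<le> wealth p \<xi> U s x L t \<omega>" if u: "s \<le> u" "u \<le> T" for u
  proof -
    obtain d where d: "0 < d" "\<And>v. u - s \<le> v \<Longrightarrow> v < u - s + d \<Longrightarrow> arrivals e v = arrivals e (u - s)"
      using arrivals_right_constant[of e "u - s"] reg e_def by blast
    have "B (t - s) - L t \<omega> \<le> wealth p \<xi> U s x L t \<omega>" if t: "u < t" "t < u + d" for t
    proof -
      have "arrivals e (t - s) = arrivals e (u - s)" "arrivals e (min (t - s) r) = arrivals e (u - s)"
        using t u by (auto intro!: d(2) simp: r_def)
      then have "aggregate e (t - s) = aggregate e (min (t - s) r)"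
        by (simp add: aggregate_def)
      moreover have "p * min (t - s) r \<le> p * (t - s)"
        using assms by (intro mult_left_mono) auto
      ultimately show ?thesis
        using wealth_eq[OF reg, of t p x L] t u by (simp add: B_def budget_def e_def)
    qed
    then show ?thesis
      unfolding eventually_at_right_field using d(1) by (intro exI[of _ "u + d"]) auto
  qed
  have wealth: "wealth p \<xi> U s x L t \<omega> = B (t - s) - L t \<omega>" if "s \<le> t" "t \<le> T" for t
    using wealth_eq[OF reg, of t p x L] that by (simp add: B_def budget_def e_def r_def)
  have solvent_right: "\<forall>\<^sub>F t in at_right u. L t \<omega> \<le> B (t - s)"
    if "s \<le> u" "0 \<le> wealth p \<xi> U s x L u \<omega>" "u \<le> T" for u
    using wealth_stays_nonneg[of "u - s" a] that wealth[of u]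
    unfolding filter_shift eventually_filtermap L by simp
  show ?thesis
    unfolding admissible_path_def
  proof (intro conjI ballI allI impI)
    show "L s \<omega> = 0"
      by (simp add: L payout_zero)
    show "mono_on {s..} (\<lambda>t. L t \<omega>)"
      by (auto intro!: mono_onI mono_L)
    show "caglad_from s (\<lambda>t. L t \<omega>)"
      unfolding caglad_from_def using left right by blast
    show "L t \<omega> = right_lim (\<lambda>u. L u \<omega>) T" if "T < t" for t
      by (rule right_lim_const[symmetric]) (use tail that in blast)
  next
    fix t assume t: "t \<in> {s..T}" "ereal t < ruin_time p \<xi> U s x L \<omega>"
    have "\<forall>\<^sub>F u in at_right t. L t \<omega> \<le> L u \<omega>"
      unfolding eventually_at_right_field using mono_L by (intro exI[of _ "t + 1"]) auto
    then show "L t \<omega> \<le> right_lim (\<lambda>u. L u \<omega>) t"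
      using tendsto_lowerbound[OF right] by simp
    have "0 \<le> wealth p \<xi> U s x L t \<omega>"
    proof (rule ccontr)
      assume "\<not> 0 \<le> wealth p \<xi> U s x L t \<omega>"
      then have "ruin_time p \<xi> U s x L \<omega> \<le> ereal t"
        unfolding ruin_time_def using t by (intro Inf_lower) auto
      then show False using t by simp
    qed
    then have "\<forall>\<^sub>F u in at_right t. L u \<omega> \<le> B (u - s)"
      using t by (intro solvent_right) auto
    moreover have "((\<lambda>u. B (u - s)) \<longlongrightarrow> B (t - s)) (at_right t)"
      using right_cont[of "t - s"] t unfolding filter_shift filterlim_filtermap by simp
    ultimately have "right_lim (\<lambda>u. L u \<omega>) t \<le> B (t - s)"
      using tendsto_le[OF trivial_limit_at_right_real _ right] by blast
    then show "right_lim (\<lambda>u. L u \<omega>) t \<le> x + p * (t - s) - claims_after \<xi> U s t \<omega>"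
      using t claims_after_future[OF reg, of t] by (simp add: B_def budget_def r_def e_def)
  next
    fix u t assume ut: "ruin_time p \<xi> U s x L \<omega> \<le> ereal u \<and> u \<le> t"
    then have su: "s \<le> u"
      using ruin_time_ge[of s p \<xi> U x L \<omega>] by (metis ereal_less_eq(3) order_trans)
    show "L t \<omega> = L u \<omega>"
    proof (cases "\<exists>v. s \<le> v \<and> v \<le> u \<and> v \<le> T \<and> wealth p \<xi> U s x L v \<omega> < 0")
      case True
      then obtain v where v: "s \<le> v" "v \<le> u" "v \<le> T" "wealth p \<xi> U s x L v \<omega> < 0" by blast
      then have "B (v - s) < payout B a (v - s)"
        using wealth[of v] by (simp add: L)
      then have *: "L t' \<omega> = L v \<omega>" if "v \<le> t'" for t'
        unfolding L using that v(1) by (intro payout_stops_at_ruin) auto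
      have "L t \<omega> = L v \<omega>" "L u \<omega> = L v \<omega>"
        using v(2) ut by (auto intro: *)
      then show ?thesis
        by simp
    next
      case no_ruin: False
      \<comment> \<open>without ruin up to \<open>u\<close>, a ruin time of at most \<open>u\<close> would be a limit of later ruin, which the payout excludes up to \<open>T\<close>\<close>
      have "T < u"
      proof (rule ccontr)
        assume "\<not> T < u"
        then have u: "u \<le> T" by simp
        then have "0 \<le> wealth p \<xi> U s x L u \<omega>"
          using no_ruin su by (metis not_le order_refl)
        then have "\<forall>\<^sub>F t in at_right u. 0 \<le> wealth p \<xi> U s x L t \<omega>"
          using solvent_right[OF su _ u] near[OF su u] by (auto elim: eventually_elim2)
        then obtain d where d: "u < d" "\<And>t. u < t \<Longrightarrow> t < d \<Longrightarrow> 0 \<le> wealth p \<xi> U s x L t \<omega>"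
          unfolding eventually_at_right_field by blast
        have "ereal d \<le> ruin_time p \<xi> U s x L \<omega>"
          unfolding ruin_time_def
        proof (rule Inf_greatest)
          fix z assume "z \<in> ereal ` {t. s \<le> t \<and> wealth p \<xi> U s x L t \<omega> < 0}"
          then obtain t where t: "z = ereal t" "s \<le> t" "wealth p \<xi> U s x L t \<omega> < 0" by auto
          have "d \<le> t"
          proof (rule ccontr)
            assume "\<not> d \<le> t"
            then show False
              using d(2)[of t] no_ruin t u by (cases "t \<le> u") auto
          qed
          then show "ereal d \<le> z" using t by simp
        qed
        then show False
          using ut d(1) by (metis ereal_less_eq(3) leD order_trans)
      qed
      then show ?thesis
        using ut by (intro tail) auto
    qed
  qed
qed

section \<open>Strategies are dominated by rules\<close>

text \<open>
  A rule that proposes the dividends of an admissible strategy is solvent until the strategy is ruined, and by left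
  continuity the payout catches up with the strategy.  At the terminal time the rule pays out everything, the strategy
  at most that.
\<close>

lemma rule_dominates:
  assumes adm: "admissible_path T p \<xi> U s x L \<omega>" and reg: "regular_path (future \<xi> U s \<omega>)"
    and "s \<le> T" "0 \<le> p" "0 \<le> x" "s \<le> t"
    and b: "\<And>q. q \<in> \<rat> \<Longrightarrow> 0 < q \<Longrightarrow> b q (history q (future \<xi> U s \<omega>)) = L (s + q) \<omega>"
  shows "L t \<omega> \<le> dividends p (T - s) x b (future \<xi> U s \<omega>) (t - s)"
proof -
  define e where "e = future \<xi> U s \<omega>"
  define r where "r = T - s"
  define B where "B = budget p r x e"
  define a where "a = plan p r x b e"
  define \<tau> where "\<tau> = ruin_time p \<xi> U s x L \<omega>"
  have r: "0 \<le> r" using assms by (simp add: r_def)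
  interpret bounded_budget B "x + p * r"
    unfolding B_def by (rule budget_bounded[OF assms(4) r assms(5)])
  have mono: "L u \<omega> \<le> L v \<omega>" if "s \<le> u" "u \<le> v" for u v
  proof -
    have "mono_on {s..} (\<lambda>t. L t \<omega>)"
      using adm by (simp add: admissible_path_def)
    from mono_onD[OF this, of u v] show ?thesis
      using that by simp
  qed
  have nonneg: "0 \<le> L u \<omega>" if "s \<le> u" for u
    using mono[OF order_refl that] adm by (simp add: admissible_path_def)
  have stops: "L v \<omega> = L u \<omega>" if "\<tau> \<le> ereal u" "u \<le> v" for u v
    using adm that unfolding admissible_path_def \<tau>_def by blast
  have funds: "L u \<omega> \<le> B (u - s)" if u: "s \<le> u" "u \<le> T" "ereal u < \<tau>" for u
  proof (rule ccontr)
    assume "\<not> L u \<omega> \<le> B (u - s)"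
    then have "wealth p \<xi> U s x L u \<omega> < 0"
      using wealth_eq[OF reg u(1), of p x L] u by (simp add: B_def budget_def r_def e_def)
    then have "\<tau> \<le> ereal u"
      unfolding \<tau>_def ruin_time_def using u by (intro Inf_lower) auto
    then show False using u(3) by simp
  qed
  have early: "a q = L (s + q) \<omega>" if "q \<in> \<rat>" "0 < q" "q < r" for q
    using b[OF that(1,2)] that by (simp add: a_def plan_def e_def)
  have late: "a q = B r" "B q = B r" if "r \<le> q" for q
    using that by (simp_all add: a_def plan_def B_def budget_def)
  have before: "L u \<omega> \<le> payout B a (u - s)" if u: "s \<le> u" "u \<le> T" "ereal u \<le> \<tau>" for u
  proof (cases "u = s")
    case True
    then show ?thesis
      using adm payout_nonneg by (simp add: admissible_path_def)
  next
    case False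
    then have su: "s < u" using u by simp
    have "L v \<omega> \<le> payout B a (u - s)" if v: "s < v" "v < u" for v
    proof -
      obtain q where q: "q \<in> \<rat>" "v - s < q" "q < u - s"
        using rat_between[of "v - s" "u - s"] v by auto
      have pos: "0 < q" "q < r"
        using q v u by (auto simp: r_def)
      have ok: "L (s + q2) \<omega> \<le> B q2" if "0 < q2" "q2 \<le> q" for q2
      proof -
        have "ereal (s + q2) < \<tau>"
          using that q u(3) by (intro less_le_trans[OF _ u(3)]) simp
        then show ?thesis
          using funds[of "s + q2"] that pos by (simp add: r_def)
      qed
      have "solvent B a q"
      proof (rule solventI)
        fix q1 q2 :: real assume *: "q1 \<in> \<rat>" "q2 \<in> \<rat>" "0 < q1" "q1 \<le> q2" "q2 \<le> q"
        show "a q1 \<le> B q2"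
          using early[of q1] mono[of "s + q1" "s + q2"] ok[of q2] * pos by simp
      next
        fix q2 :: real assume *: "q2 \<in> \<rat>" "0 < q2" "q2 \<le> q"
        then show "0 \<le> B q2"
          using nonneg[of "s + q2"] ok[of q2] by simp
      qed
      then have "a q \<le> payout B a (u - s)"
        using q pos by (intro payout_upper) auto
      then show ?thesis
        using early[OF q(1) pos] mono[of v "s + q"] v q by simp
    qed
    then have "\<forall>\<^sub>F v in at_left u. L v \<omega> \<le> payout B a (u - s)"
      unfolding eventually_at_left_field using su by (intro exI[of _ s]) auto
    moreover have "((\<lambda>v. L v \<omega>) \<longlongrightarrow> L u \<omega>) (at_left u)"
      using adm su unfolding admissible_path_def caglad_from_def by blast
    ultimately show ?thesis
      using tendsto_upperbound by fastforce
  qed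
  have after: "L t \<omega> \<le> payout B a (t - s)" if \<tau>: "\<tau> \<le> ereal T" "\<tau> \<le> ereal t"
  proof -
    have "ereal s \<le> \<tau>"
      unfolding \<tau>_def by (rule ruin_time_ge)
    then obtain d where d: "\<tau> = ereal d" "s \<le> d"
      using \<tau> by (cases \<tau>) auto
    have "L t \<omega> = L d \<omega>"
      using stops[of d t] d \<tau> by simp
    also have "\<dots> \<le> payout B a (d - s)"
      using before[of d] d \<tau> by simp
    also have "\<dots> \<le> payout B a (t - s)"
      using d \<tau> by (intro payout_mono) simp
    finally show ?thesis .
  qed
  have "L t \<omega> \<le> payout B a (t - s)"
  proof (cases "t \<le> T")
    case True
    show ?thesis
    proof (cases "ereal t \<le> \<tau>")
      case True
      then show ?thesis
        using before[OF assms(6) \<open>t \<le> T\<close>] by simp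
    next
      case False
      then have "\<tau> \<le> ereal t" by simp
      moreover from this have "\<tau> \<le> ereal T"
        using True by (meson ereal_less_eq(3) order_trans)
      ultimately show ?thesis
        by (intro after)
    qed
  next
    case beyond: False
    show ?thesis
    proof (cases "ereal T < \<tau>")
      case True
      have eq: "L t \<omega> = right_lim (\<lambda>u. L u \<omega>) T"
        using adm beyond unfolding admissible_path_def by auto
      have T_in: "T \<in> {s..T}" using assms by simp
      have "L T \<omega> \<le> right_lim (\<lambda>u. L u \<omega>) T"
        "right_lim (\<lambda>u. L u \<omega>) T \<le> x + p * (T - s) - claims_after \<xi> U s T \<omega>"
        using adm True T_in unfolding admissible_path_def \<tau>_def by blast+
      then have T: "L T \<omega> \<le> B r" "L t \<omega> \<le> B r"
        using eq claims_after_future[OF reg assms(3)] by (simp_all add: B_def budget_def r_def e_def)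
      obtain q where q: "q \<in> \<rat>" "r < q" "q < t - s"
        using rat_between[of r "t - s"] beyond by (auto simp: r_def)
      have ok: "L (s + q2) \<omega> \<le> B q2" if "0 < q2" "q2 \<le> r" for q2
      proof -
        have "ereal (s + q2) < \<tau>"
          using that by (intro le_less_trans[OF _ True]) (simp add: r_def)
        then show ?thesis
          using funds[of "s + q2"] that by (simp add: r_def)
      qed
      have "solvent B a q"
      proof (rule solventI)
        fix q1 q2 :: real assume *: "q1 \<in> \<rat>" "q2 \<in> \<rat>" "0 < q1" "q1 \<le> q2" "q2 \<le> q"
        consider "r \<le> q1" | "q1 < r" "q2 \<le> r" | "q1 < r" "r < q2" by linarith
        then show "a q1 \<le> B q2"
        proof cases
          case 1
          then show ?thesis using late(1)[of q1] late(2)[of q2] * by simp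
        next
          case 2
          then show ?thesis
            using early[of q1] mono[of "s + q1" "s + q2"] ok[of q2] * by simp
        next
          case 3
          then show ?thesis
            using early[of q1] mono[of "s + q1" T] T(1) late(2)[of q2] * by (simp add: r_def)
        qed
      next
        fix q2 :: real assume *: "q2 \<in> \<rat>" "0 < q2" "q2 \<le> q"
        show "0 \<le> B q2"
          using nonneg[of "s + q2"] ok[of q2] * nonneg[OF assms(3)] T(1) late(2)[of q2]
          by (cases "q2 \<le> r") auto
      qed
      then have "a q \<le> payout B a (t - s)"
        using q r by (intro payout_upper) auto
      then show ?thesis
        using T(2) late(1)[of q] q by simp
    next
      case False
      then have "\<tau> \<le> ereal T" by simp
      moreover from this have "\<tau> \<le> ereal t"
        using beyond by (meson ereal_less_eq(3) order_trans linear)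
      ultimately show ?thesis
        by (intro after)
    qed
  qed
  then show ?thesis
    by (simp add: dividends_def B_def a_def r_def e_def)
qed

lemma reward_eq:
  assumes "0 \<le> p" "0 \<le> r" "0 \<le> x"
  shows "reward c p r x b e = (\<integral>\<zeta>. dividends p r x b e (max 0 \<zeta>) \<partial>exp_time c)"
proof -
  have "dividends p r x b e \<zeta> = dividends p r x b e (max 0 \<zeta>)" for \<zeta>
    using bounded_budget.payout_zero[OF budget_bounded[OF assms]] unfolding dividends_def
    by (cases "\<zeta> \<le> 0") simp_all
  then show ?thesis
    unfolding reward_def by simp
qed

text \<open>
  Inverse to \<^const>\<open>observe_states\<close>: the state at \<open>s + u\<close> from the state at \<open>s\<close> and the observation of the path at \<open>u\<close>.
\<close>

definition advance_state :: "real \<Rightarrow> observation \<Rightarrow> observation \<Rightarrow> observation" where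
  "advance_state u z o' = (fst z + fst o', fst (snd z) + fst (snd o'),
     if fst o' = 0 then snd (snd z) + u else u - snd (snd o'))"

lemma measurable_advance_state:
  "(\<lambda>(z, o'). advance_state u z o') \<in> borel_measurable (borel \<Otimes>\<^sub>M borel)"
  unfolding advance_state_def borel_prod[symmetric] by measurable

lemma state_future:
  assumes "regular_path (future \<xi> U s \<omega>)" "s \<le> u"
  shows "state \<xi> U u \<omega> = advance_state (u - s) (state \<xi> U s \<omega>) (observe (future \<xi> U s \<omega>) (u - s))"
  using claim_count_future[OF assms] total_claims_future[OF assms] elapsed_time_future[OF assms]
  by (simp add: observe_def advance_state_def state_def)

lemma predictable_section:
  assumes sp: "\<And>t. space (\<F> t) = \<Omega>" and "s \<le> t" and mono: "\<And>u. u \<le> t \<Longrightarrow> sets (\<F> u) \<subseteq> sets (\<F> t)"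
    and L: "(\<lambda>(t, \<omega>). L t \<omega>) \<in> borel_measurable (predictable_algebra \<Omega> \<F> s)"
  shows "L t \<in> borel_measurable (\<F> t)"
proof -
  have "(\<lambda>\<omega>. (t, \<omega>)) \<in> measurable (\<F> t) (predictable_algebra \<Omega> \<F> s)"
    unfolding predictable_algebra_def
  proof (rule measurable_measure_of[OF predictable_generators[OF sp]])
    show "(\<lambda>\<omega>. (t, \<omega>)) \<in> space (\<F> t) \<rightarrow> {s..} \<times> \<Omega>"
      using assms by auto
    fix Y assume "Y \<in> {{s} \<times> A | A. A \<in> sets (\<F> s)} \<union> {{a<..b} \<times> A | a b A. s \<le> a \<and> a \<le> b \<and> A \<in> sets (\<F> a)}"
    then have "\<exists>I A a. Y = I \<times> A \<and> A \<in> sets (\<F> a) \<and> (t \<in> I \<longrightarrow> a \<le> t)"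
      by (elim UnE CollectE exE conjE, metis order_refl singletonD) (metis greaterThanAtMost_iff less_imp_le)
    then obtain I A a where Y: "Y = I \<times> A" "A \<in> sets (\<F> a)" "t \<in> I \<Longrightarrow> a \<le> t"
      by blast
    have "(\<lambda>\<omega>. (t, \<omega>)) -` Y \<inter> space (\<F> t) = (if t \<in> I then A \<inter> space (\<F> t) else {})"
      using Y(1) by auto
    moreover have "t \<in> I \<Longrightarrow> A \<inter> space (\<F> t) \<in> sets (\<F> t)"
      using Y mono by blast
    ultimately show "(\<lambda>\<omega>. (t, \<omega>)) -` Y \<inter> space (\<F> t) \<in> sets (\<F> t)"
      by simp
  qed
  from measurable_compose[OF this L] show ?thesis
    by simp
qed

lemma filtration_mono:
  "t \<le> t' \<Longrightarrow> sets (augmented_filtration P \<xi> U t) \<subseteq> sets (augmented_filtration P \<xi> U t')"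
  unfolding sets_filtration observation_events_def
  by (intro sigma_sets_mono' Un_mono order_refl) (blast intro: order_trans)

definition past :: "'a set \<Rightarrow> (nat \<Rightarrow> 'a \<Rightarrow> real) \<Rightarrow> (nat \<Rightarrow> 'a \<Rightarrow> real) \<Rightarrow> real \<Rightarrow> 'a measure" where
  "past \<Omega> \<xi> U s = sigma \<Omega> (observation_events \<Omega> \<xi> U s)"

lemma space_past [simp]: "space (past \<Omega> \<xi> U s) = \<Omega>"
  unfolding past_def by (rule space_measure_of[OF observation_events_Pow])

lemma sets_past: "sets (past \<Omega> \<xi> U s) = sigma_sets \<Omega> (observation_events \<Omega> \<xi> U s)"
  unfolding past_def by (rule sets_measure_of[OF observation_events_Pow])

text \<open>
  Up to null sets, the information at time \<open>s + q\<close> is that of the past of \<open>s\<close> together with the history of the claim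
  path up to \<open>q\<close>.
\<close>

lemma filtration_event_factor:
  assumes reg: "AE \<omega> in P. regular_path (future \<xi> U s \<omega>)" and "0 \<le> s"
    and "A \<in> sets (augmented_filtration P \<xi> U (s + q))"
  shows "\<exists>B\<in>sets (past (space P) \<xi> U s \<Otimes>\<^sub>M history_space q).
    AE \<omega> in P. \<omega> \<in> A \<longleftrightarrow> (\<omega>, history q (future \<xi> U s \<omega>)) \<in> B"
proof -
  let ?S = "past (space P) \<xi> U s \<Otimes>\<^sub>M history_space q"
  have in_space: "\<omega> \<in> space P \<Longrightarrow> (\<omega>, history q (future \<xi> U s \<omega>)) \<in> space ?S" for \<omega>
    by (auto simp: space_pair_measure space_PiM history_def)
  show ?thesis
    using assms(3) unfolding sets_filtration
  proof (induction A rule: sigma_sets.induct)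
    case (Basic A)
    then show ?case
    proof
      assume "A \<in> null_sets (completion P)"
      then have "AE \<omega> in completion P. \<omega> \<notin> A"
        by (rule AE_not_in)
      then have "AE \<omega> in P. \<omega> \<notin> A"
        by (simp add: AE_completion_iff)
      then show ?thesis
        by (intro bexI[of _ "{}"]) auto
    next
      assume "A \<in> observation_events (space P) \<xi> U (s + q)"
      then obtain u B where u: "0 \<le> u" "u \<le> s + q" "B \<in> sets borel" "A = state \<xi> U u -` B \<inter> space P"
        unfolding observation_events_def state_def[abs_def] by blast
      show ?thesis
      proof (cases "u \<le> s")
        case True
        then have "A \<in> sets (past (space P) \<xi> U s)"
          using u unfolding sets_past observation_events_def state_def[abs_def]
          by (intro sigma_sets.Basic) blast
        then have "A \<times> space (history_space q) \<in> sets ?S"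
          by (intro pair_measureI) auto
        moreover have "AE \<omega> in P. \<omega> \<in> A \<longleftrightarrow> (\<omega>, history q (future \<xi> U s \<omega>)) \<in> A \<times> space (history_space q)"
          by (intro AE_I2) (auto simp: space_PiM history_def)
        ultimately show ?thesis by blast
      next
        case False
        define \<Phi> where "\<Phi> z = advance_state (u - s) (state \<xi> U s (fst z)) (snd z (u - s))" for z
        have "state \<xi> U s \<in> borel_measurable (past (space P) \<xi> U s)"
        proof (rule measurableI)
          fix B :: "(observation) set" assume "B \<in> sets borel"
          then have "state \<xi> U s -` B \<inter> space P \<in> observation_events (space P) \<xi> U s"
            using \<open>0 \<le> s\<close> unfolding observation_events_def state_def[abs_def] by blast
          then show "state \<xi> U s -` B \<inter> space (past (space P) \<xi> U s) \<in> sets (past (space P) \<xi> U s)"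
            unfolding sets_past by (auto intro: sigma_sets.Basic)
        qed simp
        then have 1: "(\<lambda>z. state \<xi> U s (fst z)) \<in> borel_measurable ?S"
          by (rule measurable_compose[OF measurable_fst])
        have "(\<lambda>g. g (u - s)) \<in> measurable (history_space q) borel"
          using u False by (intro measurable_component_singleton) auto
        then have 2: "(\<lambda>z. snd z (u - s)) \<in> borel_measurable ?S"
          by (rule measurable_compose[OF measurable_snd])
        have \<Phi>: "\<Phi> \<in> borel_measurable ?S"
          using measurable_compose[OF measurable_Pair[OF 1 2] measurable_advance_state[of "u - s"]]
          by (simp add: \<Phi>_def[abs_def])
        have "AE \<omega> in P. \<omega> \<in> A \<longleftrightarrow> (\<omega>, history q (future \<xi> U s \<omega>)) \<in> \<Phi> -` B \<inter> space ?S"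
          using reg AE_space
        proof eventually_elim
          case (elim \<omega>)
          have "state \<xi> U u \<omega> = \<Phi> (\<omega>, history q (future \<xi> U s \<omega>))"
            using state_future[OF elim(1), of u] False u by (simp add: \<Phi>_def history_def)
          then show ?case
            using in_space[OF elim(2)] elim(2) u(4) by auto
        qed
        then show ?thesis
          using measurable_sets[OF \<Phi> u(3)] by blast
      qed
    qed
  next
    case Empty
    show ?case by (intro bexI[of _ "{}"]) auto
  next
    case (Compl A)
    then obtain B where B: "B \<in> sets ?S" "AE \<omega> in P. \<omega> \<in> A \<longleftrightarrow> (\<omega>, history q (future \<xi> U s \<omega>)) \<in> B"
      by blast
    have "AE \<omega> in P. \<omega> \<in> space P - A \<longleftrightarrow> (\<omega>, history q (future \<xi> U s \<omega>)) \<in> space ?S - B"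
      using B(2) AE_space
    proof eventually_elim
      case (elim \<omega>)
      then show ?case using in_space[OF elim(2)] by auto
    qed
    then show ?case
      using B(1) by (intro bexI[of _ "space ?S - B"]) auto
  next
    case (Union A)
    then have "\<forall>i. \<exists>B. B \<in> sets ?S \<and> (AE \<omega> in P. \<omega> \<in> A i \<longleftrightarrow> (\<omega>, history q (future \<xi> U s \<omega>)) \<in> B)"
      by blast
    from choice[OF this] obtain B
      where "\<forall>i. B i \<in> sets ?S \<and> (AE \<omega> in P. \<omega> \<in> A i \<longleftrightarrow> (\<omega>, history q (future \<xi> U s \<omega>)) \<in> B i)" ..
    then have B: "\<And>i. B i \<in> sets ?S"
      "\<And>i. AE \<omega> in P. \<omega> \<in> A i \<longleftrightarrow> (\<omega>, history q (future \<xi> U s \<omega>)) \<in> B i"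
      by simp_all
    have "AE \<omega> in P. \<forall>i::nat. \<omega> \<in> A i \<longleftrightarrow> (\<omega>, history q (future \<xi> U s \<omega>)) \<in> B i"
      using B(2) by (simp add: AE_all_countable)
    then have "AE \<omega> in P. \<omega> \<in> (\<Union>i. A i) \<longleftrightarrow> (\<omega>, history q (future \<xi> U s \<omega>)) \<in> (\<Union>i. B i)"
      by eventually_elim auto
    then show ?case
      using B(1) by (intro bexI[of _ "\<Union>i. B i"]) auto
  qed
qed

text \<open>
  A real function is recovered from its strict sublevel sets at rational levels.
\<close>

lemma event_factor_imp_function_factor:
  fixes h :: "'a \<Rightarrow> real"
  assumes h: "h \<in> borel_measurable \<F>" and sp: "space \<F> = space P"
    and events: "\<And>A. A \<in> sets \<F> \<Longrightarrow> \<exists>B\<in>sets N. AE \<omega> in P. \<omega> \<in> A \<longleftrightarrow> Y \<omega> \<in> B"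
  shows "\<exists>g\<in>borel_measurable N. AE \<omega> in P. h \<omega> = g (Y \<omega>)"
proof -
  have "\<forall>i. \<exists>B. B \<in> sets N \<and> (AE \<omega> in P. h \<omega> < real_of_rat i \<longleftrightarrow> Y \<omega> \<in> B)"
  proof
    fix i
    have "{\<omega>\<in>space \<F>. h \<omega> < real_of_rat i} \<in> sets \<F>"
      using h by (intro borel_measurable_less borel_measurable_const)
    then obtain B where B: "B \<in> sets N"
      "AE \<omega> in P. \<omega> \<in> {\<omega>\<in>space \<F>. h \<omega> < real_of_rat i} \<longleftrightarrow> Y \<omega> \<in> B"
      using events by blast
    have "AE \<omega> in P. h \<omega> < real_of_rat i \<longleftrightarrow> Y \<omega> \<in> B"
      using B(2) AE_space by eventually_elim (simp add: sp)
    then show "\<exists>B. B \<in> sets N \<and> (AE \<omega> in P. h \<omega> < real_of_rat i \<longleftrightarrow> Y \<omega> \<in> B)"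
      using B(1) by (intro exI[of _ B] conjI)
  qed
  from choice[OF this] obtain B
    where "\<forall>i. B i \<in> sets N \<and> (AE \<omega> in P. h \<omega> < real_of_rat i \<longleftrightarrow> Y \<omega> \<in> B i)" ..
  then have B: "\<And>i. B i \<in> sets N"
    "\<And>i. AE \<omega> in P. h \<omega> < real_of_rat i \<longleftrightarrow> Y \<omega> \<in> B i"
    by simp_all
  \<comment> \<open>a level whose set \<open>B i\<close> does not contain \<open>y\<close> contributes \<open>\<infinity>\<close>; almost surely the infimum is finite\<close>
  define G where "G y = (INF i. if y \<in> B i then ereal (real_of_rat i) else \<infinity>)" for y
  have "G \<in> borel_measurable N"
    unfolding G_def using B(1) by (intro borel_measurable_INF measurable_If) (auto simp: sets.sets_Collect)
  then have "(\<lambda>y. real_of_ereal (G y)) \<in> borel_measurable N"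
    by simp
  moreover have "AE \<omega> in P. \<forall>i. h \<omega> < real_of_rat i \<longleftrightarrow> Y \<omega> \<in> B i"
    using B(2) by (simp add: AE_all_countable)
  then have "AE \<omega> in P. h \<omega> = real_of_ereal (G (Y \<omega>))"
  proof eventually_elim
    case (elim \<omega>)
    have "G (Y \<omega>) = ereal (h \<omega>)"
    proof (rule antisym)
      show "ereal (h \<omega>) \<le> G (Y \<omega>)"
        unfolding G_def using elim by (intro INF_greatest) (auto simp: less_imp_le)
      show "G (Y \<omega>) \<le> ereal (h \<omega>)"
      proof (rule dense_ge)
        fix z assume "ereal (h \<omega>) < z"
        then obtain i where i: "ereal (h \<omega>) < real_of_rat i" "real_of_rat i < z"
          using ereal_dense3 by blast
        have "G (Y \<omega>) \<le> (if Y \<omega> \<in> B i then ereal (real_of_rat i) else \<infinity>)"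
          unfolding G_def by (rule INF_lower) simp
        then show "G (Y \<omega>) \<le> z"
          using i elim by auto
      qed
    qed
    then show ?case by simp
  qed
  ultimately show ?thesis
    by (intro bexI[of _ "\<lambda>y. real_of_ereal (G y)"])
qed

section \<open>The value function in terms of rules\<close>

text \<open>
  The control problem from one initial state, with \<open>P\<close> the conditional probability and \<open>Q\<close> the law of the claim path
  after \<open>s\<close>.  Its last assumption says that the claim path is independent of the observations up to \<open>s\<close>.
\<close>

locale initial_law = prob_space P + canonical: path_prob Q c p
  for P :: "'a measure" and Q :: "path measure" and c p :: real +
  fixes \<xi> U :: "nat \<Rightarrow> 'a \<Rightarrow> real" and s T x :: real
  assumes s_nonneg: "0 \<le> s" and s_le_T: "s \<le> T" and x_nonneg: "0 \<le> x"
    and measurable_past: "(\<lambda>\<omega>. \<omega>) \<in> measurable P (past (space P) \<xi> U s)"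
    and measurable_future: "future \<xi> U s \<in> measurable P path_space"
    and future_law: "distr P path_space (future \<xi> U s) = Q"
    and future_indep: "distr P (past (space P) \<xi> U s \<Otimes>\<^sub>M path_space) (\<lambda>\<omega>. (\<omega>, future \<xi> U s \<omega>))
      = distr P (past (space P) \<xi> U s) (\<lambda>\<omega>. \<omega>) \<Otimes>\<^sub>M Q"
begin

abbreviation "past_space \<equiv> past (space P) \<xi> U s"

abbreviation "path_value L \<omega> \<equiv>
  (LINT t : {t. s \<le> t \<and> ereal t \<le> min (ruin_time p \<xi> U s x L \<omega>) (ereal T)}
     | dividend_measure s (\<lambda>u. L u \<omega>). exp (- c * (t - s)))"

lemma r_nonneg: "0 \<le> T - s"
  using s_le_T by simp

lemma AE_regular_future: "AE \<omega> in P. regular_path (future \<xi> U s \<omega>)"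
  by (rule AE_distrD[OF measurable_future]) (simp only: future_law canonical.regular)

lemma expected_dividends_eq:
  "expected_dividends P T p c \<xi> U s x L = (\<integral>\<omega>. path_value L \<omega> \<partial>completion P)"
  by (simp add: expected_dividends_def)

lemma rule_strategy:
  assumes b: "b \<in> rules"
  defines "L \<equiv> \<lambda>t \<omega>. dividends p (T - s) x b (future \<xi> U s \<omega>) (t - s)"
  shows "L \<in> admissible P T p \<xi> U s x"
    and "expected_dividends P T p c \<xi> U s x L = (\<integral>e. reward c p (T - s) x b e \<partial>Q)"
proof -
  have adm: "AE \<omega> in P. admissible_path T p \<xi> U s x L \<omega>"
    using AE_regular_future unfolding L_def
    by eventually_elim (rule rule_admissible_path[OF _ s_le_T canonical.p_nonneg x_nonneg])
  then show "L \<in> admissible P T p \<xi> U s x"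
    unfolding admissible_iff L_def
    using dividends_predictable[OF AE_regular_future s_nonneg r_nonneg canonical.p_nonneg x_nonneg b] by simp
  let ?h = "\<lambda>\<omega>. reward c p (T - s) x b (future \<xi> U s \<omega>)"
  have rm: "reward c p (T - s) x b \<in> borel_measurable path_space"
    by (rule measurable_reward[OF b canonical.c_pos canonical.p_nonneg r_nonneg x_nonneg])
  then have h: "?h \<in> borel_measurable P"
    by (rule measurable_compose[OF measurable_future])
  have eq: "AE \<omega> in P. path_value L \<omega> = ?h \<omega>"
    using adm
  proof eventually_elim
    case (elim \<omega>)
    have "path_value L \<omega> = (\<integral>\<zeta>. L (s + max 0 \<zeta>) \<omega> \<partial>exp_time c)"
      by (rule admissible_path_reward[OF elim s_le_T canonical.c_pos])
    then show ?case
      using reward_eq[OF canonical.p_nonneg r_nonneg x_nonneg] by (simp add: L_def)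
  qed
  have "path_value L \<in> borel_measurable (completion P)"
    by (rule measurable_modify_null[OF _ _ _ _ eq])
       (use h in \<open>auto intro: measurable_completion simp: null_sets_def\<close>)
  from this measurable_completion[OF h] AE_completion[OF eq]
  have "(\<integral>\<omega>. path_value L \<omega> \<partial>completion P) = (\<integral>\<omega>. ?h \<omega> \<partial>completion P)"
    by (rule integral_cong_AE)
  also have "\<dots> = (\<integral>\<omega>. ?h \<omega> \<partial>P)"
    by (rule integral_completion[OF h])
  also have "\<dots> = (\<integral>e. reward c p (T - s) x b e \<partial>Q)"
    using integral_distr[OF measurable_future rm] future_law by simp
  finally show "expected_dividends P T p c \<xi> U s x L = (\<integral>e. reward c p (T - s) x b e \<partial>Q)"
    by (simp add: expected_dividends_eq)
qed

lemma strategy_section_factor: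
  assumes "L \<in> admissible P T p \<xi> U s x" "0 < q"
  shows "\<exists>g\<in>borel_measurable (past_space \<Otimes>\<^sub>M history_space q).
    AE \<omega> in P. L (s + q) \<omega> = g (\<omega>, history q (future \<xi> U s \<omega>))"
proof (rule event_factor_imp_function_factor)
  show "L (s + q) \<in> borel_measurable (augmented_filtration P \<xi> U (s + q))"
    using assms by (intro predictable_section[where s = s and \<Omega> = "space P"])
      (auto simp: admissible_iff intro: filtration_mono[THEN subsetD])
  show "\<exists>B\<in>sets (past_space \<Otimes>\<^sub>M history_space q).
      AE \<omega> in P. \<omega> \<in> A \<longleftrightarrow> (\<omega>, history q (future \<xi> U s \<omega>)) \<in> B"
    if "A \<in> sets (augmented_filtration P \<xi> U (s + q))" for A
    by (rule filtration_event_factor[OF AE_regular_future s_nonneg that])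
qed simp

text \<open>
  At rational times the strategy is a family of rules indexed by the observations up to \<open>s\<close>.  Each of these rules has an
  expected gain of at most the value, and by independence the gain of the strategy is bounded by their mean.
\<close>

lemma strategy_bound:
  assumes L: "L \<in> admissible P T p \<xi> U s x"
  shows "expected_dividends P T p c \<xi> U s x L \<le> canonical_value c p (T - s) x Q"
proof -
  define \<R> where "\<R> = {q\<in>\<rat>. 0 < (q::real)}"
  have "\<forall>q\<in>\<R>. \<exists>g. g \<in> borel_measurable (past_space \<Otimes>\<^sub>M history_space q) \<and>
      (AE \<omega> in P. L (s + q) \<omega> = g (\<omega>, history q (future \<xi> U s \<omega>)))"
    using strategy_section_factor[OF L] unfolding \<R>_def by blast
  from bchoice[OF this] obtain g0 where g0: "\<forall>q\<in>\<R>. g0 q \<in> borel_measurable (past_space \<Otimes>\<^sub>M history_space q) \<and>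
      (AE \<omega> in P. L (s + q) \<omega> = g0 q (\<omega>, history q (future \<xi> U s \<omega>)))" ..
  \<comment> \<open>proposals matter at positive rational times only\<close>
  define g where "g q = (if q \<in> \<R> then g0 q else (\<lambda>_. 0))" for q
  have g: "g q \<in> borel_measurable (past_space \<Otimes>\<^sub>M history_space q)" for q
    using g0 by (simp add: g_def)
  define R where "R z = reward c p (T - s) x (\<lambda>q h. g q (fst z, h)) (snd z)" for z
  have R: "R \<in> borel_measurable (past_space \<Otimes>\<^sub>M path_space)"
    unfolding R_def by (rule measurable_reward_param[OF g canonical.c_pos canonical.p_nonneg r_nonneg x_nonneg])
  have R_bounds: "0 \<le> R z" "R z \<le> x + p * (T - s)" for z
    unfolding R_def by (rule reward_bounds[OF canonical.c_pos canonical.p_nonneg r_nonneg x_nonneg])+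
  have pair: "(\<lambda>\<omega>. (\<omega>, future \<xi> U s \<omega>)) \<in> measurable P (past_space \<Otimes>\<^sub>M path_space)"
    by (intro measurable_Pair measurable_past measurable_future)
  let ?h = "\<lambda>\<omega>. R (\<omega>, future \<xi> U s \<omega>)"
  have h: "?h \<in> borel_measurable P"
    by (rule measurable_compose[OF pair R])
  have "countable \<R>"
    unfolding \<R>_def by (rule countable_subset[OF _ countable_rat]) auto
  then have "AE \<omega> in P. \<forall>q\<in>\<R>. L (s + q) \<omega> = g q (\<omega>, history q (future \<xi> U s \<omega>))"
    using g0 by (subst AE_ball_countable) (auto simp: g_def)
  moreover have "AE \<omega> in P. admissible_path T p \<xi> U s x L \<omega>"
    using L by (simp add: admissible_iff)
  ultimately have le: "AE \<omega> in P. path_value L \<omega> \<le> ?h \<omega>"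
    using AE_regular_future
  proof eventually_elim
    case (elim \<omega>)
    interpret E: prob_space "exp_time c" by (rule prob_space_exp_time[OF canonical.c_pos])
    let ?b = "\<lambda>q h. g q (\<omega>, h)"
    have dom: "L (s + max 0 \<zeta>) \<omega> \<le> dividends p (T - s) x ?b (future \<xi> U s \<omega>) (max 0 \<zeta>)" for \<zeta>
      using rule_dominates[OF elim(2,3) s_le_T canonical.p_nonneg x_nonneg, of "s + max 0 \<zeta>" ?b] elim(1)
      by (simp add: \<R>_def)
    have mono: "L u \<omega> \<le> L v \<omega>" if "s \<le> u" "u \<le> v" for u v
    proof -
      have "mono_on {s..} (\<lambda>t. L t \<omega>)"
        using elim(2) by (simp add: admissible_path_def)
      from mono_onD[OF this, of u v] show ?thesis
        using that by simp
    qed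
    have bounds: "0 \<le> L (s + max 0 \<zeta>) \<omega>" "L (s + max 0 \<zeta>) \<omega> \<le> x + p * (T - s)" for \<zeta>
      using mono[of s "s + max 0 \<zeta>"] elim(2) order_trans[OF dom dividends_bounds(2)[OF canonical.p_nonneg r_nonneg x_nonneg]]
      by (simp_all add: admissible_path_def)
    have "(\<lambda>\<zeta>. L (s + max 0 \<zeta>) \<omega>) \<in> borel_measurable borel"
      by (rule borel_measurable_mono) (auto simp: mono_def intro!: mono)
    then have int: "integrable (exp_time c) (\<lambda>\<zeta>. L (s + max 0 \<zeta>) \<omega>)"
      using bounds by (intro E.integrable_const_bound[where B = "x + p * (T - s)"]) (auto intro!: AE_I2 simp: measurable_def)
    have "(\<lambda>\<zeta>. dividends p (T - s) x ?b (future \<xi> U s \<omega>) (max 0 \<zeta>)) \<in> borel_measurable borel"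
      by (rule measurable_compose[OF _ dividends_measurable_time[OF canonical.p_nonneg r_nonneg x_nonneg]]) simp
    then have int': "integrable (exp_time c) (\<lambda>\<zeta>. dividends p (T - s) x ?b (future \<xi> U s \<omega>) (max 0 \<zeta>))"
      using dividends_bounds[OF canonical.p_nonneg r_nonneg x_nonneg]
      by (intro E.integrable_const_bound[where B = "x + p * (T - s)"]) (auto intro!: AE_I2 simp: measurable_def)
    have "path_value L \<omega> = (\<integral>\<zeta>. L (s + max 0 \<zeta>) \<omega> \<partial>exp_time c)"
      by (rule admissible_path_reward[OF elim(2) s_le_T canonical.c_pos])
    also have "\<dots> \<le> (\<integral>\<zeta>. dividends p (T - s) x ?b (future \<xi> U s \<omega>) (max 0 \<zeta>) \<partial>exp_time c)"
      by (rule integral_mono[OF int int' dom])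
    also have "\<dots> = ?h \<omega>"
      using reward_eq[OF canonical.p_nonneg r_nonneg x_nonneg] by (simp add: R_def)
    finally show ?case .
  qed
  have int_h: "integrable P ?h"
    using R_bounds h by (intro integrable_const_bound[where B = "x + p * (T - s)"]) auto
  then have int_hc: "integrable (completion P) ?h"
    using integrable_completion[OF h] by simp
  \<comment> \<open>if the gain of the strategy is not integrable, its Bochner integral is 0, and \<open>R\<close> is nonnegative\<close>
  have "(\<integral>\<omega>. path_value L \<omega> \<partial>completion P) \<le> (\<integral>\<omega>. ?h \<omega> \<partial>completion P)"
  proof (cases "integrable (completion P) (path_value L)")
    case True
    then show ?thesis
      using int_hc le by (intro integral_mono_AE) (auto simp: AE_completion)
  next
    case False
    then show ?thesis
      using R_bounds by (simp add: not_integrable_integral_eq)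
  qed
  also have "\<dots> = (\<integral>\<omega>. ?h \<omega> \<partial>P)"
    by (rule integral_completion[OF h])
  also have "\<dots> = (\<integral>z. R z \<partial>distr P (past_space \<Otimes>\<^sub>M path_space) (\<lambda>\<omega>. (\<omega>, future \<xi> U s \<omega>)))"
    by (rule integral_distr[OF pair R, symmetric])
  also have "distr P (past_space \<Otimes>\<^sub>M path_space) (\<lambda>\<omega>. (\<omega>, future \<xi> U s \<omega>))
      = distr P past_space (\<lambda>\<omega>. \<omega>) \<Otimes>\<^sub>M Q"
    by (rule future_indep)
  also have "(\<integral>z. R z \<partial>(distr P past_space (\<lambda>\<omega>. \<omega>) \<Otimes>\<^sub>M Q)) \<le> canonical_value c p (T - s) x Q"
  proof -
    interpret PP: prob_space "distr P past_space (\<lambda>\<omega>. \<omega>)"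
      by (rule prob_space_distr[OF measurable_past])
    interpret PQ: pair_prob_space "distr P past_space (\<lambda>\<omega>. \<omega>)" Q ..
    have "R \<in> borel_measurable (distr P past_space (\<lambda>\<omega>. \<omega>) \<Otimes>\<^sub>M Q)"
      using R canonical.sets_P by (simp cong: measurable_cong_sets sets_pair_measure_cong)
    then have int: "integrable (distr P past_space (\<lambda>\<omega>. \<omega>) \<Otimes>\<^sub>M Q) R"
      using R_bounds by (intro PQ.P.integrable_const_bound[where B = "x + p * (T - s)"]) auto
    have "(\<integral>z. R z \<partial>(distr P past_space (\<lambda>\<omega>. \<omega>) \<Otimes>\<^sub>M Q))
      = (\<integral>\<rho>. (\<integral>e. R (\<rho>, e) \<partial>Q) \<partial>distr P past_space (\<lambda>\<omega>. \<omega>))"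
      by (rule PQ.integral_fst'[OF int, symmetric])
    also have "\<dots> \<le> canonical_value c p (T - s) x Q"
    proof (rule PP.integral_le_const[OF PQ.integrable_fst'[OF int]], rule AE_I2)
      fix \<rho> assume \<rho>: "\<rho> \<in> space (distr P past_space (\<lambda>\<omega>. \<omega>))"
      have "(\<lambda>q h. g q (\<rho>, h)) \<in> rules"
        unfolding rules_def
        using measurable_compose[OF measurable_Pair1' g] \<rho> by simp
      from canonical.value_upper[OF this r_nonneg x_nonneg]
      show "(\<integral>e. R (\<rho>, e) \<partial>Q) \<le> canonical_value c p (T - s) x Q"
        by (simp add: R_def)
    qed
    finally show ?thesis .
  qed
  finally show ?thesis
    by (simp add: expected_dividends_eq)
qed

lemma value_eq:
  "(SUP L\<in>admissible P T p \<xi> U s x. expected_dividends P T p c \<xi> U s x L) = canonical_value c p (T - s) x Q"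
proof (rule antisym)
  show "(SUP L\<in>admissible P T p \<xi> U s x. expected_dividends P T p c \<xi> U s x L) \<le> canonical_value c p (T - s) x Q"
    using rule_strategy(1)[OF rules_nonempty] by (intro cSUP_least strategy_bound) auto
  show "canonical_value c p (T - s) x Q \<le> (SUP L\<in>admissible P T p \<xi> U s x. expected_dividends P T p c \<xi> U s x L)"
  proof (rule canonical.value_least)
    fix b assume b: "b \<in> rules"
    show "(\<integral>e. reward c p (T - s) x b e \<partial>Q) \<le> (SUP L\<in>admissible P T p \<xi> U s x. expected_dividends P T p c \<xi> U s x L)"
      unfolding rule_strategy(2)[OF b, symmetric]
      by (intro cSUP_upper rule_strategy(1)[OF b] bdd_aboveI2[OF strategy_bound])
  qed
qed

end

text \<open>
  A law whose tails are prescribed on \<open>[0, \<infinity>)\<close>, with no mass left outside of \<open>(0, \<infinity>)\<close>.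
\<close>

lemma cdf_from_tail:
  assumes "real_distribution D" "real_distribution D'"
    and "\<And>t. 0 \<le> t \<Longrightarrow> measure D {t<..} = measure D' {t<..}" "measure D {0<..} = 1"
  shows "D = D'"
proof -
  interpret D: real_distribution D by fact
  interpret D': real_distribution D' by fact
  have c: "cdf D t = 1 - measure D {t<..}" "cdf D' t = 1 - measure D' {t<..}" for t
    using D.prob_compl[of "{t<..}"] D'.prob_compl[of "{t<..}"] unfolding cdf_def
    by (simp_all add: Compl_eq_Diff_UNIV[symmetric])
  have "cdf D t = cdf D' t" for t
  proof (cases "0 \<le> t")
    case True
    then show ?thesis using c assms(3) by simp
  next
    case False
    have "cdf D 0 = 0" "cdf D' 0 = 0"
      using c assms(3)[of 0] assms(4) by simp_all
    then show ?thesis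
      using False D.cdf_nondecreasing[of t 0] D'.cdf_nondecreasing[of t 0]
        D.cdf_nonneg[of t] D'.cdf_nonneg[of t] by simp
  qed
  then show ?thesis
    using cdf_unique[OF assms(1,2)] by blast
qed

definition shift_index :: "nat + nat \<Rightarrow> nat + nat" where
  "shift_index = map_sum Suc Suc"

lemma shift_index_image: "shift_index i \<in> Inl ` {1..} \<union> Inr ` {1..}"
  by (cases i) (auto simp: shift_index_def)

context sparre_andersen
begin

definition waiting_law :: "real measure" where
  "waiting_law = distr M borel (\<xi> 1)"

definition claim_law :: "real measure" where
  "claim_law = distr M borel (U 1)"

lemma measurable_waiting_claim: "\<xi> 1 \<in> borel_measurable M" "U 1 \<in> borel_measurable M"
proof -
  have "case_sum \<xi> U i \<in> borel_measurable M" if "i \<in> Inl ` {1..} \<union> Inr ` {1..}" for i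
    using indep that unfolding indep_vars_def by blast
  from this[of "Inl 1"] this[of "Inr 1"] show "\<xi> 1 \<in> borel_measurable M" "U 1 \<in> borel_measurable M"
    by auto
qed

lemma real_distribution_laws: "real_distribution waiting_law" "real_distribution claim_law"
  unfolding waiting_law_def claim_law_def
  using real_distribution_distr measurable_waiting_claim by blast+

lemma cdf_laws: "cdf waiting_law = F" "cdf claim_law = G"
  unfolding waiting_law_def claim_law_def using waiting_cdf[of 1] claim_cdf[of 1] by simp_all

sublocale model: dividend_model lam waiting_law claim_law c p
proof -
  interpret W: real_distribution waiting_law by (rule real_distribution_laws)
  interpret C: real_distribution claim_law by (rule real_distribution_laws)
  show "dividend_model lam waiting_law claim_law c p"
  proof
    show "continuous_on {0..} lam" by (rule intensity_cont)
    show "0 \<le> lam t" if "0 \<le> t" for t using intensity_nonneg that by blast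
    have "((\<lambda>t. 1 - F t) \<longlongrightarrow> 1 - 1) at_top"
      using W.cdf_lim_at_top_prob unfolding cdf_laws by (intro tendsto_intros)
    moreover have "\<forall>\<^sub>F t in at_top. 1 - F t = exp (- integral {0..t} lam)"
      using eventually_ge_at_top[of 0] by eventually_elim (rule survival)
    ultimately show "((\<lambda>t. exp (- integral {0..t} lam)) \<longlongrightarrow> 0) at_top"
      by (simp add: Lim_transform_eventually)
    have "F 0 = 0"
      using survival[of 0] by simp
    then have "W.prob {..0} = 0"
      using cdf_laws(1) by (simp add: cdf_def fun_eq_iff)
    then have "AE y in waiting_law. y \<notin> {..0}"
      by (intro AE_not_in) (simp add: null_sets_def W.emeasure_eq_measure)
    then show "AE y in waiting_law. 0 < y"
      by eventually_elim simp
    have "AE y in claim_law. y \<notin> {.. - 1 / real (Suc n)}" for n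
    proof -
      have "C.prob {.. - 1 / real (Suc n)} = 0"
        using cdf_laws(2) G_neg[of "- 1 / real (Suc n)"] by (simp add: cdf_def fun_eq_iff)
      then show ?thesis
        by (intro AE_not_in) (simp add: null_sets_def C.emeasure_eq_measure)
    qed
    then have "AE y in claim_law. \<forall>n. y \<notin> {.. - 1 / real (Suc n)}"
      by (simp add: AE_all_countable)
    then show "AE y in claim_law. 0 \<le> y"
    proof eventually_elim
      case (elim y)
      show ?case
      proof (rule ccontr)
        assume "\<not> 0 \<le> y"
        then obtain n where "1 / real (Suc n) < - y"
          using nat_approx_posE[of "- y"] by auto
        then show False
          using elim[rule_format, of n] by simp
      qed
    qed
    show "continuous_on {0..} (cdf claim_law)"
      unfolding cdf_laws by (rule G_cont)
    show "0 < c" by (rule c_pos)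
    show "0 \<le> p" using p_pos by simp
  qed
qed

context
  fixes s w :: real
  assumes s: "s \<in> {0..T}" and w: "w \<in> {0..s}"
begin

lemma conditional_prob: "prob_space (K s w)" "sets (K s w) = sets M" "space (K s w) = space M"
proof -
  have "w \<in> space (restrict_space borel {0..s})"
    using w by (simp add: space_restrict_space)
  then have "K s w \<in> space (prob_algebra M)"
    by (rule measurable_space[OF kernel[OF s]])
  then show "prob_space (K s w)" "sets (K s w) = sets M"
    by (auto simp: space_prob_algebra)
  then show "space (K s w) = space M"
    by (intro sets_eq_imp_space_eq)
qed

lemma future_shift: "future \<xi> U s \<omega> i = case_sum (waiting_after \<xi> s) (claim_after \<xi> U s) (shift_index i) \<omega>"
  by (cases i) (simp_all add: future_def shift_index_def)

interpretation K: prob_space "K s w"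
  by (rule conditional_prob)

lemma measurable_future_coord:
  assumes "i \<in> Inl ` {1..} \<union> Inr ` {1..}"
  shows "case_sum (waiting_after \<xi> s) (claim_after \<xi> U s) i \<in> borel_measurable (K s w)"
  using cond_indep[OF s w] assms unfolding K.indep_vars_def by blast

text \<open>
  The first waiting time is identified by its tails, the other coordinates by their distribution functions.
\<close>

lemma future_marginal:
  "distr (K s w) borel (case_sum (waiting_after \<xi> s) (claim_after \<xi> U s) (shift_index i))
    = path_marginal (model.residual w) waiting_law claim_law i"
proof -
  have rd: "real_distribution (distr (K s w) borel (case_sum (waiting_after \<xi> s) (claim_after \<xi> U s) (shift_index i)))"
    by (rule K.real_distribution_distr[OF measurable_future_coord[OF shift_index_image]])
  have w0: "0 \<le> w" using w by simp
  show ?thesis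
  proof (cases i)
    case (Inr k)
    then show ?thesis
      using cdf_unique[OF rd real_distribution_laws(2)] cond_claims[OF s w, of "Suc k"] cdf_laws
      by (simp add: shift_index_def path_marginal_def)
  next
    case (Inl k)
    show ?thesis
    proof (cases "k = 0")
      case False
      then show ?thesis
        using cdf_unique[OF rd real_distribution_laws(1)] cond_later_waiting[OF s w, of "Suc k"] cdf_laws Inl
        by (simp add: shift_index_def path_marginal_def)
    next
      case True
      have m: "waiting_after \<xi> s 1 \<in> borel_measurable (K s w)"
        using measurable_future_coord[of "Inl 1"] by simp
      have tail: "measure (distr (K s w) borel (waiting_after \<xi> s 1)) {t<..} = exp (- integral {w..w + t} lam)"
        if "0 \<le> t" for t
      proof -
        have "waiting_after \<xi> s 1 -` {t<..} \<inter> space (K s w) = {\<omega> \<in> space M. waiting_after \<xi> s 1 \<omega> > t}"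
          using conditional_prob(3) by auto
        then show ?thesis
          using cond_first_waiting[OF s w that] measure_distr[OF m, of "{t<..}"] by simp
      qed
      have tail': "measure (model.residual w) {t<..} = exp (- integral {w..w + t} lam)" if "0 \<le> t" for t
        using model.residual_tail[OF w0 that] by (simp add: measure_def)
      have "distr (K s w) borel (waiting_after \<xi> s 1) = model.residual w"
        using rd Inl True tail tail'
        by (intro cdf_from_tail model.real_distribution_residual w0) (auto simp: shift_index_def)
      then show ?thesis
        using Inl True by (simp add: shift_index_def path_marginal_def)
    qed
  qed
qed

lemma measurable_future_path: "future \<xi> U s \<in> measurable (K s w) path_space"
  by (rule measurable_PiM_single')
     (simp_all add: future_shift measurable_future_coord[OF shift_index_image] space_PiM)

text \<open>
  The coordinates are independent, so their joint law is the product of the marginals; the rest of the proof is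
  the change of numbering by \<^const>\<open>shift_index\<close>.
\<close>

lemma future_path_law: "distr (K s w) path_space (future \<xi> U s) = model.law w"
proof -
  define I :: "(nat + nat) set" where "I = Inl ` {1..} \<union> Inr ` {1..}"
  define X where "X = case_sum (waiting_after \<xi> s) (claim_after \<xi> U s)"
  have "Inl 1 \<in> I" by (auto simp: I_def)
  have XI: "X i \<in> borel_measurable (K s w)" if "i \<in> I" for i
    using measurable_future_coord that by (simp add: I_def X_def)
  have \<phi>: "inj_on shift_index UNIV" "shift_index \<in> UNIV \<rightarrow> I"
    using shift_index_image by (auto simp: I_def shift_index_def intro: sum.inj_map)
  have mPi: "(\<lambda>\<omega>. \<lambda>i\<in>I. X i \<omega>) \<in> measurable (K s w) (PiM I (\<lambda>_. borel))"
    by (intro measurable_restrict XI)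
  have "K.indep_vars (\<lambda>_. borel) X I"
    using cond_indep[OF s w] by (simp add: I_def X_def)
  then have joint: "distr (K s w) (PiM I (\<lambda>_. borel)) (\<lambda>\<omega>. \<lambda>i\<in>I. X i \<omega>)
      = PiM I (\<lambda>i. distr (K s w) borel (X i))"
    using K.indep_vars_iff_distr_eq_PiM'[where I = I and M' = "\<lambda>_. borel" and X = X] XI \<open>Inl 1 \<in> I\<close>
    by blast
  have mphi: "(\<lambda>f. \<lambda>n\<in>UNIV. f (shift_index n)) \<in> measurable (PiM I (\<lambda>_. borel)) path_space"
    using \<phi>(2) by (intro measurable_restrict measurable_component_singleton) auto
  have "distr (K s w) path_space (future \<xi> U s)
    = distr (distr (K s w) (PiM I (\<lambda>_. borel)) (\<lambda>\<omega>. \<lambda>i\<in>I. X i \<omega>)) path_space (\<lambda>f. \<lambda>n\<in>UNIV. f (shift_index n))"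
    unfolding distr_distr[OF mphi mPi]
    using \<phi>(2) by (intro distr_cong) (auto simp: fun_eq_iff future_shift X_def)
  also have "\<dots> = distr (PiM I (\<lambda>i. distr (K s w) borel (X i))) (PiM UNIV (\<lambda>n. distr (K s w) borel (X (shift_index n))))
      (\<lambda>f. \<lambda>n\<in>UNIV. f (shift_index n))"
    unfolding joint by (intro distr_cong sets_PiM_cong) auto
  also have "\<dots> = PiM UNIV (\<lambda>n. distr (K s w) borel (X (shift_index n)))"
    using \<phi> K.prob_space_distr[OF XI] by (intro distr_PiM_reindex) auto
  also have "\<dots> = model.law w"
    unfolding path_law_def X_def future_marginal ..
  finally show ?thesis .
qed

lemma past_events: "sets (past (space (K s w)) \<xi> U s) \<subseteq> sets (K s w)"
  using cond_indep_past[OF s w] unfolding K.indep_sets2_eq sets_past conditional_prob(3) by blast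

lemma measurable_past_id: "(\<lambda>\<omega>. \<omega>) \<in> measurable (K s w) (past (space (K s w)) \<xi> U s)"
proof (rule measurableI)
  fix A assume A: "A \<in> sets (past (space (K s w)) \<xi> U s)"
  then have "(\<lambda>\<omega>. \<omega>) -` A \<inter> space (K s w) = A"
    using sets.sets_into_space[OF A] by auto
  then show "(\<lambda>\<omega>. \<omega>) -` A \<inter> space (K s w) \<in> sets (K s w)"
    using A past_events by auto
qed simp

text \<open>
  Independence of \<open>\<sigma>\<close>-algebras gives equality on rectangles, which determine a product measure.
\<close>

lemma future_indep_past:
  "distr (K s w) (past (space (K s w)) \<xi> U s \<Otimes>\<^sub>M path_space) (\<lambda>\<omega>. (\<omega>, future \<xi> U s \<omega>))
    = distr (K s w) (past (space (K s w)) \<xi> U s) (\<lambda>\<omega>. \<omega>) \<Otimes>\<^sub>M model.law w"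
proof (rule pair_measure_eqI[symmetric])
  let ?past = "past (space (K s w)) \<xi> U s"
  interpret PP: prob_space "distr (K s w) ?past (\<lambda>\<omega>. \<omega>)"
    by (rule K.prob_space_distr[OF measurable_past_id])
  interpret Q: prob_space "model.law w"
    unfolding future_path_law[symmetric] by (rule K.prob_space_distr[OF measurable_future_path])
  show "sigma_finite_measure (distr (K s w) ?past (\<lambda>\<omega>. \<omega>))" "sigma_finite_measure (model.law w)"
    by unfold_locales
  show "sets (distr (K s w) ?past (\<lambda>\<omega>. \<omega>) \<Otimes>\<^sub>M model.law w)
      = sets (distr (K s w) (?past \<Otimes>\<^sub>M path_space) (\<lambda>\<omega>. (\<omega>, future \<xi> U s \<omega>)))"
    unfolding future_path_law[symmetric] by (simp cong: sets_pair_measure_cong)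
  define H where "H = {case_sum (waiting_after \<xi> s) (claim_after \<xi> U s) i -` B \<inter> space M | i B.
    i \<in> Inl ` {1..} \<union> Inr ` {1..} \<and> B \<in> sets borel}"
  have ind: "K.indep_set (sigma_sets (space M) (observation_events (space M) \<xi> U s)) (sigma_sets (space M) H)"
    using cond_indep_past[OF s w] unfolding H_def .
  have H: "H \<subseteq> Pow (space M)"
    by (auto simp: H_def)
  have fut: "future \<xi> U s \<in> measurable (sigma (space M) H) path_space"
  proof (rule measurable_PiM_single')
    fix i
    show "(\<lambda>\<omega>. future \<xi> U s \<omega> i) \<in> borel_measurable (sigma (space M) H)"
    proof (rule measurableI)
      fix B :: "real set" assume "B \<in> sets borel"
      then have "(\<lambda>\<omega>. future \<xi> U s \<omega> i) -` B \<inter> space M \<in> H"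
        unfolding H_def future_shift using shift_index_image[of i] by blast
      then show "(\<lambda>\<omega>. future \<xi> U s \<omega> i) -` B \<inter> space (sigma (space M) H) \<in> sets (sigma (space M) H)"
        using H by (auto intro: sigma_sets.Basic)
    qed simp
  qed (simp add: space_PiM)
  fix A B assume A: "A \<in> sets (distr (K s w) ?past (\<lambda>\<omega>. \<omega>))" and B: "B \<in> sets (model.law w)"
  have A': "A \<in> sets ?past" "A \<subseteq> space (K s w)"
    using A sets.sets_into_space[of A ?past] by auto
  have B': "B \<in> sets path_space"
    using B unfolding future_path_law[symmetric] by simp
  have "A \<in> sigma_sets (space M) (observation_events (space M) \<xi> U s)"
    using A'(1) unfolding sets_past conditional_prob(3) .
  moreover have "future \<xi> U s -` B \<inter> space M \<in> sigma_sets (space M) H"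
    using measurable_sets[OF fut B'] H by simp
  ultimately have "K.prob (A \<inter> (future \<xi> U s -` B \<inter> space (K s w)))
      = K.prob A * K.prob (future \<xi> U s -` B \<inter> space (K s w))"
    using ind unfolding K.indep_sets2_eq conditional_prob(3) by blast
  moreover have "emeasure (distr (K s w) ?past (\<lambda>\<omega>. \<omega>)) A = emeasure (K s w) A"
    using A' by (subst emeasure_distr[OF measurable_past_id]) (auto simp: Int_absorb2 intro!: arg_cong[where f = "emeasure (K s w)"])
  moreover have "emeasure (model.law w) B = emeasure (K s w) (future \<xi> U s -` B \<inter> space (K s w))"
    unfolding future_path_law[symmetric] by (rule emeasure_distr[OF measurable_future_path B'])
  moreover have "emeasure (distr (K s w) (?past \<Otimes>\<^sub>M path_space) (\<lambda>\<omega>. (\<omega>, future \<xi> U s \<omega>))) (A \<times> B)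
      = emeasure (K s w) (A \<inter> (future \<xi> U s -` B \<inter> space (K s w)))"
    using A' B' by (subst emeasure_distr[OF measurable_Pair[OF measurable_past_id measurable_future_path]])
      (auto intro!: arg_cong[where f = "emeasure (K s w)"])
  ultimately show "emeasure (distr (K s w) ?past (\<lambda>\<omega>. \<omega>)) A * emeasure (model.law w) B
      = emeasure (distr (K s w) (?past \<Otimes>\<^sub>M path_space) (\<lambda>\<omega>. (\<omega>, future \<xi> U s \<omega>))) (A \<times> B)"
    by (simp add: K.emeasure_eq_measure ennreal_mult')
qed

lemma value_function_eq:
  assumes "0 \<le> x"
  shows "value_function K T p c \<xi> U s x w = model.v (T - s) x w"
proof -
  have w0: "0 \<le> w" using w by simp
  interpret canonical: path_prob "model.law w" c p
    by (rule model.path_prob_law[OF w0])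
  interpret start: initial_law "K s w" "model.law w" c p \<xi> U s T x
    by unfold_locales (use s assms measurable_past_id measurable_future_path future_path_law future_indep_past in auto)
  show ?thesis
    unfolding value_function_def model.v_def by (rule start.value_eq)
qed

end

lemma value_function_continuous:
  "continuous_on (state_domain T) (\<lambda>(s, x, w). value_function K T p c \<xi> U s x w)"
  unfolding continuous_on_sequentially
proof (intro ballI allI impI, elim conjE)
  fix z :: "observation" and y
  assume z: "z \<in> state_domain T" and y: "\<forall>n. y n \<in> state_domain T" and lim: "y \<longlonglongrightarrow> z"
  let ?f = "\<lambda>(s, x, w). value_function K T p c \<xi> U s x w"
  have eq: "?f u = model.v (T - fst u) (fst (snd u)) (snd (snd u))" if "u \<in> state_domain T" for u
    using that value_function_eq by (auto simp: state_domain_def)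
  have dom: "0 \<le> fst u" "fst u \<le> T" "0 \<le> fst (snd u)" "0 \<le> snd (snd u)" if "u \<in> state_domain T" for u
    using that by (auto simp: state_domain_def)
  have "(\<lambda>n. model.v (T - fst (y n)) (fst (snd (y n))) (snd (snd (y n))))
      \<longlonglongrightarrow> model.v (T - fst z) (fst (snd z)) (snd (snd z))"
    using dom[OF z] dom[OF y[rule_format]] lim
    by (intro model.v_continuous tendsto_intros) auto
  then show "(?f \<circ> y) \<longlonglongrightarrow> ?f z"
    using eq[OF z] eq[OF y[rule_format]] by (simp add: comp_def)
qed

end

theorem corollary3p6:
  fixes M :: "'a measure" and T p c :: real
    and \<xi> U :: "nat \<Rightarrow> 'a \<Rightarrow> real"
    and F f G lam :: "real \<Rightarrow> real"
    and K :: "real \<Rightarrow> real \<Rightarrow> 'a measure"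
  assumes "sparre_andersen M T p c \<xi> U F f G lam K"
  shows "continuous_on (state_domain T) (\<lambda>(s, x, w). value_function K T p c \<xi> U s x w) \<and>
    (\<forall>C. compact C \<and> C \<subseteq> state_domain T \<longrightarrow>
       uniformly_continuous_on C (\<lambda>(s, x, w). value_function K T p c \<xi> U s x w))"
  using sparre_andersen.value_function_continuous[OF assms]
  by (blast intro: compact_uniformly_continuous continuous_on_subset)

end
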